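(* Let $(\mathcal{S},\mathcal{B}_F,\psi,Q)$ be a classical solution of the water-wave problem such that $\psi_Y<0$ in $\Omega$. Then $T[\psi]\le 0$ in $\overline\Omega$, where $$T[\psi](X,Y):=\tfrac12|\nabla\psi(X,Y)|^2+gY-\tfrac12Q+\hat\Gamma(\psi(X,Y))-\varpi\,\psi(X,Y),$$ $$\hat\Gamma(r):=\int_0^r\gamma(t)\,dt\ \ (r\in[0,B]),\qquad \varpi:=\tfrac12\max\Big\{0,\max_{r\in[0,B]}\gamma(r)\Big\}.$$
   Context: Fix constants $g,B,L>0$, $\alpha\in(0,1)$ and $\gamma\in C^{1,\alpha}([0,B])$. For $F\in\mathbb{R}$, $\mathcal{B}_F:=\{(X,F):X\in\mathbb{R}\}$. $\mathcal{S}=\{(u(s),v(s)):s\in\mathbb{R}\}$ is a non-self-intersecting locally rectifiable curve lying in $\{Y>F\}$, $2L$-periodic in the horizontal direction (for some $\omega>0$, $u(s+\omega)=u(s)+2L$, $v(s+\omega)=v(s)$ for all $s$), and $\Omega$ is the domain lying above $\mathcal{B}_F$ and below $\mathcal{S}$, with boundary $\mathcal{S}\cup\mathcal{B}_F$. $Q\in\mathbb{R}$. The water-wave problem is: $\Delta\psi=-\gamma(\psi)$ in $\Omega$; $0\le\psi\le B$ in $\Omega$; $\psi=B$ on $\mathcal{B}_F$; $\psi=0$ on $\mathcal{S}$; $|\nabla\psi|^2+2gY=Q$ on $\mathcal{S}$. It is always required that $\psi\in\mathrm{Lip}(\overline\Omega)$, that $\psi$ is $2L$-periodic in $X$, that $0\le\psi\le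 B$ in $\Omega$, $\psi=B$ on $\mathcal{B}_F$, $\psi=0$ on $\mathcal{S}$ hold classically, and that $\int_{\Omega}\nabla\psi\cdot\nabla\zeta\,d\mathcal{L}^2=\int_\Omega\gamma(\psi)\zeta\,d\mathcal{L}^2$ for all $\zeta\in C^1_0(\Omega)$ (compactly supported $C^1$ functions); then $\psi\in C^{3,\alpha}_{\rm loc}(\Omega\cup\mathcal{B}_F)$ and the PDE holds classically. Such a $(\mathcal{S},\mathcal{B}_F,\psi,Q)$ is a classical solution if $\mathcal{S}$ is a $C^1$ curve, $\psi\in C^1(\Omega\cup\mathcal{S})$ and $|\nabla\psi|^2+2gY=Q$ holds everywhere on $\mathcal{S}$. *)

theory Defs
  imports "HOL-Analysis.Analysis"
begin

section \<open>Regularity classes\<close>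

text \<open>\<open>C\<^sup>1\<^sup>,\<^sup>\<alpha>(S)\<close> for a compact interval \<open>S\<close>; at the end points the derivative is one-sided.
  Note \<open>0 powr \<alpha> = 0\<close>.\<close>

definition C1_holder_on :: "real \<Rightarrow> real set \<Rightarrow> (real \<Rightarrow> real) \<Rightarrow> bool" where
  "C1_holder_on \<alpha> S f \<longleftrightarrow>
     (\<exists>f'. (\<forall>x\<in>S. (f has_real_derivative f' x) (at x within S)) \<and>
           (\<exists>C. \<forall>x\<in>S. \<forall>y\<in>S. \<bar>f' x - f' y\<bar> \<le> C * \<bar>x - y\<bar> powr \<alpha>))"

text \<open>Points of the plane are pairs \<open>(X, Y)\<close>, with the Euclidean norm and inner product of
  \<^typ>\<open>real \<times> real\<close>.\<close>

definition grad :: "(real \<times> real \<Rightarrow> real) \<Rightarrow> real \<times> real \<Rightarrow> real \<times> real" where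
  "grad f p = (frechet_derivative f (at p) (1, 0), frechet_derivative f (at p) (0, 1))"

text \<open>The gradient on \<open>closure \<Omega>\<close>, i.e. the continuous extension of the gradient in the open set
  \<open>\<Omega>\<close>. Values of \<open>f\<close> outside \<open>\<Omega>\<close> are irrelevant.\<close>

definition grad_cl :: "(real \<times> real) set \<Rightarrow> (real \<times> real \<Rightarrow> real) \<Rightarrow> real \<times> real \<Rightarrow> real \<times> real" where
  "grad_cl \<Omega> f p = Lim (at p within \<Omega>) (grad f)"

text \<open>\<open>f \<in> C\<^sup>1(\<Omega> \<union> E)\<close> for \<open>\<Omega>\<close> open and \<open>E \<subseteq> frontier \<Omega>\<close>: \<open>f\<close> is differentiable in \<open>\<Omega>\<close>, and \<open>f\<close> and
  its gradient extend continuously to \<open>\<Omega> \<union> E\<close>.\<close>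

definition C1_upto :: "(real \<times> real) set \<Rightarrow> (real \<times> real) set \<Rightarrow> (real \<times> real \<Rightarrow> real) \<Rightarrow> bool" where
  "C1_upto \<Omega> E f \<longleftrightarrow>
     (\<forall>p\<in>\<Omega>. f differentiable (at p)) \<and>
     continuous_on (\<Omega> \<union> E) f \<and>
     (\<exists>G. continuous_on (\<Omega> \<union> E) G \<and> (\<forall>p\<in>\<Omega>. G p = grad f p))"

text \<open>Elements of \<open>C\<^sup>1\<^sub>0(\<Omega>)\<close>, extended by zero to the plane.\<close>

definition C1_test_fun :: "(real \<times> real) set \<Rightarrow> (real \<times> real \<Rightarrow> real) \<Rightarrow> bool" where
  "C1_test_fun \<Omega> \<zeta> \<longleftrightarrow>
     (\<forall>p. \<zeta> differentiable (at p)) \<and> continuous_on UNIV (grad \<zeta>) \<and>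
     compact (closure {p. \<zeta> p \<noteq> 0}) \<and> closure {p. \<zeta> p \<noteq> 0} \<subseteq> \<Omega>"

section \<open>Free surface, bed and fluid domain\<close>

definition bed :: "real \<Rightarrow> (real \<times> real) set" where
  "bed F = {(X, Y). Y = F}"

definition locally_rectifiable :: "(real \<Rightarrow> real \<times> real) \<Rightarrow> bool" where
  "locally_rectifiable c \<longleftrightarrow>
     (\<forall>a b. \<exists>M. \<forall>n (t :: nat \<Rightarrow> real).
        (\<forall>i\<le>n. t i \<in> {a..b}) \<and> (\<forall>i<n. t i \<le> t (Suc i)) \<longrightarrow>
        (\<Sum>i<n. dist (c (t i)) (c (t (Suc i)))) \<le> M)"

definition free_surface :: "real \<Rightarrow> real \<Rightarrow> (real \<times> real) set \<Rightarrow> bool" where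
  "free_surface L F S \<longleftrightarrow>
     (\<exists>u v :: real \<Rightarrow> real.
        S = range (\<lambda>s. (u s, v s)) \<and>
        continuous_on UNIV u \<and> continuous_on UNIV v \<and>
        inj (\<lambda>s. (u s, v s)) \<and>
        locally_rectifiable (\<lambda>s. (u s, v s)) \<and>
        (\<forall>s. F < v s) \<and>
        (\<exists>\<omega>>0. \<forall>s. u (s + \<omega>) = u s + 2 * L \<and> v (s + \<omega>) = v s))"

definition C1_curve :: "(real \<times> real) set \<Rightarrow> bool" where
  "C1_curve S \<longleftrightarrow>
     (\<exists>c :: real \<Rightarrow> real \<times> real.
        S = range c \<and> inj c \<and> c C1_differentiable_on UNIV \<and>
        (\<forall>s. vector_derivative c (at s) \<noteq> 0))"

text \<open>\<open>S\<close> need not be a graph. That \<open>\<Omega>\<close> lies below \<open>S\<close> is expressed by its height being bounded,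
  which excludes the other component of the half-plane \<open>Y > F\<close> without \<open>S\<close>.\<close>

definition fluid_domain :: "(real \<times> real) set \<Rightarrow> real \<Rightarrow> (real \<times> real) set \<Rightarrow> bool" where
  "fluid_domain S F \<Omega> \<longleftrightarrow>
     open \<Omega> \<and> connected \<Omega> \<and> \<Omega> \<noteq> {} \<and>
     (\<forall>(X, Y)\<in>\<Omega>. F < Y) \<and> bdd_above (snd ` \<Omega>) \<and>
     frontier \<Omega> = S \<union> bed F"

section \<open>The water-wave problem\<close>

text \<open>The requirements common to all notions of solution. Lipschitz functions are differentiable
  only almost everywhere, so the weak form uses the complete Lebesgue measure.\<close>

definition stream_function ::
  "real \<Rightarrow> real \<Rightarrow> (real \<Rightarrow> real) \<Rightarrow> (real \<times> real) set \<Rightarrow> real \<Rightarrow> (real \<times> real) set \<Rightarrow>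
   (real \<times> real \<Rightarrow> real) \<Rightarrow> bool" where
  "stream_function B L \<gamma> S F \<Omega> \<psi> \<longleftrightarrow>
     (\<exists>C. C-lipschitz_on (closure \<Omega>) \<psi>) \<and>
     (\<forall>(X, Y)\<in>closure \<Omega>. \<psi> (X + 2 * L, Y) = \<psi> (X, Y)) \<and>
     (\<forall>p\<in>\<Omega>. 0 \<le> \<psi> p \<and> \<psi> p \<le> B) \<and>
     (\<forall>p\<in>bed F. \<psi> p = B) \<and>
     (\<forall>p\<in>S. \<psi> p = 0) \<and>
     (\<forall>\<zeta>. C1_test_fun \<Omega> \<zeta> \<longrightarrow>
        (LINT p:\<Omega>|lebesgue. grad \<psi> p \<bullet> grad \<zeta> p) = (LINT p:\<Omega>|lebesgue. \<gamma> (\<psi> p) * \<zeta> p))"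

definition classical_solution ::
  "real \<Rightarrow> real \<Rightarrow> real \<Rightarrow> (real \<Rightarrow> real) \<Rightarrow> (real \<times> real) set \<Rightarrow> real \<Rightarrow> (real \<times> real) set \<Rightarrow>
   (real \<times> real \<Rightarrow> real) \<Rightarrow> real \<Rightarrow> bool" where
  "classical_solution g B L \<gamma> S F \<Omega> \<psi> Q \<longleftrightarrow>
     free_surface L F S \<and> fluid_domain S F \<Omega> \<and> stream_function B L \<gamma> S F \<Omega> \<psi> \<and>
     C1_curve S \<and> C1_upto \<Omega> S \<psi> \<and>
     (\<forall>p\<in>S. (norm (grad_cl \<Omega> \<psi> p))\<^sup>2 + 2 * g * snd p = Q)"

section \<open>The functional \<open>T\<close>\<close>

definition Gamma_hat :: "(real \<Rightarrow> real) \<Rightarrow> real \<Rightarrow> real" where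
  "Gamma_hat \<gamma> r = integral {0..r} \<gamma>"

text \<open>For continuous \<open>\<gamma>\<close> the supremum is attained.\<close>

definition varpi :: "real \<Rightarrow> (real \<Rightarrow> real) \<Rightarrow> real" where
  "varpi B \<gamma> = 1 / 2 * max 0 (SUP r\<in>{0..B}. \<gamma> r)"

definition T_fun ::
  "real \<Rightarrow> real \<Rightarrow> (real \<Rightarrow> real) \<Rightarrow> (real \<times> real) set \<Rightarrow> real \<Rightarrow> (real \<times> real \<Rightarrow> real) \<Rightarrow>
   real \<times> real \<Rightarrow> real" where
  "T_fun g B \<gamma> \<Omega> Q \<psi> p =
     1 / 2 * (norm (grad_cl \<Omega> \<psi> p))\<^sup>2 + g * snd p - 1 / 2 * Q
     + Gamma_hat \<gamma> (\<psi> p) - varpi B \<gamma> * \<psi> p"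

end

theory Submission
  imports Defs "HOL-Computational_Algebra.Polynomial" "HOL-Library.Periodic_Fun"
begin

text \<open>Write \<open>\<omega>\<close> for \<^const>\<open>varpi\<close>. For smooth \<open>\<psi>\<close> the Hessian of \<open>\<psi>\<close> can be eliminated from the
Laplacian of \<open>T\<close>: it is a symmetric \<open>2 \<times> 2\<close> matrix with trace \<open>- \<gamma>(\<psi>)\<close>, and \<open>\<nabla>T\<close> determines its
product with \<open>\<nabla>\<psi>\<close>. By the Cayley--Hamilton theorem
\<open>|\<nabla>\<psi>|\<^sup>2 \<Delta>T = 2 g\<^sup>2 + (2\<omega> - \<gamma>(\<psi>)) (\<omega> |\<nabla>\<psi>|\<^sup>2 - 2 g \<psi>\<^sub>Y)\<close> wherever \<open>\<nabla>T = 0\<close>. The right-hand side is at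
least \<open>2 g\<^sup>2 > 0\<close> because \<open>\<gamma> \<le> 2\<omega>\<close> and \<open>\<psi>\<^sub>Y \<le> 0\<close>, so \<open>T\<close> has no interior maximum. On the bed
\<open>\<psi>\<^sub>X = \<psi>\<^sub>X\<^sub>X = 0\<close> and \<open>\<psi>\<^sub>Y\<^sub>Y = - \<gamma>(B)\<close>, so \<open>T\<^sub>Y = g - \<omega> \<psi>\<^sub>Y > 0\<close> and the bed carries no maximum either. By
periodicity \<open>T\<close> attains its maximum, which therefore lies on the free surface, where the Bernoulli
condition says \<open>T = 0\<close>.

This argument needs three derivatives of \<open>\<psi>\<close>, while \<open>\<psi>\<close> is a \<open>C\<^sup>1\<close> function that solves the equation
only weakly. Instead of proving that \<open>\<psi>\<close> is smooth, the argument is carried out for averages of \<open>\<psi>\<close> in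
the horizontal direction (\<open>moll\<close>). Horizontal derivatives of such an average fall on the
kernel. Testing the weak equation with products \<open>A(X) D(Y)\<close> shows that the vertical derivative of an
average is differentiable and that the average solves a Poisson equation in the classical sense
(\<open>moll_R_deriv_t\<close>). Horizontal averaging respects the bed: the averages still equal \<open>B\<close> there, they
stay between \<open>0\<close> and \<open>B\<close>, and they still decrease upwards. Since the averages converge together with
their gradients, a maximum of \<open>T\<close> yields maxima of the averaged and slightly perturbed \<open>T\<close>
at nearby points, and the formula above is violated there in the limit (\<open>no_maximum\<close>).

For \<open>T\<close> to be meaningful and continuous on the bed, \<open>\<nabla>\<psi>\<close> must have limits there. The horizontal
derivative of an average vanishes on the bed and solves a Poisson equation with bounded right-hand
side. One barrier (\<open>linear_barrier\<close>), applied to it and then to its symmetric horizontal differences,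
bounds it by a multiple of the distance to the bed and bounds the second horizontal derivative
of the average. The equation then bounds the second vertical derivative, so \<open>\<psi>\<^sub>Y\<close> is Lipschitz in the
vertical direction up to the bed (\<open>P_limit\<close>, \<open>R_limit\<close>).\<close>

section \<open>Smoothing kernels\<close>

text \<open>The kernel is handed over together with its derivatives: \<open>k n\<close> is the \<open>n\<close>-th derivative of \<open>k 0\<close>.
Three derivatives suffice below, and with finitely many of them a truncated polynomial will do.\<close>

definition mollifier :: "real \<Rightarrow> (nat \<Rightarrow> real \<Rightarrow> real) \<Rightarrow> bool" where
  "mollifier \<epsilon> k \<longleftrightarrow> 0 < \<epsilon> \<and>
     (\<forall>n<3. \<forall>t. (k n has_real_derivative k (Suc n) t) (at t)) \<and>
     (\<forall>n\<le>3. continuous_on UNIV (k n)) \<and>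
     (\<forall>n\<le>3. \<forall>t. \<epsilon> \<le> \<bar>t\<bar> \<longrightarrow> k n t = 0) \<and>
     (\<forall>t. 0 \<le> k 0 t) \<and> integral {-\<epsilon>..\<epsilon>} (k 0) = 1"

lemma mollifierD:
  assumes "mollifier \<epsilon> k"
  shows mollifier_pos: "0 < \<epsilon>"
    and mollifier_deriv: "n < 3 \<Longrightarrow> (k n has_real_derivative k (Suc n) t) (at t)"
    and mollifier_cont: "n \<le> 3 \<Longrightarrow> continuous_on UNIV (k n)"
    and mollifier_eq_0: "n \<le> 3 \<Longrightarrow> \<epsilon> \<le> \<bar>t\<bar> \<Longrightarrow> k n t = 0"
    and mollifier_nonneg: "0 \<le> k 0 t"
    and mollifier_integral: "integral {-\<epsilon>..\<epsilon>} (k 0) = 1"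
  using assms unfolding mollifier_def by blast+

lemma has_real_derivative_0_squeeze:
  fixes f g :: "real \<Rightarrow> real"
  assumes "(f has_real_derivative 0) (at x)" "f x = 0" "\<And>t. \<bar>g t\<bar> \<le> \<bar>f t\<bar>"
  shows "(g has_real_derivative 0) (at x)"
proof -
  have gx: "g x = 0" using assms(2) assms(3)[of x] by simp
  have "((\<lambda>y. f y / (y - x)) \<longlongrightarrow> 0) (at x)"
    using assms(1,2) by (simp add: has_field_derivative_iff)
  then have "((\<lambda>y. g y / (y - x)) \<longlongrightarrow> 0) (at x)"
    by (rule Lim_null_comparison[rotated, OF tendsto_norm_zero])
      (auto simp: abs_mult divide_inverse intro!: always_eventually mult_right_mono assms(3))
  then show ?thesis by (simp add: has_field_derivative_iff gx)
qed

lemma truncated_poly_has_derivative: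
  fixes p :: "real poly"
  assumes "0 < \<epsilon>"
    and "poly p \<epsilon> = 0" "poly p (-\<epsilon>) = 0" "poly (pderiv p) \<epsilon> = 0" "poly (pderiv p) (-\<epsilon>) = 0"
  shows "((\<lambda>t. if \<bar>t\<bar> \<le> \<epsilon> then poly p t else 0) has_real_derivative
           (if \<bar>t\<bar> \<le> \<epsilon> then poly (pderiv p) t else 0)) (at t)" (is "(?g has_real_derivative _) _")
proof -
  consider "\<bar>t\<bar> < \<epsilon>" | "\<bar>t\<bar> > \<epsilon>" | "t = \<epsilon>" | "t = -\<epsilon>" by linarith
  then show ?thesis
  proof cases
    case 1
    have "(?g has_real_derivative poly (pderiv p) t) (at t)"
      by (rule has_field_derivative_transform_within_open[OF poly_DERIV, of "{-\<epsilon><..<\<epsilon>}"])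
        (use 1 in auto)
    then show ?thesis using 1 by simp
  next
    case 2
    have "(?g has_real_derivative 0) (at t)"
      by (rule has_field_derivative_transform_within_open[where f = "\<lambda>_. 0" and S = "-{-\<epsilon>..\<epsilon>}"])
        (use 2 in auto)
    then show ?thesis using 2 by simp
  next
    case 3
    have "(?g has_real_derivative 0) (at t)"
      by (rule has_real_derivative_0_squeeze[of "poly p"]) (use 3 assms poly_DERIV[of p t] in auto)
    then show ?thesis using 3 assms by simp
  next
    case 4
    have "(?g has_real_derivative 0) (at t)"
      by (rule has_real_derivative_0_squeeze[of "poly p"]) (use 4 assms poly_DERIV[of p t] in auto)
    then show ?thesis using 4 assms by simp
  qed
qed

lemma truncated_poly_continuous:
  fixes p :: "real poly"
  assumes "poly p \<epsilon> = 0" "poly p (-\<epsilon>) = 0" "0 < \<epsilon>"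
  shows "continuous_on UNIV (\<lambda>t. if \<bar>t\<bar> \<le> \<epsilon> then poly p t else 0)"
proof -
  have "continuous_on UNIV (\<lambda>t. poly p (max (-\<epsilon>) (min \<epsilon> t)))"
    by (intro continuous_intros)
  also have "(\<lambda>t. poly p (max (-\<epsilon>) (min \<epsilon> t))) = (\<lambda>t. if \<bar>t\<bar> \<le> \<epsilon> then poly p t else 0)"
    using assms by (auto simp: max_def min_def fun_eq_iff)
  finally show ?thesis .
qed

lemma power_dvd_pderiv:
  fixes p q :: "real poly"
  assumes "q ^ Suc m dvd p"
  shows "q ^ m dvd pderiv p"
proof -
  obtain r where "p = q ^ Suc m * r" using assms by (auto simp: dvd_def)
  then have "pderiv p = q ^ m * (q * pderiv r + smult (of_nat (Suc m)) (r * pderiv q))"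
    by (simp only: pderiv_mult pderiv_power_Suc) (simp add: algebra_simps)
  then show ?thesis by simp
qed

text \<open>The truncation of \<open>(\<epsilon>\<^sup>2 - t\<^sup>2)\<^sup>4\<close> to \<open>|t| \<le> \<epsilon>\<close>, normalised. The fourth power makes the first three
derivatives of the polynomial vanish at \<open>\<plusminus>\<epsilon>\<close>, hence truncation preserves differentiability.\<close>

lemma ex_mollifier:
  assumes "0 < (\<epsilon>::real)"
  shows "\<exists>k. mollifier \<epsilon> k"
proof -
  define q :: "real poly" where "q = [:\<epsilon>^2, 0, -1:]"
  define p where "p n = (pderiv ^^ n) (q ^ 4)" for n
  have dvd: "n \<le> 4 \<Longrightarrow> q ^ (4 - n) dvd p n" for n
  proof (induction n)
    case 0 then show ?case by (simp add: p_def)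
  next
    case (Suc n)
    then have "4 - n = Suc (4 - Suc n)" "q ^ (4 - n) dvd p n" by auto
    then have "q ^ Suc (4 - Suc n) dvd p n" by (simp only:)
    from power_dvd_pderiv[OF this] show ?case by (simp add: p_def)
  qed
  have q: "poly q t = \<epsilon>^2 - t^2" for t by (simp add: q_def power2_eq_square)
  have zero: "poly (p n) t = 0" if "n \<le> 3" "t = \<epsilon> \<or> t = -\<epsilon>" for n t
  proof -
    have "q dvd q ^ (4 - n)" by (rule dvd_power) (use that in simp)
    moreover have "q ^ (4 - n) dvd p n" by (rule dvd) (use that in simp)
    ultimately have "q dvd p n" by (rule dvd_trans)
    then show ?thesis using that by (auto simp: dvd_def q)
  qed
  define h where "h n t = (if \<bar>t\<bar> \<le> \<epsilon> then poly (p n) t else 0)" for n t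
  have hd: "(h n has_real_derivative h (Suc n) t) (at t)" if "n < 3" for n t
  proof -
    have "pderiv (p n) = p (Suc n)" by (simp add: p_def)
    moreover have "poly (p n) \<epsilon> = 0" "poly (p n) (-\<epsilon>) = 0" "poly (p (Suc n)) \<epsilon> = 0" "poly (p (Suc n)) (-\<epsilon>) = 0"
      using zero[of n] zero[of "Suc n"] that by auto
    ultimately show ?thesis
      using truncated_poly_has_derivative[of \<epsilon> "p n" t] assms unfolding h_def[abs_def] by metis
  qed
  have hc: "continuous_on UNIV (h n)" if "n \<le> 3" for n
    unfolding h_def[abs_def] by (rule truncated_poly_continuous) (use that zero assms in auto)
  have hz: "h n t = 0" if "n \<le> 3" "\<epsilon> \<le> \<bar>t\<bar>" for n t
    using that zero[of n t] by (auto simp: h_def abs_if split: if_splits)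
  have h0: "0 \<le> h 0 t" for t
    by (simp add: h_def p_def q)
  define c where "c = integral {-\<epsilon>..\<epsilon>} (h 0)"
  have int: "h 0 integrable_on {-\<epsilon>..\<epsilon>}"
    by (meson hc continuous_on_subset integrable_continuous_interval le0 subset_UNIV)
  have "c \<noteq> 0"
  proof
    assume "c = 0"
    then have "(h 0 has_integral 0) (cbox (-\<epsilon>) \<epsilon>)"
      using int c_def by (simp add: has_integral_integrable_integral)
    from has_integral_0_cbox_imp_0[OF continuous_on_subset[OF hc[of 0]] h0 this, of 0]
    have "h 0 0 = 0" using assms by simp
    then show False using assms by (simp add: h_def p_def q)
  qed
  moreover have "0 \<le> c" unfolding c_def using h0 by (intro integral_nonneg int) auto
  ultimately have c: "0 < c" by simp
  have "mollifier \<epsilon> (\<lambda>n t. h n t / c)"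
    unfolding mollifier_def
  proof (intro conjI allI impI)
    show "continuous_on UNIV (\<lambda>t. h n t / c)" if "n \<le> 3" for n
      using hc[OF that] c by (intro continuous_intros) auto
    show "((\<lambda>t. h n t / c) has_real_derivative h (Suc n) t / c) (at t)" if "n < 3" for n t
      by (rule DERIV_cdivide[OF hd[OF that]])
  qed (use assms c hz h0 c_def in auto)
  then show ?thesis by blast
qed

section \<open>Averaging in the horizontal direction\<close>

text \<open>The convolution of \<open>f\<close> with \<open>k\<close> in the first variable only. The integral runs over a fixed interval,
so that differentiation under the integral sign applies. It agrees with the convolution when the
interval contains the support of the shifted kernel.\<close>

definition moll :: "real \<Rightarrow> real \<Rightarrow> (real \<Rightarrow> real) \<Rightarrow> (real \<times> real \<Rightarrow> real) \<Rightarrow> real \<Rightarrow> real \<Rightarrow> real"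
  where "moll a1 a2 k f x t = integral {a1..a2} (\<lambda>s. k (x - s) * f (s, t))"

lemma continuous_on_slice:
  fixes f :: "real \<times> real \<Rightarrow> real"
  assumes "continuous_on (I \<times> T) f" "t \<in> T"
  shows "continuous_on I (\<lambda>s. f (s, t))"
  by (rule continuous_on_compose2[OF assms(1)]) (use assms(2) in \<open>auto intro!: continuous_intros\<close>)

lemma continuous_on_kernel:
  fixes k :: "real \<Rightarrow> real"
  assumes "continuous_on UNIV k" "continuous_on A f"
  shows "continuous_on A (\<lambda>x. k (f x))"
  by (rule continuous_on_compose2[OF assms]) auto

lemma moll_integrable:
  fixes k :: "real \<Rightarrow> real"
  assumes "continuous_on UNIV k" "continuous_on {a1..a2} (\<lambda>s. f (s, t))"
  shows "(\<lambda>s. k (x - s) * f (s, t)) integrable_on {a1..a2}"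
  by (intro integrable_continuous_interval continuous_intros continuous_on_kernel[OF assms(1)] assms(2))

lemma moll_has_derivative_x:
  assumes k: "\<And>z. (k has_real_derivative k' z) (at z)" and k': "continuous_on UNIV k'"
    and f: "continuous_on {a1..a2} (\<lambda>s. f (s, t))"
  shows "((\<lambda>x. moll a1 a2 k f x t) has_real_derivative moll a1 a2 k' f x t) (at x)"
proof -
  have kc: "continuous_on UNIV k"
    by (meson DERIV_isCont k continuous_at_imp_continuous_on)
  have "((\<lambda>x. integral (cbox a1 a2) (\<lambda>s. k (x - s) * f (s, t))) has_field_derivative
          integral (cbox a1 a2) (\<lambda>s. k' (x - s) * f (s, t))) (at x within UNIV)"
  proof (rule leibniz_rule_field_derivative[where fx = "\<lambda>x s. k' (x - s) * f (s, t)"])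
    show "((\<lambda>x. k (x - s) * f (s, t)) has_real_derivative k' (x - s) * f (s, t)) (at x)" for x s
      by (auto intro!: derivative_eq_intros DERIV_chain'[OF _ k])
    show "(\<lambda>s. k (x - s) * f (s, t)) integrable_on cbox a1 a2" for x
      using moll_integrable[OF kc f] by simp
    show "continuous_on (UNIV \<times> cbox a1 a2) (\<lambda>(x, s). k' (x - s) * f (s, t))"
      unfolding case_prod_beta
      by (intro continuous_intros continuous_on_kernel[OF k'] continuous_on_compose2[OF f]) auto
  qed auto
  then show ?thesis by (simp add: moll_def)
qed

lemma moll_has_derivative_t:
  assumes k: "continuous_on UNIV k"
    and f: "\<And>s t. s \<in> {a1..a2} \<Longrightarrow> t \<in> {c<..<d} \<Longrightarrow> ((\<lambda>t. f (s, t)) has_real_derivative f' (s, t)) (at t)"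
    and fc: "continuous_on ({a1..a2} \<times> {c<..<d}) f"
    and f': "continuous_on ({a1..a2} \<times> {c<..<d}) f'" and t: "t \<in> {c<..<d}"
  shows "(moll a1 a2 k f x has_real_derivative moll a1 a2 k f' x t) (at t)"
proof -
  have "((\<lambda>t. integral (cbox a1 a2) (\<lambda>s. k (x - s) * f (s, t))) has_field_derivative
          integral (cbox a1 a2) (\<lambda>s. k (x - s) * f' (s, t))) (at t within {c<..<d})"
  proof (rule leibniz_rule_field_derivative[where fx = "\<lambda>t s. k (x - s) * f' (s, t)"])
    show "((\<lambda>t. k (x - s) * f (s, t)) has_real_derivative k (x - s) * f' (s, t)) (at t within {c<..<d})"
      if "t \<in> {c<..<d}" "s \<in> cbox a1 a2" for t s
      by (rule DERIV_cmult, rule DERIV_subset[OF f[of s t] subset_UNIV]) (use that in auto)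
    show "(\<lambda>s. k (x - s) * f (s, t)) integrable_on cbox a1 a2" if "t \<in> {c<..<d}" for t
      using moll_integrable[OF k continuous_on_slice[OF fc that]] by simp
    show "continuous_on ({c<..<d} \<times> cbox a1 a2) (\<lambda>(t, s). k (x - s) * f' (s, t))"
      unfolding case_prod_beta
      by (intro continuous_intros continuous_on_kernel[OF k] continuous_on_compose2[OF f']) auto
  qed (use t in auto)
  then show ?thesis using t by (simp add: moll_def[abs_def] at_within_open[of t "{c<..<d}"])
qed

lemma continuous_on_moll:
  assumes k: "continuous_on UNIV k" and f: "continuous_on ({a1..a2} \<times> T) f"
  shows "continuous_on (X \<times> T) (\<lambda>(x, t). moll a1 a2 k f x t)"
proof -
  have "continuous_on (X \<times> T) (\<lambda>p. integral (cbox a1 a2) (\<lambda>s. k (fst p - s) * f (s, snd p)))"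
  proof (rule integral_continuous_on_param)
    show "continuous_on ((X \<times> T) \<times> cbox a1 a2) (\<lambda>(p, s). k (fst p - s) * f (s, snd p))"
      unfolding case_prod_beta
      by (intro continuous_intros continuous_on_kernel[OF k] continuous_on_compose2[OF f]) auto
  qed
  then show ?thesis by (simp add: moll_def case_prod_beta)
qed

lemma moll_average_le:
  assumes m: "mollifier \<epsilon> k" and x: "a1 \<le> x - \<epsilon>" "x + \<epsilon> \<le> a2"
    and f: "continuous_on {a1..a2} (\<lambda>s. f (s, t))"
    and le: "\<And>s. \<bar>s - x\<bar> \<le> \<epsilon> \<Longrightarrow> f (s, t) \<le> u"
  shows "moll a1 a2 (k 0) f x t \<le> u"
proof -
  have kc: "continuous_on UNIV (k 0)" and k0: "\<And>t. 0 \<le> k 0 t" and \<epsilon>: "0 < \<epsilon>"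
    and kz: "\<And>t. \<epsilon> \<le> \<bar>t\<bar> \<Longrightarrow> k 0 t = 0" and one: "integral {-\<epsilon>..\<epsilon>} (k 0) = 1"
    using mollifier_cont[OF m] mollifier_eq_0[OF m] mollifierD[OF m] by auto
  have "integral {-\<epsilon>..\<epsilon>} (\<lambda>s. k 0 (- s)) = 1"
    using one by (metis Henstock_Kurzweil_Integration.integral_reflect_real add.inverse_inverse)
  then have "integral {x-\<epsilon>..x+\<epsilon>} (\<lambda>s. k 0 (x - s)) = 1"
    using integral_shift_real_ivl[of "-\<epsilon>" "-x" \<epsilon> "\<lambda>s. k 0 (- s)"] by (simp add: algebra_simps)
  then have hi: "((\<lambda>s. k 0 (x - s) * u) has_integral 1 * u) {x-\<epsilon>..x+\<epsilon>}"
    by (intro has_integral_mult_left)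
      (auto simp: has_integral_integrable_integral intro!: integrable_continuous_interval continuous_intros continuous_on_kernel[OF kc])
  have "moll a1 a2 (k 0) f x t = integral {x-\<epsilon>..x+\<epsilon>} (\<lambda>s. k 0 (x - s) * f (s, t))"
    unfolding moll_def
  proof (rule integral_spike_set)
    show "negligible {s \<in> {a1..a2} - {x - \<epsilon>..x + \<epsilon>}. k 0 (x - s) * f (s, t) \<noteq> 0}"
    proof -
      have "k 0 (x - s) * f (s, t) = 0" if "s \<notin> {x - \<epsilon>..x + \<epsilon>}" for s
      proof -
        have "\<epsilon> \<le> \<bar>x - s\<bar>" using that by auto
        then show ?thesis by (simp add: kz)
      qed
      then have "{s \<in> {a1..a2} - {x - \<epsilon>..x + \<epsilon>}. k 0 (x - s) * f (s, t) \<noteq> 0} = {}" by blast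
      then show ?thesis by (simp only: negligible_empty)
    qed
    show "negligible {s \<in> {x - \<epsilon>..x + \<epsilon>} - {a1..a2}. k 0 (x - s) * f (s, t) \<noteq> 0}"
      by (rule negligible_subset[of "{}"]) (use x in auto)
  qed
  also have "\<dots> \<le> integral {x-\<epsilon>..x+\<epsilon>} (\<lambda>s. k 0 (x - s) * u)"
  proof (rule integral_le)
    show "(\<lambda>s. k 0 (x - s) * f (s, t)) integrable_on {x - \<epsilon>..x + \<epsilon>}"
      using x by (intro moll_integrable kc continuous_on_subset[OF f]) auto
    show "(\<lambda>s. k 0 (x - s) * u) integrable_on {x - \<epsilon>..x + \<epsilon>}"
      using hi by blast
  qed (use le k0 in \<open>auto intro!: mult_left_mono\<close>)
  also have "\<dots> = u" using integral_unique[OF hi] by (simp only: mult_1_left)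
  finally show ?thesis .
qed

lemma moll_average_ge:
  assumes m: "mollifier \<epsilon> k" and x: "a1 \<le> x - \<epsilon>" "x + \<epsilon> \<le> a2"
    and f: "continuous_on {a1..a2} (\<lambda>s. f (s, t))"
    and le: "\<And>s. \<bar>s - x\<bar> \<le> \<epsilon> \<Longrightarrow> l \<le> f (s, t)"
  shows "l \<le> moll a1 a2 (k 0) f x t"
proof -
  have "moll a1 a2 (k 0) (\<lambda>p. - f p) x t \<le> - l"
    by (rule moll_average_le[OF m x]) (auto intro!: continuous_intros f le)
  then show ?thesis by (simp add: moll_def)
qed

text \<open>There are no boundary terms: the shifted kernel vanishes at both ends of the interval.\<close>

lemma moll_by_parts:
  assumes m: "mollifier \<epsilon> k" and x: "a1 \<le> x - \<epsilon>" "x + \<epsilon> \<le> a2" and n: "n < 3"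
    and f: "continuous_on {a1..a2} (\<lambda>s. f (s, t))"
    and f': "\<And>s. s \<in> {a1<..<a2} \<Longrightarrow> ((\<lambda>s. f (s, t)) has_real_derivative f' (s, t)) (at s)"
    and f'c: "continuous_on {a1..a2} (\<lambda>s. f' (s, t))"
  shows "moll a1 a2 (k (Suc n)) f x t = moll a1 a2 (k n) f' x t"
proof -
  have k: "(k n has_real_derivative k (Suc n) z) (at z)" and kc: "continuous_on UNIV (k n)"
    and kc': "continuous_on UNIV (k (Suc n))" and kz: "\<epsilon> \<le> \<bar>z\<bar> \<Longrightarrow> k n z = 0" and \<epsilon>: "0 < \<epsilon>" for z
    using mollifier_deriv[OF m n] mollifier_cont[OF m] mollifier_eq_0[OF m] mollifier_pos[OF m] n by auto
  have "((\<lambda>s. k n (x - s) * f' (s, t) - k (Suc n) (x - s) * f (s, t)) has_integral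
          k n (x - a2) * f (a2, t) - k n (x - a1) * f (a1, t)) {a1..a2}"
  proof (rule fundamental_theorem_of_calculus_interior)
    show "a1 \<le> a2" using x \<epsilon> by simp
    show "continuous_on {a1..a2} (\<lambda>s. k n (x - s) * f (s, t))"
      by (intro continuous_intros f continuous_on_kernel[OF kc])
    fix s assume "s \<in> {a1<..<a2}"
    then show "((\<lambda>s. k n (x - s) * f (s, t)) has_vector_derivative
                 k n (x - s) * f' (s, t) - k (Suc n) (x - s) * f (s, t)) (at s)"
      unfolding has_real_derivative_iff_has_vector_derivative[symmetric]
      by (auto intro!: derivative_eq_intros DERIV_chain'[OF _ k] f')
  qed
  then have "integral {a1..a2} (\<lambda>s. k n (x - s) * f' (s, t) - k (Suc n) (x - s) * f (s, t)) = 0"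
    using kz x by (simp add: integral_unique)
  then show ?thesis
    by (simp add: moll_def Henstock_Kurzweil_Integration.integral_diff moll_integrable kc kc' f f'c)
qed

lemma moll_tendsto:
  assumes m: "\<And>n. mollifier (\<epsilon> n) (k n)" and \<epsilon>: "\<epsilon> \<longlonglongrightarrow> 0"
    and f: "continuous_on ({a1..a2} \<times> T) f"
    and x: "\<And>n. a1 \<le> x n - \<epsilon> n" "\<And>n. x n + \<epsilon> n \<le> a2" and t: "\<And>n. t n \<in> T"
    and lim: "x \<longlonglongrightarrow> x0" "t \<longlonglongrightarrow> t0" and 0: "(x0, t0) \<in> {a1..a2} \<times> T"
  shows "(\<lambda>n. moll a1 a2 (k n 0) f (x n) (t n)) \<longlonglongrightarrow> f (x0, t0)"
proof (rule LIMSEQ_I)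
  fix e :: real assume e: "0 < e"
  obtain \<delta> where \<delta>: "0 < \<delta>"
    and close: "\<And>p. p \<in> {a1..a2} \<times> T \<Longrightarrow> dist p (x0, t0) < \<delta> \<Longrightarrow> dist (f p) (f (x0, t0)) < e / 2"
    using f[unfolded continuous_on_iff, rule_format, OF 0, of "e / 2"] e by auto
  have "\<forall>\<^sub>F n in sequentially. dist (x n) x0 < \<delta> / 3 \<and> dist (t n) t0 < \<delta> / 3 \<and> dist (\<epsilon> n) 0 < \<delta> / 3"
    using \<delta> by (intro eventually_conj tendstoD[OF lim(1)] tendstoD[OF lim(2)] tendstoD[OF \<epsilon>]) auto
  then obtain N where N: "\<And>n. N \<le> n \<Longrightarrow> dist (x n) x0 < \<delta> / 3 \<and> dist (t n) t0 < \<delta> / 3 \<and> dist (\<epsilon> n) 0 < \<delta> / 3"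
    by (auto simp: eventually_sequentially)
  have "norm (moll a1 a2 (k n 0) f (x n) (t n) - f (x0, t0)) < e" if "N \<le> n" for n
  proof -
    have *: "dist (f (s, t n)) (f (x0, t0)) < e / 2" if "\<bar>s - x n\<bar> \<le> \<epsilon> n" for s
    proof (rule close)
      show "(s, t n) \<in> {a1..a2} \<times> T" using that x[of n] t[of n] by auto
      have "dist (s, t n) (x0, t0) \<le> dist s x0 + dist (t n) t0"
        by (simp add: dist_Pair_Pair sqrt_sum_squares_le_sum)
      then show "dist (s, t n) (x0, t0) < \<delta>"
        using N[OF \<open>N \<le> n\<close>] that unfolding dist_real_def by linarith
    qed
    have **: "f (s, t n) \<le> f (x0, t0) + e / 2 \<and> f (x0, t0) - e / 2 \<le> f (s, t n)" if "\<bar>s - x n\<bar> \<le> \<epsilon> n" for s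
      using *[OF that] unfolding dist_real_def by linarith
    have sl: "continuous_on {a1..a2} (\<lambda>s. f (s, t n))" by (rule continuous_on_slice[OF f t])
    have "moll a1 a2 (k n 0) f (x n) (t n) \<le> f (x0, t0) + e / 2"
      by (rule moll_average_le[OF m x sl]) (use ** in blast)
    moreover have "f (x0, t0) - e / 2 \<le> moll a1 a2 (k n 0) f (x n) (t n)"
      by (rule moll_average_ge[OF m x sl]) (use ** in blast)
    ultimately show ?thesis using e by (auto simp: abs_if)
  qed
  then show "\<exists>N. \<forall>n\<ge>N. norm (moll a1 a2 (k n 0) f (x n) (t n) - f (x0, t0)) < e" by blast
qed

section \<open>Maximum principle and a barrier\<close>

lemma interior_max_derivatives:
  fixes f f' :: "real \<Rightarrow> real"
  assumes S: "open S" "x \<in> S"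
    and f: "\<And>y. y \<in> S \<Longrightarrow> (f has_real_derivative f' y) (at y)"
    and f': "(f' has_real_derivative D) (at x)"
    and max: "\<And>y. y \<in> S \<Longrightarrow> f y \<le> f x"
  shows "f' x = 0" "D \<le> 0"
proof -
  obtain e where e: "0 < e" "ball x e \<subseteq> S" using S by (meson openE)
  then have ball: "y \<in> S" if "\<bar>x - y\<bar> < e" for y
    using that by (auto simp: dist_real_def)
  show z: "f' x = 0"
    by (rule DERIV_local_max[OF f[OF S(2)] e(1)]) (use max ball in blast)
  show "D \<le> 0"
  proof (rule ccontr)
    assume "\<not> D \<le> 0"
    then have "0 < D" by simp
    from DERIV_pos_inc_right[OF f' this] obtain d where d: "0 < d"
      and inc: "\<And>h. 0 < h \<Longrightarrow> h < d \<Longrightarrow> f' x < f' (x + h)" by blast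
    define h where "h = min d e / 2"
    have h: "0 < h" "h < d" "h < e" using d e by (auto simp: h_def)
    have "f x < f (x + h)"
    proof (rule DERIV_pos_imp_increasing_open[of x "x + h" f])
      show "x < x + h" using h by simp
      show "\<exists>y. (f has_real_derivative y) (at w) \<and> 0 < y" if "x < w" "w < x + h" for w
        using f[of w] ball[of w] inc[of "w - x"] z h that by (intro exI[of _ "f' w"]) auto
      show "continuous_on {x..x + h} f"
        using DERIV_isCont[OF f[OF ball]] h by (intro continuous_at_imp_continuous_on) auto
    qed
    moreover have "f (x + h) \<le> f x" using max ball h by simp
    ultimately show False by simp
  qed
qed

text \<open>Comparison with \<open>A s - N' s\<^sup>2 / 2 + K y\<^sup>2\<close>. The term in \<open>y\<close> makes this function at least \<open>M\<close> on the two
sides \<open>y = \<plusminus>d\<close>, the number \<open>N'\<close> is so large that its Laplacian is below \<open>- N\<close>, and \<open>A\<close> is so large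
that it is at least \<open>M\<close> on the side \<open>s = d\<close>. As the inequality between
the Laplacians is strict, the second derivative test excludes an interior maximum of the difference.\<close>

lemma linear_barrier:
  fixes f fs fss fy fyy :: "real \<Rightarrow> real \<Rightarrow> real"
  assumes d: "0 < d" and M: "0 \<le> M" and N: "0 \<le> N"
    and cont: "continuous_on ({0..d} \<times> {-d..d}) (\<lambda>(s, y). f s y)"
    and fs: "\<And>s y. 0 < s \<Longrightarrow> s < d \<Longrightarrow> \<bar>y\<bar> < d \<Longrightarrow> ((\<lambda>s. f s y) has_real_derivative fs s y) (at s)"
    and fss: "\<And>s y. 0 < s \<Longrightarrow> s < d \<Longrightarrow> \<bar>y\<bar> < d \<Longrightarrow> ((\<lambda>s. fs s y) has_real_derivative fss s y) (at s)"
    and fy: "\<And>s y. 0 < s \<Longrightarrow> s < d \<Longrightarrow> \<bar>y\<bar> < d \<Longrightarrow> (f s has_real_derivative fy s y) (at y)"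
    and fyy: "\<And>s y. 0 < s \<Longrightarrow> s < d \<Longrightarrow> \<bar>y\<bar> < d \<Longrightarrow> (fy s has_real_derivative fyy s y) (at y)"
    and lap: "\<And>s y. 0 < s \<Longrightarrow> s < d \<Longrightarrow> \<bar>y\<bar> < d \<Longrightarrow> - N \<le> fss s y + fyy s y"
    and bound: "\<And>s y. 0 \<le> s \<Longrightarrow> s \<le> d \<Longrightarrow> \<bar>y\<bar> \<le> d \<Longrightarrow> f s y \<le> M"
    and zero: "\<And>y. \<bar>y\<bar> \<le> d \<Longrightarrow> f 0 y \<le> 0"
    and s: "0 \<le> s" "s \<le> d"
  shows "f s 0 \<le> (2 * M / d + (N + 1) * d / 2) * s"
proof -
  define K where "K = M / d\<^sup>2"
  define N' where "N' = N + 2 * K + 1"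
  define A where "A = M / d + N' * d / 2"
  have K: "0 \<le> K" "K * d\<^sup>2 = M" using M d by (auto simp: K_def)
  have N': "0 \<le> N'" using N K by (simp add: N'_def)
  have A: "A * d - N' / 2 * d\<^sup>2 = M" using d by (simp add: A_def power2_eq_square field_simps)
  have lin: "0 \<le> A * s - N' / 2 * s\<^sup>2" if "0 \<le> s" "s \<le> d" for s
  proof -
    have "A * s - N' / 2 * s\<^sup>2 = s * (M / d + N' / 2 * (d - s))"
      by (simp add: A_def power2_eq_square algebra_simps add_divide_distrib diff_divide_distrib)
    then show ?thesis using that M N' d by simp
  qed
  define w where "w s y = A * s - N' / 2 * s\<^sup>2 + K * y\<^sup>2" for s y :: real
  have "continuous_on ({0..d} \<times> {-d..d}) (\<lambda>p. f (fst p) (snd p) - w (fst p) (snd p))"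
    using cont by (auto simp: w_def case_prod_beta intro!: continuous_intros)
  moreover have "compact ({0..d} \<times> {-d..d})" by (intro compact_Times) auto
  moreover have "{0..d} \<times> {-d..d} \<noteq> {}" using d by auto
  ultimately have "\<exists>p\<in>{0..d} \<times> {-d..d}. \<forall>q\<in>{0..d} \<times> {-d..d}.
      f (fst q) (snd q) - w (fst q) (snd q) \<le> f (fst p) (snd p) - w (fst p) (snd p)"
    by (intro continuous_attains_sup)
  then obtain p where p: "p \<in> {0..d} \<times> {-d..d}"
    and pmax: "\<And>q. q \<in> {0..d} \<times> {-d..d} \<Longrightarrow> f (fst q) (snd q) - w (fst q) (snd q) \<le> f (fst p) (snd p) - w (fst p) (snd p)"
    by blast
  obtain a b where ab: "p = (a, b)" by (cases p)
  have a: "0 \<le> a" "a \<le> d" and b: "\<bar>b\<bar> \<le> d" using p ab by auto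
  have max: "f s y - w s y \<le> f a b - w a b" if "0 \<le> s" "s \<le> d" "\<bar>y\<bar> \<le> d" for s y
    using pmax[of "(s, y)"] that ab by (simp add: abs_le_iff)
  have "f a b \<le> w a b"
  proof -
    consider "a = 0" | "a = d" | "\<bar>b\<bar> = d" | "0 < a" "a < d" "\<bar>b\<bar> < d" using a b by linarith
    then show ?thesis
    proof cases
      case 1
      moreover have "0 \<le> K * b\<^sup>2" using K by simp
      ultimately show ?thesis using zero[OF b] by (simp add: w_def)
    next
      case 2
      have "0 \<le> K * b\<^sup>2" using K by simp
      then show ?thesis using bound[OF a b] A 2 by (simp add: w_def)
    next
      case 3
      then have "b\<^sup>2 = d\<^sup>2" by (metis power2_abs)
      then show ?thesis using bound[OF a b] lin[OF a] K by (simp add: w_def)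
    next
      case 4
      have "fss a b - (- N') \<le> 0"
      proof (rule interior_max_derivatives(2)[where S = "{0<..<d}" and x = a
            and f = "\<lambda>s. f s b - w s b" and f' = "\<lambda>s. fs s b - (A - N' * s)"])
        show "((\<lambda>s. f s b - w s b) has_real_derivative fs s b - (A - N' * s)) (at s)" if "s \<in> {0<..<d}" for s
          proof (rule DERIV_diff)
          show "((\<lambda>s. w s b) has_real_derivative A - N' * s) (at s)"
            unfolding w_def by (auto intro!: derivative_eq_intros)
        qed (use that 4 fs in auto)
        show "((\<lambda>s. fs s b - (A - N' * s)) has_real_derivative fss a b - (- N')) (at a)"
          by (rule DERIV_diff[OF fss]) (use 4 in \<open>auto intro!: derivative_eq_intros\<close>)
      qed (use 4 max b in auto)
      moreover have "fyy a b - 2 * K \<le> 0"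
      proof (rule interior_max_derivatives(2)[where S = "{-d<..<d}" and x = b
            and f = "\<lambda>y. f a y - w a y" and f' = "\<lambda>y. fy a y - 2 * K * y"])
        show "((\<lambda>y. f a y - w a y) has_real_derivative fy a y - 2 * K * y) (at y)" if "y \<in> {-d<..<d}" for y
          proof (rule DERIV_diff)
          show "(w a has_real_derivative 2 * K * y) (at y)"
            unfolding w_def by (auto intro!: derivative_eq_intros)
        qed (use that 4 fy in auto)
        show "((\<lambda>y. fy a y - 2 * K * y) has_real_derivative fyy a b - 2 * K) (at b)"
          by (rule DERIV_diff[OF fyy]) (use 4 in \<open>auto intro!: derivative_eq_intros\<close>)
      qed (use 4 max a in auto)
      ultimately show ?thesis using lap[OF 4] by (simp add: N'_def)
    qed
  qed
  then have "f s 0 \<le> w s 0" using max[of s 0] s d by simp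
  also have "\<dots> \<le> A * s" using N' by (simp add: w_def)
  also have "A = 2 * M / d + (N + 1) * d / 2"
    using d by (simp add: A_def N'_def K_def field_simps power2_eq_square)
  finally show ?thesis .
qed

section \<open>Averages of weak solutions\<close>

text \<open>The kernels serve as test functions: the average of \<open>V\<close> at scale \<open>\<epsilon>\<close> has the average of \<open>N\<close> as its
derivative. By the mean value theorem its increments over \<open>[t, t + h]\<close> are \<open>h\<close> times a value close to \<open>N t\<close>,
uniformly in \<open>\<epsilon>\<close>, and the bound survives \<open>\<epsilon> \<rightarrow> 0\<close>. As \<open>moll\<close> acts on functions of two variables, \<open>V\<close> and
\<open>N\<close> are read as functions of the first one.\<close>

lemma weak_derivative_imp_derivative:
  fixes V N :: "real \<Rightarrow> real"
  assumes V: "continuous_on {c<..<d} V" and N: "continuous_on {c<..<d} N"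
    and weak: "\<And>D D' c' d'. \<lbrakk>c < c'; c' < d'; d' < d; \<And>t. (D has_real_derivative D' t) (at t);
        continuous_on UNIV D'; \<And>t. t \<notin> {c'..d'} \<Longrightarrow> D t = 0\<rbrakk>
      \<Longrightarrow> integral {c'..d'} (\<lambda>t. V t * D' t + N t * D t) = 0"
    and t: "t \<in> {c<..<d}"
  shows "(V has_real_derivative N t) (at t)"
  unfolding DERIV_def
proof (rule LIM_I)
  fix e :: real assume e: "0 < e"
  have "open {c<..<d}" by simp
  then have "isCont N t" using N t continuous_on_eq_continuous_at by blast
  from this[unfolded continuous_at_eps_delta, rule_format, of "e / 2"]
  obtain r where r: "0 < r" and Nr: "\<And>s. \<bar>s - t\<bar> < r \<Longrightarrow> \<bar>N s - N t\<bar> < e / 2"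
    using e by (auto simp: dist_real_def)
  define \<delta> where "\<delta> = min r (min (t - c) (d - t)) / 3"
  have \<delta>: "0 < \<delta>" "2 * \<delta> < r" "c < t - 2 * \<delta>" "t + 2 * \<delta> < d"
  proof -
    have "3 * \<delta> \<le> r" "3 * \<delta> \<le> t - c" "3 * \<delta> \<le> d - t" by (auto simp: \<delta>_def)
    moreover show "0 < \<delta>" using r t by (auto simp: \<delta>_def)
    ultimately show "2 * \<delta> < r" "c < t - 2 * \<delta>" "t + 2 * \<delta> < d" by linarith+
  qed
  define a1 a2 where "a1 = t - 2 * \<delta>" and "a2 = t + 2 * \<delta>"
  have a: "c < a1" "a1 < a2" "a2 < d" using \<delta> by (auto simp: a1_def a2_def)
  have sub: "{a1..a2} \<subseteq> {c<..<d}" using a by auto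
  have Vc: "continuous_on {a1..a2} V" and Nc: "continuous_on {a1..a2} N"
    using V N sub continuous_on_subset by blast+
  have "\<forall>n. \<exists>k. mollifier (\<delta> / real (Suc n)) k" using \<delta> by (intro allI ex_mollifier) simp
  then obtain k where k: "\<And>n. mollifier (\<delta> / real (Suc n)) (k n)" by metis
  have small: "\<delta> / real (Suc n) \<le> \<delta>" for n
    using \<delta> by (simp add: field_simps)
  have lim0: "(\<lambda>n. \<delta> / real (Suc n)) \<longlonglongrightarrow> 0"
    by (rule LIMSEQ_Suc[OF lim_const_over_n])
  define mv where "mv n x = moll a1 a2 (k n 0) (V \<circ> fst) x (0::real)" for n x
  define mn where "mn n x = moll a1 a2 (k n 0) (N \<circ> fst) x (0::real)" for n x
  have mv: "(mv n has_real_derivative mn n x) (at x)" if "\<bar>x - t\<bar> \<le> \<delta>" for n x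
  proof -
    note m = k[of n]
    have "(mv n has_real_derivative moll a1 a2 (k n (Suc 0)) (V \<circ> fst) x 0) (at x)"
      unfolding mv_def
      by (rule moll_has_derivative_x[OF mollifier_deriv[OF m] mollifier_cont[OF m]]) (use Vc in auto)
    moreover have "moll a1 a2 (k n (Suc 0)) (V \<circ> fst) x 0 = mn n x"
    proof -
      have "integral {a1..a2} (\<lambda>s. V s * (- k n (Suc 0) (x - s)) + N s * k n 0 (x - s)) = 0"
      proof (rule weak[OF a])
        have "((\<lambda>s. k n 0 (x - s)) has_real_derivative k n (Suc 0) (x - s) * (0 - 1)) (at s)" for s
          by (rule DERIV_chain'[of "\<lambda>s. x - s"])
            (auto intro!: derivative_eq_intros mollifier_deriv[OF m])
        then show "((\<lambda>s. k n 0 (x - s)) has_real_derivative - k n (Suc 0) (x - s)) (at s)" for s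
          by simp
        show "continuous_on UNIV (\<lambda>s. - k n (Suc 0) (x - s))"
          by (intro continuous_intros continuous_on_kernel[OF mollifier_cont[OF m]]) simp
        fix s assume "s \<notin> {a1..a2}"
        then have "\<delta> / real (Suc n) \<le> \<bar>x - s\<bar>"
          using that small[of n] by (auto simp: a1_def a2_def)
        then show "k n 0 (x - s) = 0" by (intro mollifier_eq_0[OF m]) auto
      qed
      then have "integral {a1..a2} (\<lambda>s. k n 0 (x - s) * N s - k n (Suc 0) (x - s) * V s) = 0"
        by (simp add: algebra_simps)
      then have "integral {a1..a2} (\<lambda>s. k n 0 (x - s) * N s) - integral {a1..a2} (\<lambda>s. k n (Suc 0) (x - s) * V s) = 0"
        by (subst (asm) Henstock_Kurzweil_Integration.integral_diff)
          (auto intro!: integrable_continuous_interval continuous_intros Vc Nc continuous_on_kernel[OF mollifier_cont[OF m]])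
      then show ?thesis by (simp add: moll_def mn_def)
    qed
    ultimately show ?thesis by simp
  qed
  have mn: "\<bar>mn n x - N t\<bar> \<le> e / 2" if "\<bar>x - t\<bar> \<le> \<delta>" for n x
  proof -
    note m = k[of n]
    have x: "a1 \<le> x - \<delta> / real (Suc n)" "x + \<delta> / real (Suc n) \<le> a2"
      using that small[of n] unfolding a1_def a2_def by linarith+
    have near: "N t - e / 2 \<le> N s \<and> N s \<le> N t + e / 2" if "\<bar>s - x\<bar> \<le> \<delta> / real (Suc n)" for s
      using Nr[of s] that \<open>\<bar>x - t\<bar> \<le> \<delta>\<close> small[of n] \<delta>(2) by linarith
    have "mn n x \<le> N t + e / 2" unfolding mn_def
      by (rule moll_average_le[OF m x]) (use Nc near in auto)
    moreover have "N t - e / 2 \<le> mn n x" unfolding mn_def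
      by (rule moll_average_ge[OF m x]) (use Nc near in auto)
    ultimately show ?thesis by linarith
  qed
  have lim: "(\<lambda>n. mv n x) \<longlonglongrightarrow> V x" if "\<bar>x - t\<bar> \<le> \<delta>" for x
  proof -
    have "(\<lambda>n. moll a1 a2 (k n 0) (V \<circ> fst) x 0) \<longlonglongrightarrow> (V \<circ> fst) (x, 0::real)"
    proof (rule moll_tendsto[OF k lim0, where T = "{0}"])
      show "continuous_on ({a1..a2} \<times> {0}) (V \<circ> fst)"
        unfolding o_def by (rule continuous_on_compose2[OF Vc]) (auto intro!: continuous_intros)
      show "a1 \<le> x - \<delta> / real (Suc n)" "x + \<delta> / real (Suc n) \<le> a2" for n
        using that small[of n] unfolding a1_def a2_def by linarith+
      show "(x, 0) \<in> {a1..a2} \<times> {0}" using that \<delta> by (auto simp: a1_def a2_def)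
    qed auto
    then show ?thesis by (simp add: mv_def)
  qed
  have incr: "\<bar>V (t + h) - V t - h * N t\<bar> \<le> \<bar>h\<bar> * (e / 2)" if "\<bar>h\<bar> < \<delta>" for h
  proof (rule LIMSEQ_le_const2)
    show "(\<lambda>n. \<bar>mv n (t + h) - mv n t - h * N t\<bar>) \<longlonglongrightarrow> \<bar>V (t + h) - V t - h * N t\<bar>"
      using that \<delta> by (intro tendsto_intros lim) auto
    have "\<bar>mv n (t + h) - mv n t - h * N t\<bar> \<le> \<bar>h\<bar> * (e / 2)" for n
    proof (cases "h = 0")
      case False
      have "\<exists>z. \<bar>z - t\<bar> \<le> \<delta> \<and> mv n (t + h) - mv n t = h * mn n z"
      proof (cases "0 < h")
        case True
        have "\<exists>z>t. z < t + h \<and> mv n (t + h) - mv n t = (t + h - t) * mn n z"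
          by (rule MVT2) (use True that mv in auto)
        then obtain z where "t < z" "z < t + h" "mv n (t + h) - mv n t = (t + h - t) * mn n z" by blast
        then show ?thesis using that by (intro exI[of _ z]) auto
      next
        case neg: False
        have "\<exists>z>t + h. z < t \<and> mv n t - mv n (t + h) = (t - (t + h)) * mn n z"
          by (rule MVT2) (use neg False that mv in auto)
        then obtain z where "t + h < z" "z < t" "mv n t - mv n (t + h) = (t - (t + h)) * mn n z" by blast
        then show ?thesis using that by (intro exI[of _ z]) (auto simp: algebra_simps)
      qed
      then obtain z where z: "\<bar>z - t\<bar> \<le> \<delta>" "mv n (t + h) - mv n t = h * mn n z" by blast
      then have "\<bar>mv n (t + h) - mv n t - h * N t\<bar> = \<bar>h\<bar> * \<bar>mn n z - N t\<bar>"
        by (simp add: abs_mult[symmetric] right_diff_distrib)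
      also have "\<dots> \<le> \<bar>h\<bar> * (e / 2)" by (intro mult_left_mono mn z) auto
      finally show ?thesis .
    qed simp
    then show "\<exists>M. \<forall>n\<ge>M. \<bar>mv n (t + h) - mv n t - h * N t\<bar> \<le> \<bar>h\<bar> * (e / 2)" by blast
  qed
  have "norm ((V (t + h) - V t) / h - N t) < e" if "h \<noteq> 0" "norm (h - 0) < \<delta>" for h
  proof -
    have "(V (t + h) - V t) / h - N t = (V (t + h) - V t - h * N t) / h"
      using that by (simp add: field_simps)
    then have "\<bar>(V (t + h) - V t) / h - N t\<bar> = \<bar>V (t + h) - V t - h * N t\<bar> / \<bar>h\<bar>"
      by (simp add: abs_divide)
    also have "\<dots> \<le> (\<bar>h\<bar> * (e / 2)) / \<bar>h\<bar>"
      using that by (intro divide_right_mono incr) auto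
    also have "\<dots> < e" using that e by simp
    finally show ?thesis by simp
  qed
  then show "\<exists>s>0. \<forall>h. h \<noteq> 0 \<and> norm (h - 0) < s \<longrightarrow> norm ((V (t + h) - V t) / h - N t) < e"
    using \<delta> by blast
qed

text \<open>A weak solution on a rectangle, with \<open>P\<close> and \<open>R\<close> its two partial derivatives. The
weak equation is stated for test functions in product form, the ones that separate the two directions. The lower side \<open>t = c\<close> may lie on
the bed; this is why \<open>\<psi>\<close> is continuous on the closed rectangle but differentiable only for \<open>c < t < d\<close>.\<close>

locale weak_stream_box =
  fixes a1 a2 c d B :: real and \<gamma> \<gamma>' :: "real \<Rightarrow> real" and \<psi> P R :: "real \<times> real \<Rightarrow> real"
  assumes c_less_d: "c < d"
    and \<gamma>_deriv: "\<And>r. r \<in> {0..B} \<Longrightarrow> (\<gamma> has_real_derivative \<gamma>' r) (at r within {0..B})"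
    and \<gamma>'_cont: "continuous_on {0..B} \<gamma>'"
    and \<psi>_cont: "continuous_on ({a1..a2} \<times> {c..d}) \<psi>"
    and \<psi>_range: "\<And>s t. s \<in> {a1..a2} \<Longrightarrow> t \<in> {c<..<d} \<Longrightarrow> 0 < \<psi> (s, t) \<and> \<psi> (s, t) < B"
    and P: "\<And>s t. s \<in> {a1..a2} \<Longrightarrow> t \<in> {c<..<d} \<Longrightarrow> ((\<lambda>s. \<psi> (s, t)) has_real_derivative P (s, t)) (at s)"
    and R: "\<And>s t. s \<in> {a1..a2} \<Longrightarrow> t \<in> {c<..<d} \<Longrightarrow> ((\<lambda>t. \<psi> (s, t)) has_real_derivative R (s, t)) (at t)"
    and P_cont: "continuous_on ({a1..a2} \<times> {c<..<d}) P"
    and R_cont: "continuous_on ({a1..a2} \<times> {c<..<d}) R"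
    and weak: "\<And>A A' D D' c' d'. \<lbrakk>c < c'; c' < d'; d' < d;
        \<And>s. (A has_real_derivative A' s) (at s); continuous_on UNIV A'; \<And>s. s \<notin> {a1..a2} \<Longrightarrow> A s = 0;
        \<And>t. (D has_real_derivative D' t) (at t); continuous_on UNIV D'; \<And>t. t \<notin> {c'..d'} \<Longrightarrow> D t = 0\<rbrakk>
      \<Longrightarrow> integral (cbox (a1, c') (a2, d')) (\<lambda>(s, t). P (s, t) * (A' s * D t) + R (s, t) * (A s * D' t)) =
          integral (cbox (a1, c') (a2, d')) (\<lambda>(s, t). \<gamma> (\<psi> (s, t)) * (A s * D t))"
begin

lemma \<gamma>_cont: "continuous_on {0..B} \<gamma>"
  using \<gamma>_deriv DERIV_continuous_on by blast

lemma \<psi>_range_closed: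
  assumes "s \<in> {a1..a2}" "t \<in> {c..d}"
  shows "\<psi> (s, t) \<in> {0..B}"
proof -
  have cont: "continuous_on {c..d} (\<lambda>t. \<psi> (s, t))"
    by (rule continuous_on_compose2[OF \<psi>_cont]) (use assms(1) in \<open>auto intro!: continuous_intros\<close>)
  have cl: "closure {c<..<d} = {c..d}" using c_less_d by simp
  have o: "0 \<le> \<psi> (s, t) \<and> \<psi> (s, t) \<le> B" if "t \<in> {c<..<d}" for t
    using \<psi>_range[OF assms(1) that] by simp
  have "0 \<le> \<psi> (s, t)"
    by (rule continuous_ge_on_closure[of "{c<..<d}" "\<lambda>t. \<psi> (s, t)"])
      (use cl cont assms o in \<open>simp_all del: greaterThanLessThan_iff\<close>)
  moreover have "\<psi> (s, t) \<le> B"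
    by (rule continuous_le_on_closure[of "{c<..<d}" "\<lambda>t. \<psi> (s, t)"])
      (use cl cont assms o in \<open>simp_all del: greaterThanLessThan_iff\<close>)
  ultimately show ?thesis by simp
qed

lemma \<gamma>\<psi>_cont: "continuous_on ({a1..a2} \<times> {c..d}) (\<lambda>p. \<gamma> (\<psi> p))"
  by (rule continuous_on_compose2[OF \<gamma>_cont \<psi>_cont]) (use \<psi>_range_closed in auto)

lemma \<gamma>'\<psi>_cont: "continuous_on ({a1..a2} \<times> {c..d}) (\<lambda>p. \<gamma>' (\<psi> p))"
  by (rule continuous_on_compose2[OF \<gamma>'_cont \<psi>_cont]) (use \<psi>_range_closed in auto)

lemma \<gamma>_deriv_interior:
  assumes "r \<in> {0<..<B}"
  shows "(\<gamma> has_real_derivative \<gamma>' r) (at r)"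
proof -
  have "r \<in> interior {0..B}" using assms by simp
  then have "at r within {0..B} = at r" by (rule at_within_interior)
  moreover have "(\<gamma> has_real_derivative \<gamma>' r) (at r within {0..B})"
    by (rule \<gamma>_deriv) (use assms in auto)
  ultimately show ?thesis by (simp only:)
qed

lemma \<gamma>\<psi>_deriv_x:
  assumes "s \<in> {a1..a2}" "t \<in> {c<..<d}"
  shows "((\<lambda>s. \<gamma> (\<psi> (s, t))) has_real_derivative \<gamma>' (\<psi> (s, t)) * P (s, t)) (at s)"
  by (rule DERIV_chain2[OF \<gamma>_deriv_interior P]) (use assms \<psi>_range in auto)

lemma \<gamma>\<psi>_deriv_t:
  assumes "s \<in> {a1..a2}" "t \<in> {c<..<d}"
  shows "((\<lambda>t. \<gamma> (\<psi> (s, t))) has_real_derivative \<gamma>' (\<psi> (s, t)) * R (s, t)) (at t)"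
  by (rule DERIV_chain2[OF \<gamma>_deriv_interior R]) (use assms \<psi>_range in auto)

abbreviation "M \<equiv> moll a1 a2"

lemma moll_\<psi>_by_parts:
  assumes "mollifier \<epsilon> k" "a1 \<le> x - \<epsilon>" "x + \<epsilon> \<le> a2" "n < 3" "t \<in> {c<..<d}"
  shows "M (k (Suc n)) \<psi> x t = M (k n) P x t"
proof (rule moll_by_parts[OF assms(1-4)])
  show "continuous_on {a1..a2} (\<lambda>s. \<psi> (s, t))"
    by (rule continuous_on_slice[OF \<psi>_cont]) (use assms(5) in auto)
  show "continuous_on {a1..a2} (\<lambda>s. P (s, t))"
    by (rule continuous_on_slice[OF P_cont assms(5)])
  show "((\<lambda>s. \<psi> (s, t)) has_real_derivative P (s, t)) (at s)" if "s \<in> {a1<..<a2}" for s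
    by (rule P) (use that assms(5) in auto)
qed

text \<open>The Poisson equation for the averages. With the shifted kernel as the horizontal factor of a test
function, the weak equation becomes a weak ordinary differential equation in \<open>t\<close> for the average of
\<open>\<psi>\<^sub>Y\<close>, whose continuous right-hand side contains no vertical derivatives.\<close>

lemma moll_R_deriv_t:
  assumes m: "mollifier \<epsilon> k" and x: "a1 \<le> x - \<epsilon>" "x + \<epsilon> \<le> a2" and n: "n < 2" and t: "t \<in> {c<..<d}"
  shows "(M (k n) R x has_real_derivative
           - (M (k (Suc (Suc n))) \<psi> x t + M (k n) (\<lambda>p. \<gamma> (\<psi> p)) x t)) (at t)"
proof -
  have kd: "(k n has_real_derivative k (Suc n) z) (at z)" for z
    by (rule mollifier_deriv[OF m]) (use n in simp)
  have kc: "continuous_on UNIV (k n)" and kc1: "continuous_on UNIV (k (Suc n))"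
    and kc2: "continuous_on UNIV (k (Suc (Suc n)))"
    using n by (auto intro!: mollifier_cont[OF m])
  have oc: "{a1..a2} \<times> {c<..<d} \<subseteq> {a1..a2} \<times> {c..d}" by auto
  have jc: "continuous_on {c<..<d} (M k' f x)"
    if "continuous_on UNIV k'" "continuous_on ({a1..a2} \<times> {c<..<d}) f" for k' f
  proof -
    have "continuous_on ({x} \<times> {c<..<d}) (\<lambda>(x, t). M k' f x t)"
      by (rule continuous_on_moll[OF that])
    moreover have "continuous_on {c<..<d} (Pair x)" by (intro continuous_intros)
    ultimately have "continuous_on {c<..<d} (\<lambda>t. (\<lambda>(x, t). M k' f x t) (x, t))"
      by (rule continuous_on_compose2) auto
    then show ?thesis by simp
  qed
  note \<psi>o = continuous_on_subset[OF \<psi>_cont oc] and \<gamma>\<psi>o = continuous_on_subset[OF \<gamma>\<psi>_cont oc]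
  show ?thesis
  proof (rule weak_derivative_imp_derivative[OF _ _ _ t])
    show "continuous_on {c<..<d} (M (k n) R x)" by (rule jc[OF kc R_cont])
    show "continuous_on {c<..<d} (\<lambda>t. - (M (k (Suc (Suc n))) \<psi> x t + M (k n) (\<lambda>p. \<gamma> (\<psi> p)) x t))"
      by (intro continuous_intros jc kc kc2 \<psi>o \<gamma>\<psi>o)
    fix D D' :: "real \<Rightarrow> real" and c' d'
    assume cd: "c < c'" "c' < d'" "d' < d" and D: "\<And>t. (D has_real_derivative D' t) (at t)"
      and D': "continuous_on UNIV D'" and Dz: "\<And>t. t \<notin> {c'..d'} \<Longrightarrow> D t = 0"
    have Dc: "continuous_on UNIV D" using D by (meson DERIV_isCont continuous_at_imp_continuous_on)
    define A where "A s = k n (x - s)" for s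
    define A' where "A' s = - k (Suc n) (x - s)" for s
    have A: "(A has_real_derivative A' s) (at s)" for s
    proof -
      have "((\<lambda>s. k n (x - s)) has_real_derivative k (Suc n) (x - s) * (0 - 1)) (at s)"
        by (rule DERIV_chain'[of "\<lambda>s. x - s"]) (auto intro!: derivative_eq_intros kd)
      then show ?thesis by (simp add: A_def[abs_def] A'_def)
    qed
    have A'c: "continuous_on UNIV A'" unfolding A'_def by (intro continuous_intros continuous_on_kernel[OF kc1])
    have Ac: "continuous_on UNIV A" unfolding A_def by (intro continuous_intros continuous_on_kernel[OF kc])
    have Az: "A s = 0" if "s \<notin> {a1..a2}" for s
    proof -
      have "\<epsilon> \<le> \<bar>x - s\<bar>" using that x by auto
      then show ?thesis unfolding A_def using n by (intro mollifier_eq_0[OF m]) auto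
    qed
    have sub: "cbox (a1, c') (a2, d') \<subseteq> {a1..a2} \<times> {c<..<d}"
      using cd by (auto simp: cbox_Pair_eq)
    note on = continuous_on_subset[OF _ sub]
    have slice: "continuous_on {a1..a2} (\<lambda>s. f (s, t))"
      if "continuous_on ({a1..a2} \<times> {c<..<d}) f" "t \<in> {c'..d'}" for f :: "real \<times> real \<Rightarrow> real" and t
      by (rule continuous_on_slice[OF that(1)]) (use that(2) cd in auto)
    have c1: "continuous_on (cbox (a1, c') (a2, d'))
        (\<lambda>(s, t). P (s, t) * (A' s * D t) + R (s, t) * (A s * D' t))"
      unfolding case_prod_beta prod.collapse
      by (intro continuous_intros on P_cont R_cont continuous_on_kernel[OF A'c]
        continuous_on_kernel[OF Ac] continuous_on_kernel[OF Dc] continuous_on_kernel[OF D'])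
    have c2: "continuous_on (cbox (a1, c') (a2, d')) (\<lambda>(s, t). \<gamma> (\<psi> (s, t)) * (A s * D t))"
      unfolding case_prod_beta prod.collapse
      by (intro continuous_intros on \<gamma>\<psi>o continuous_on_kernel[OF Ac] continuous_on_kernel[OF Dc])
    have w: "integral {c'..d'} (\<lambda>t. integral {a1..a2} (\<lambda>s. P (s, t) * (A' s * D t) + R (s, t) * (A s * D' t))) =
          integral {c'..d'} (\<lambda>t. integral {a1..a2} (\<lambda>s. \<gamma> (\<psi> (s, t)) * (A s * D t)))"
      using weak[OF cd A A'c Az D D' Dz] integral_prod_continuous[OF c1] integral_swap_continuous[OF c1]
        integral_prod_continuous[OF c2] integral_swap_continuous[OF c2]
      by (simp add: case_prod_beta)
    have l: "integral {a1..a2} (\<lambda>s. P (s, t) * (A' s * D t) + R (s, t) * (A s * D' t)) =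
        M (k n) R x t * D' t - M (k (Suc (Suc n))) \<psi> x t * D t" if t: "t \<in> {c'..d'}" for t
    proof -
      have t': "t \<in> {c<..<d}" using t cd by auto
      have "M (k (Suc (Suc n))) \<psi> x t = M (k (Suc n)) P x t"
        by (rule moll_\<psi>_by_parts[OF m x _ t']) (use n in simp)
      moreover have "integral {a1..a2} (\<lambda>s. P (s, t) * (A' s * D t) + R (s, t) * (A s * D' t)) =
        integral {a1..a2} (\<lambda>s. D' t * (k n (x - s) * R (s, t)) - D t * (k (Suc n) (x - s) * P (s, t)))"
        by (simp add: A_def A'_def algebra_simps)
      moreover have "\<dots> = D' t * M (k n) R x t - D t * M (k (Suc n)) P x t"
        unfolding moll_def
        by (subst Henstock_Kurzweil_Integration.integral_diff)
          (auto intro!: integrable_on_mult_right moll_integrable kc kc1 slice P_cont R_cont t)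
      ultimately show ?thesis by simp
    qed
    have r: "integral {a1..a2} (\<lambda>s. \<gamma> (\<psi> (s, t)) * (A s * D t)) = M (k n) (\<lambda>p. \<gamma> (\<psi> p)) x t * D t" for t
      unfolding moll_def A_def by (simp add: integral_mult_left[symmetric] mult_ac del: integral_mult_left)
    have eq: "integral {c'..d'} (\<lambda>t. M (k n) R x t * D' t - M (k (Suc (Suc n))) \<psi> x t * D t) =
        integral {c'..d'} (\<lambda>t. M (k n) (\<lambda>p. \<gamma> (\<psi> p)) x t * D t)"
    proof -
      have "integral {c'..d'} (\<lambda>t. M (k n) R x t * D' t - M (k (Suc (Suc n))) \<psi> x t * D t) =
          integral {c'..d'} (\<lambda>t. integral {a1..a2} (\<lambda>s. P (s, t) * (A' s * D t) + R (s, t) * (A s * D' t)))"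
        by (rule integral_cong, rule l[symmetric])
      also note w
      also have "integral {c'..d'} (\<lambda>t. integral {a1..a2} (\<lambda>s. \<gamma> (\<psi> (s, t)) * (A s * D t))) =
          integral {c'..d'} (\<lambda>t. M (k n) (\<lambda>p. \<gamma> (\<psi> p)) x t * D t)"
        by (simp only: r)
      finally show ?thesis .
    qed
    have sub': "{c'..d'} \<subseteq> {c<..<d}" using cd by auto
    note jc' = continuous_on_subset[OF jc sub']
    have "integral {c'..d'} (\<lambda>t. M (k n) R x t * D' t - M (k (Suc (Suc n))) \<psi> x t * D t
            - M (k n) (\<lambda>p. \<gamma> (\<psi> p)) x t * D t) = 0"
      by (subst Henstock_Kurzweil_Integration.integral_diff)
        (auto simp: eq intro!: integrable_continuous_interval continuous_intros jc' kc kc2 R_cont \<psi>o \<gamma>\<psi>o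
          continuous_on_subset[OF Dc] continuous_on_subset[OF D'])
    then show "integral {c'..d'} (\<lambda>t. M (k n) R x t * D' t +
        - (M (k (Suc (Suc n))) \<psi> x t + M (k n) (\<lambda>p. \<gamma> (\<psi> p)) x t) * D t) = 0"
      by (simp add: algebra_simps)
  qed
qed

end

context weak_stream_box
begin

lemma open_closed: "{a1..a2} \<times> {c<..<d} \<subseteq> {a1..a2} \<times> {c..d}"
  by auto

lemmas \<psi>_cont_open = continuous_on_subset[OF \<psi>_cont open_closed]
  and \<gamma>\<psi>_cont_open = continuous_on_subset[OF \<gamma>\<psi>_cont open_closed]
  and \<gamma>'\<psi>_cont_open = continuous_on_subset[OF \<gamma>'\<psi>_cont open_closed]

lemma moll_deriv_x:
  assumes m: "mollifier \<epsilon> k" and n: "n < 3" and f: "continuous_on ({a1..a2} \<times> T) f" and t: "t \<in> T"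
  shows "((\<lambda>x. M (k n) f x t) has_real_derivative M (k (Suc n)) f x t) (at x)"
proof (rule moll_has_derivative_x)
  show "(k n has_real_derivative k (Suc n) z) (at z)" for z by (rule mollifier_deriv[OF m n])
  show "continuous_on UNIV (k (Suc n))" by (rule mollifier_cont[OF m]) (use n in simp)
  show "continuous_on {a1..a2} (\<lambda>s. f (s, t))" by (rule continuous_on_slice[OF f t])
qed

lemma moll_\<psi>_deriv_t:
  assumes m: "mollifier \<epsilon> k" and n: "n \<le> 3" and t: "t \<in> {c<..<d}"
  shows "(M (k n) \<psi> x has_real_derivative M (k n) R x t) (at t)"
  by (rule moll_has_derivative_t[OF mollifier_cont[OF m n] R \<psi>_cont_open R_cont t])

lemma moll_\<gamma>\<psi>_deriv_t:
  assumes m: "mollifier \<epsilon> k" and n: "n \<le> 3" and t: "t \<in> {c<..<d}"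
  shows "(M (k n) (\<lambda>p. \<gamma> (\<psi> p)) x has_real_derivative M (k n) (\<lambda>p. \<gamma>' (\<psi> p) * R p) x t) (at t)"
  by (rule moll_has_derivative_t[OF mollifier_cont[OF m n] \<gamma>\<psi>_deriv_t \<gamma>\<psi>_cont_open
      continuous_on_mult[OF \<gamma>'\<psi>_cont_open R_cont] t])

lemma moll_\<gamma>\<psi>_by_parts:
  assumes "mollifier \<epsilon> k" "a1 \<le> x - \<epsilon>" "x + \<epsilon> \<le> a2" "n < 3" and t: "t \<in> {c<..<d}"
  shows "M (k (Suc n)) (\<lambda>p. \<gamma> (\<psi> p)) x t = M (k n) (\<lambda>p. \<gamma>' (\<psi> p) * P p) x t"
proof (rule moll_by_parts[OF assms(1-4)])
  show "continuous_on {a1..a2} (\<lambda>s. \<gamma> (\<psi> (s, t)))"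
    by (rule continuous_on_slice[OF \<gamma>\<psi>_cont_open t])
  show "continuous_on {a1..a2} (\<lambda>s. \<gamma>' (\<psi> (s, t)) * P (s, t))"
    by (rule continuous_on_slice[OF continuous_on_mult[OF \<gamma>'\<psi>_cont_open P_cont] t])
  show "((\<lambda>s. \<gamma> (\<psi> (s, t))) has_real_derivative \<gamma>' (\<psi> (s, t)) * P (s, t)) (at s)" if "s \<in> {a1<..<a2}" for s
    by (rule \<gamma>\<psi>_deriv_x) (use that t in auto)
qed

lemma moll_abs_le:
  assumes m: "mollifier \<epsilon> k" and x: "a1 \<le> x - \<epsilon>" "x + \<epsilon> \<le> a2"
    and f: "continuous_on ({a1..a2} \<times> T) f" and t: "t \<in> T"
    and le: "\<And>s. s \<in> {a1..a2} \<Longrightarrow> \<bar>f (s, t)\<bar> \<le> u"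
  shows "\<bar>M (k 0) f x t\<bar> \<le> u"
proof -
  have *: "f (s, t) \<le> u \<and> - u \<le> f (s, t)" if "\<bar>s - x\<bar> \<le> \<epsilon>" for s
  proof -
    have "s \<in> {a1..a2}" using that x by auto
    from le[OF this] show ?thesis by linarith
  qed
  have "M (k 0) f x t \<le> u"
    by (rule moll_average_le[OF m x continuous_on_slice[OF f t]]) (use * in blast)
  moreover have "- u \<le> M (k 0) f x t"
    by (rule moll_average_ge[OF m x continuous_on_slice[OF f t]]) (use * in blast)
  ultimately show ?thesis by linarith
qed

lemma moll_const_deriv:
  assumes "mollifier \<epsilon> k" "a1 \<le> x - \<epsilon>" "x + \<epsilon> \<le> a2" "n < 3" "\<And>s. s \<in> {a1..a2} \<Longrightarrow> f (s, t) = b"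
  shows "M (k (Suc n)) f x t = 0"
proof -
  have "M (k (Suc n)) (\<lambda>_. b) x t = M (k n) (\<lambda>_. 0) x t"
    by (rule moll_by_parts[OF assms(1-4)]) auto
  moreover have "M (k (Suc n)) f x t = M (k (Suc n)) (\<lambda>_. b) x t"
    unfolding moll_def by (rule integral_cong) (simp add: assms(5))
  ultimately show ?thesis by (simp add: moll_def)
qed

lemma moll_comp_continuous:
  assumes m: "mollifier \<epsilon> k" "n \<le> 3" and f: "continuous_on ({a1..a2} \<times> T) f"
    and g: "continuous_on S g" "continuous_on S h" "\<And>p. p \<in> S \<Longrightarrow> h p \<in> T"
  shows "continuous_on S (\<lambda>p. M (k n) f (g p) (h p))"
proof -
  have "continuous_on (UNIV \<times> T) (\<lambda>(x, t). M (k n) f x t)"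
    by (rule continuous_on_moll[OF mollifier_cont[OF m] f])
  moreover have "continuous_on S (\<lambda>p. (g p, h p))" by (intro continuous_intros g)
  ultimately have "continuous_on S (\<lambda>p. (\<lambda>(x, t). M (k n) f x t) (g p, h p))"
    by (rule continuous_on_compose2) (use g in auto)
  then show ?thesis by simp
qed

end

section \<open>The gradient at the bed\<close>

lemma DERIV_le_of_linear_bound:
  fixes g :: "real \<Rightarrow> real"
  assumes g: "(g has_real_derivative D) (at 0)" and "g 0 = 0" and e: "0 < e"
    and le: "\<And>s. 0 \<le> s \<Longrightarrow> s \<le> e \<Longrightarrow> g s \<le> A * s"
  shows "D \<le> A"
proof (rule ccontr)
  assume "\<not> D \<le> A"
  then have "0 < D - A" by simp
  moreover have "((\<lambda>s. g s - A * s) has_real_derivative D - A) (at 0)"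
    by (rule DERIV_diff[OF g]) (auto intro!: derivative_eq_intros)
  ultimately obtain r where r: "0 < r" and inc: "\<And>h. 0 < h \<Longrightarrow> h < r \<Longrightarrow> g 0 - A * 0 < g (0 + h) - A * (0 + h)"
    using DERIV_pos_inc_right by blast
  define h where "h = min r e / 2"
  have h: "0 < h" "h < r" "h \<le> e" using r e by (auto simp: h_def)
  show False using inc[OF h(1,2)] le[of h] h assms(2) by simp
qed

lemma DERIV_add_arg:
  fixes g :: "real \<Rightarrow> real"
  assumes "(g has_real_derivative D) (at (x + y))"
  shows "((\<lambda>y. g (x + y)) has_real_derivative D) (at y)"
proof -
  have "((\<lambda>y. g (x + y)) has_real_derivative D * (0 + 1)) (at y)"
    by (rule DERIV_chain2[where f = g and g = "\<lambda>y. x + y", OF assms]) (auto intro!: derivative_eq_intros)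
  then show ?thesis by simp
qed

lemma DERIV_diff_arg:
  fixes g :: "real \<Rightarrow> real"
  assumes "(g has_real_derivative D) (at (x - y))"
  shows "((\<lambda>y. g (x - y)) has_real_derivative - D) (at y)"
proof -
  have "((\<lambda>y. g (x - y)) has_real_derivative D * (0 - 1)) (at y)"
    by (rule DERIV_chain2[where f = g and g = "\<lambda>y. x - y", OF assms]) (auto intro!: derivative_eq_intros)
  then show ?thesis by simp
qed

text \<open>A rectangle standing on the bed, and a point \<open>(a, c)\<close> of the bed that has distance at least \<open>5 \<delta>\<close> to
the vertical sides: the estimates for \<open>|x - a| \<le> \<delta>\<close> use points at distance up to \<open>4 \<delta>\<close>, and averages
over intervals of length at most \<open>2 \<delta>\<close> around these.\<close>

locale bed_box = weak_stream_box +
  fixes C G0 G1 :: real and a \<delta> :: real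
  assumes bed: "\<And>s. s \<in> {a1..a2} \<Longrightarrow> \<psi> (s, c) = B"
    and P_bound: "\<And>s t. s \<in> {a1..a2} \<Longrightarrow> t \<in> {c<..<d} \<Longrightarrow> \<bar>P (s, t)\<bar> \<le> C"
    and G0: "\<And>s t. s \<in> {a1..a2} \<Longrightarrow> t \<in> {c<..<d} \<Longrightarrow> \<bar>\<gamma> (\<psi> (s, t))\<bar> \<le> G0"
    and G1: "\<And>s t. s \<in> {a1..a2} \<Longrightarrow> t \<in> {c<..<d} \<Longrightarrow> \<bar>\<gamma>' (\<psi> (s, t)) * P (s, t)\<bar> \<le> G1"
    and C_nonneg: "0 \<le> C" and G1_nonneg: "0 \<le> G1"
    and \<delta>: "0 < \<delta>" "a1 \<le> a - 5 * \<delta>" "a + 5 * \<delta> \<le> a2" "c + 2 * \<delta> \<le> d"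
begin

definition "A1 = 2 * C / \<delta> + (G1 + 1) * \<delta> / 2"
definition "A2 = 4 * A1 + (G1 + 1) * \<delta> / 2"

lemma moll_vorticity_dx_bound:
  assumes "mollifier \<epsilon> k" "\<epsilon> \<le> \<delta>" "\<bar>x - a\<bar> \<le> 4 * \<delta>" "t \<in> {c<..<d}"
  shows "\<bar>M (k (Suc 0)) (\<lambda>p. \<gamma> (\<psi> p)) x t\<bar> \<le> G1"
proof -
  have x: "a1 \<le> x - \<epsilon>" "x + \<epsilon> \<le> a2" using assms(2,3) \<delta> by linarith+
  have "M (k (Suc 0)) (\<lambda>p. \<gamma> (\<psi> p)) x t = M (k 0) (\<lambda>p. \<gamma>' (\<psi> p) * P p) x t"
    by (rule moll_\<gamma>\<psi>_by_parts[OF assms(1) x _ assms(4)]) simp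
  moreover have "\<bar>M (k 0) (\<lambda>p. \<gamma>' (\<psi> p) * P p) x t\<bar> \<le> G1"
    by (rule moll_abs_le[OF assms(1) x continuous_on_mult[OF \<gamma>'\<psi>_cont_open P_cont] assms(4)])
      (rule G1[OF _ assms(4)])
  ultimately show ?thesis by simp
qed

text \<open>The barrier applies to the horizontal derivative of the average: this function vanishes on the bed, is
bounded by the Lipschitz constant \<open>C\<close> and has Laplacian bounded by \<open>G1\<close>. The bound does not depend on
the scale of the average. The sign \<open>\<sigma>\<close> yields both inequalities at once.\<close>

lemma moll_dx_linear_bound:
  assumes m: "mollifier \<epsilon> k" and \<epsilon>: "\<epsilon> \<le> \<delta>" and x: "\<bar>x - a\<bar> \<le> 3 * \<delta>" and s: "0 \<le> s" "s \<le> \<delta>"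
  shows "\<bar>M (k (Suc 0)) \<psi> x (c + s)\<bar> \<le> A1 * s"
proof -
  have main: "\<sigma> * M (k (Suc 0)) \<psi> (x + 0) (c + s) \<le> A1 * s" if \<sigma>: "\<sigma> = 1 \<or> \<sigma> = - 1" for \<sigma>
    unfolding A1_def
  proof (rule linear_barrier[where f = "\<lambda>s y. \<sigma> * M (k (Suc 0)) \<psi> (x + y) (c + s)"
      and fs = "\<lambda>s y. \<sigma> * M (k (Suc 0)) R (x + y) (c + s)"
      and fss = "\<lambda>s y. \<sigma> * - (M (k (Suc (Suc (Suc 0)))) \<psi> (x + y) (c + s) + M (k (Suc 0)) (\<lambda>p. \<gamma> (\<psi> p)) (x + y) (c + s))"
      and fy = "\<lambda>s y. \<sigma> * M (k (Suc (Suc 0))) \<psi> (x + y) (c + s)"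
      and fyy = "\<lambda>s y. \<sigma> * M (k (Suc (Suc (Suc 0)))) \<psi> (x + y) (c + s)"
      and d = \<delta> and M = C and N = G1])
    show "continuous_on ({0..\<delta>} \<times> {- \<delta>..\<delta>}) (\<lambda>(s, y). \<sigma> * M (k (Suc 0)) \<psi> (x + y) (c + s))"
      unfolding case_prod_beta
      by (intro continuous_intros moll_comp_continuous[OF m _ \<psi>_cont]) (use \<delta> in auto)
    fix s y :: real
    assume sy: "0 < s" "s < \<delta>" "\<bar>y\<bar> < \<delta>"
    have t: "c + s \<in> {c<..<d}" using sy \<delta> by auto
    have xy: "\<bar>(x + y) - a\<bar> \<le> 4 * \<delta>" using x sy by linarith
    have xy': "a1 \<le> (x + y) - \<epsilon>" "(x + y) + \<epsilon> \<le> a2" using xy \<epsilon> \<delta> by linarith+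
    show "((\<lambda>s. \<sigma> * M (k (Suc 0)) \<psi> (x + y) (c + s)) has_real_derivative \<sigma> * M (k (Suc 0)) R (x + y) (c + s)) (at s)"
      by (rule DERIV_cmult, rule DERIV_add_arg[OF moll_\<psi>_deriv_t[OF m _ t]]) simp
    show "((\<lambda>s. \<sigma> * M (k (Suc 0)) R (x + y) (c + s)) has_real_derivative
       \<sigma> * - (M (k (Suc (Suc (Suc 0)))) \<psi> (x + y) (c + s) + M (k (Suc 0)) (\<lambda>p. \<gamma> (\<psi> p)) (x + y) (c + s))) (at s)"
      by (rule DERIV_cmult, rule DERIV_add_arg[OF moll_R_deriv_t[OF m xy' _ t]]) simp
    show "((\<lambda>y. \<sigma> * M (k (Suc 0)) \<psi> (x + y) (c + s)) has_real_derivative \<sigma> * M (k (Suc (Suc 0))) \<psi> (x + y) (c + s)) (at y)"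
      by (rule DERIV_cmult, rule DERIV_add_arg[where g = "\<lambda>x. M (k (Suc 0)) \<psi> x (c + s)"],
        rule moll_deriv_x[OF m _ \<psi>_cont_open t]) simp
    show "((\<lambda>y. \<sigma> * M (k (Suc (Suc 0))) \<psi> (x + y) (c + s)) has_real_derivative \<sigma> * M (k (Suc (Suc (Suc 0)))) \<psi> (x + y) (c + s)) (at y)"
      by (rule DERIV_cmult, rule DERIV_add_arg[where g = "\<lambda>x. M (k (Suc (Suc 0))) \<psi> x (c + s)"],
        rule moll_deriv_x[OF m _ \<psi>_cont_open t]) simp
    have "\<bar>\<sigma> * M (k (Suc 0)) (\<lambda>p. \<gamma> (\<psi> p)) (x + y) (c + s)\<bar> \<le> G1"
      using moll_vorticity_dx_bound[OF m \<epsilon> xy t] \<sigma> by (auto simp: abs_mult)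
    then show "- G1 \<le> \<sigma> * - (M (k (Suc (Suc (Suc 0)))) \<psi> (x + y) (c + s) + M (k (Suc 0)) (\<lambda>p. \<gamma> (\<psi> p)) (x + y) (c + s)) +
        \<sigma> * M (k (Suc (Suc (Suc 0)))) \<psi> (x + y) (c + s)"
      by (simp add: algebra_simps abs_le_iff)
  next
    fix s y :: real
    assume sy: "0 \<le> s" "s \<le> \<delta>" "\<bar>y\<bar> \<le> \<delta>"
    have xy: "a1 \<le> (x + y) - \<epsilon>" "(x + y) + \<epsilon> \<le> a2" using x sy \<epsilon> \<delta> by linarith+
    have "\<bar>M (k (Suc 0)) \<psi> (x + y) (c + s)\<bar> \<le> C"
    proof (cases "s = 0")
      case True
      then show ?thesis using moll_const_deriv[OF m xy, of 0 \<psi> c B] bed C_nonneg by simp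
    next
      case False
      then have t: "c + s \<in> {c<..<d}" using sy \<delta> by auto
      have "M (k (Suc 0)) \<psi> (x + y) (c + s) = M (k 0) P (x + y) (c + s)"
        by (rule moll_\<psi>_by_parts[OF m xy _ t]) simp
      moreover have "\<bar>M (k 0) P (x + y) (c + s)\<bar> \<le> C"
        by (rule moll_abs_le[OF m xy P_cont t]) (rule P_bound[OF _ t])
      ultimately show ?thesis by simp
    qed
    then show "\<sigma> * M (k (Suc 0)) \<psi> (x + y) (c + s) \<le> C" using \<sigma> by auto
  next
    fix y :: real assume "\<bar>y\<bar> \<le> \<delta>"
    then have xy: "a1 \<le> (x + y) - \<epsilon>" "(x + y) + \<epsilon> \<le> a2" using x \<epsilon> \<delta> by linarith+
    show "\<sigma> * M (k (Suc 0)) \<psi> (x + y) (c + 0) \<le> 0"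
      using moll_const_deriv[OF m xy, of 0 \<psi> c B] bed by simp
  qed (use \<delta> C_nonneg G1_nonneg s in auto)
  show ?thesis using main[of 1] main[of "- 1"] by (simp add: abs_le_iff)
qed

text \<open>At height \<open>r\<close> above the bed, half the difference of the values at \<open>x + s\<close> and \<open>x - s\<close> vanishes for \<open>s = 0\<close>
and is of size \<open>r\<close> for \<open>s \<le> r\<close> and heights up to \<open>2 r\<close>, by the preceding bound. The barrier with the roles of
the two directions exchanged therefore has a slope that is bounded independently of \<open>r\<close>.\<close>

lemma moll_dxx_bound:
  assumes m: "mollifier \<epsilon> k" and \<epsilon>: "\<epsilon> \<le> \<delta>" and x: "\<bar>x - a\<bar> \<le> \<delta>" and r: "0 < r" "r \<le> \<delta> / 2"
  shows "\<bar>M (k (Suc (Suc 0))) \<psi> x (c + r)\<bar> \<le> A2"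
proof -
  have A1: "0 \<le> A1" using C_nonneg G1_nonneg \<delta> by (simp add: A1_def)
  have t0: "c + r \<in> {c<..<d}" using r \<delta> by auto
  have main: "\<sigma> * M (k (Suc (Suc 0))) \<psi> x (c + r) \<le> A2" if \<sigma>: "\<sigma> = 1 \<or> \<sigma> = - 1" for \<sigma>
  proof -
    define f where "f = (\<lambda>s y. \<sigma> / 2 * (M (k (Suc 0)) \<psi> (x + s) ((c + r) + y) - M (k (Suc 0)) \<psi> (x - s) ((c + r) + y)))"
    have bound: "f s y \<le> 2 * A1 * r" if "0 \<le> s" "s \<le> r" "\<bar>y\<bar> \<le> r" for s y
    proof -
      have "\<bar>M (k (Suc 0)) \<psi> z (c + (r + y))\<bar> \<le> A1 * (r + y)" if "\<bar>z - x\<bar> \<le> s" for z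
        by (rule moll_dx_linear_bound[OF m \<epsilon>]) (use that \<open>s \<le> r\<close> \<open>\<bar>y\<bar> \<le> r\<close> x r in auto)
      from this[of "x + s"] this[of "x - s"] have "f s y \<le> A1 * (r + y)"
        using \<sigma> \<open>0 \<le> s\<close> by (auto simp: f_def abs_le_iff add.assoc)
      also have "\<dots> \<le> A1 * (2 * r)" using A1 that by (intro mult_left_mono) auto
      finally show ?thesis by simp
    qed
    have le: "f s 0 \<le> A2 * s" if s: "0 \<le> s" "s \<le> r" for s
    proof -
      have "f s 0 \<le> (2 * (2 * A1 * r) / r + (G1 + 1) * r / 2) * s"
      proof (rule linear_barrier[where f = f
          and fs = "\<lambda>s y. \<sigma> / 2 * (M (k (Suc (Suc 0))) \<psi> (x + s) ((c + r) + y) - - M (k (Suc (Suc 0))) \<psi> (x - s) ((c + r) + y))"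
          and fss = "\<lambda>s y. \<sigma> / 2 * (M (k (Suc (Suc (Suc 0)))) \<psi> (x + s) ((c + r) + y) - - (- M (k (Suc (Suc (Suc 0)))) \<psi> (x - s) ((c + r) + y)))"
          and fy = "\<lambda>s y. \<sigma> / 2 * (M (k (Suc 0)) R (x + s) ((c + r) + y) - M (k (Suc 0)) R (x - s) ((c + r) + y))"
          and fyy = "\<lambda>s y. \<sigma> / 2 * (- (M (k (Suc (Suc (Suc 0)))) \<psi> (x + s) ((c + r) + y) + M (k (Suc 0)) (\<lambda>p. \<gamma> (\<psi> p)) (x + s) ((c + r) + y))
            - - (M (k (Suc (Suc (Suc 0)))) \<psi> (x - s) ((c + r) + y) + M (k (Suc 0)) (\<lambda>p. \<gamma> (\<psi> p)) (x - s) ((c + r) + y)))"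
          and d = r and M = "2 * A1 * r" and N = G1])
        show "continuous_on ({0..r} \<times> {- r..r}) (\<lambda>(s, y). f s y)"
          unfolding case_prod_beta f_def
          by (intro continuous_intros moll_comp_continuous[OF m _ \<psi>_cont]) (use \<delta> r in auto)
        fix s y :: real
        assume sy: "0 < s" "s < r" "\<bar>y\<bar> < r"
        have t: "(c + r) + y \<in> {c<..<d}" using sy r \<delta> by auto
        have xs: "\<bar>(x + s) - a\<bar> \<le> 4 * \<delta>" "\<bar>(x - s) - a\<bar> \<le> 4 * \<delta>" using x sy r by linarith+
        have xs': "a1 \<le> (x + s) - \<epsilon>" "(x + s) + \<epsilon> \<le> a2" "a1 \<le> (x - s) - \<epsilon>" "(x - s) + \<epsilon> \<le> a2"
          using xs \<epsilon> \<delta> by linarith+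
        have dx: "((\<lambda>s. M (k n) \<psi> (x + s) ((c + r) + y)) has_real_derivative M (k (Suc n)) \<psi> (x + s) ((c + r) + y)) (at s)"
          "((\<lambda>s. M (k n) \<psi> (x - s) ((c + r) + y)) has_real_derivative - M (k (Suc n)) \<psi> (x - s) ((c + r) + y)) (at s)"
          if "n < 3" for n
          by (rule DERIV_add_arg[where g = "\<lambda>x. M (k n) \<psi> x ((c + r) + y)"] DERIV_diff_arg[where g = "\<lambda>x. M (k n) \<psi> x ((c + r) + y)"],
            rule moll_deriv_x[OF m that \<psi>_cont_open t])+
        show "((\<lambda>s. f s y) has_real_derivative \<sigma> / 2 * (M (k (Suc (Suc 0))) \<psi> (x + s) ((c + r) + y) - - M (k (Suc (Suc 0))) \<psi> (x - s) ((c + r) + y))) (at s)"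
          unfolding f_def by (rule DERIV_cmult, rule DERIV_diff, rule dx, simp, rule dx, simp)
        show "((\<lambda>s. \<sigma> / 2 * (M (k (Suc (Suc 0))) \<psi> (x + s) ((c + r) + y) - - M (k (Suc (Suc 0))) \<psi> (x - s) ((c + r) + y))) has_real_derivative
            \<sigma> / 2 * (M (k (Suc (Suc (Suc 0)))) \<psi> (x + s) ((c + r) + y) - - (- M (k (Suc (Suc (Suc 0)))) \<psi> (x - s) ((c + r) + y)))) (at s)"
          by (rule DERIV_cmult, rule DERIV_diff, rule dx, simp, rule DERIV_minus, rule dx, simp)
        show "(f s has_real_derivative \<sigma> / 2 * (M (k (Suc 0)) R (x + s) ((c + r) + y) - M (k (Suc 0)) R (x - s) ((c + r) + y))) (at y)"
          unfolding f_def
          by (rule DERIV_cmult, rule DERIV_diff; rule DERIV_add_arg[OF moll_\<psi>_deriv_t[OF m _ t]]) simp_all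
        show "((\<lambda>y. \<sigma> / 2 * (M (k (Suc 0)) R (x + s) ((c + r) + y) - M (k (Suc 0)) R (x - s) ((c + r) + y))) has_real_derivative
            \<sigma> / 2 * (- (M (k (Suc (Suc (Suc 0)))) \<psi> (x + s) ((c + r) + y) + M (k (Suc 0)) (\<lambda>p. \<gamma> (\<psi> p)) (x + s) ((c + r) + y))
            - - (M (k (Suc (Suc (Suc 0)))) \<psi> (x - s) ((c + r) + y) + M (k (Suc 0)) (\<lambda>p. \<gamma> (\<psi> p)) (x - s) ((c + r) + y)))) (at y)"
          by (rule DERIV_cmult, rule DERIV_diff, rule DERIV_add_arg[OF moll_R_deriv_t[OF m xs'(1,2) _ t]], simp,
              rule DERIV_add_arg[OF moll_R_deriv_t[OF m xs'(3,4) _ t]], simp)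
        have "\<bar>M (k (Suc 0)) (\<lambda>p. \<gamma> (\<psi> p)) (x + s) ((c + r) + y)\<bar> \<le> G1"
          "\<bar>M (k (Suc 0)) (\<lambda>p. \<gamma> (\<psi> p)) (x - s) ((c + r) + y)\<bar> \<le> G1"
          by (rule moll_vorticity_dx_bound[OF m \<epsilon> _ t], rule xs)+
        then show "- G1 \<le> \<sigma> / 2 * (M (k (Suc (Suc (Suc 0)))) \<psi> (x + s) ((c + r) + y) - - (- M (k (Suc (Suc (Suc 0)))) \<psi> (x - s) ((c + r) + y))) +
            \<sigma> / 2 * (- (M (k (Suc (Suc (Suc 0)))) \<psi> (x + s) ((c + r) + y) + M (k (Suc 0)) (\<lambda>p. \<gamma> (\<psi> p)) (x + s) ((c + r) + y))
            - - (M (k (Suc (Suc (Suc 0)))) \<psi> (x - s) ((c + r) + y) + M (k (Suc 0)) (\<lambda>p. \<gamma> (\<psi> p)) (x - s) ((c + r) + y)))"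
          using \<sigma> by (auto simp: abs_le_iff field_simps)
      qed (use r s A1 G1_nonneg bound in \<open>auto simp: f_def\<close>)
      also have "\<dots> \<le> A2 * s"
      proof (rule mult_right_mono)
        have "(G1 + 1) * r \<le> (G1 + 1) * \<delta>" using r G1_nonneg by (intro mult_left_mono) auto
        then show "2 * (2 * A1 * r) / r + (G1 + 1) * r / 2 \<le> A2"
          using r by (simp add: A2_def)
      qed (use s in simp)
      finally show ?thesis .
    qed
    have "((\<lambda>s. f s 0) has_real_derivative
      \<sigma> / 2 * (M (k (Suc (Suc 0))) \<psi> (x + 0) ((c + r) + 0) - - M (k (Suc (Suc 0))) \<psi> (x - 0) ((c + r) + 0))) (at 0)"
      unfolding f_def
      by (rule DERIV_cmult, rule DERIV_diff,
        rule DERIV_add_arg[where g = "\<lambda>x. M (k (Suc 0)) \<psi> x ((c + r) + 0)"],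
        rule moll_deriv_x[OF m _ \<psi>_cont_open], simp, use t0 in simp,
        rule DERIV_diff_arg[where g = "\<lambda>x. M (k (Suc 0)) \<psi> x ((c + r) + 0)"],
        rule moll_deriv_x[OF m _ \<psi>_cont_open], simp, use t0 in simp)
    from DERIV_le_of_linear_bound[OF this _ r(1) le] show ?thesis by (simp add: f_def)
  qed
  show ?thesis using main[of 1] main[of "- 1"] by (simp add: abs_le_iff)
qed


lemma mollifiers_exist:
  obtains k where "\<And>n. mollifier (\<delta> / real (Suc n)) (k n)" "\<And>n. \<delta> / real (Suc n) \<le> \<delta>"
    "(\<lambda>n. \<delta> / real (Suc n)) \<longlonglongrightarrow> 0"
proof -
  have "\<forall>n. \<exists>k. mollifier (\<delta> / real (Suc n)) k" using \<delta> by (intro allI ex_mollifier) simp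
  then obtain k where k: "\<And>n. mollifier (\<delta> / real (Suc n)) (k n)" by metis
  have "\<delta> / real (Suc n) \<le> \<delta>" for n
    using \<delta> by (simp add: field_simps)
  then show ?thesis using that[OF k] LIMSEQ_Suc[OF lim_const_over_n[of \<delta>]] by simp
qed

text \<open>In the Poisson equation for the averages, \<open>moll_dxx_bound\<close> controls the second vertical
derivative uniformly in the scale.\<close>

lemma R_lipschitz:
  assumes x: "\<bar>x - a\<bar> \<le> \<delta>" and t: "t \<in> {c<..c + \<delta> / 2}" "t' \<in> {c<..c + \<delta> / 2}"
  shows "\<bar>R (x, t) - R (x, t')\<bar> \<le> (A2 + G0) * \<bar>t - t'\<bar>"
proof -
  obtain k where k: "\<And>n. mollifier (\<delta> / real (Suc n)) (k n)" and le: "\<And>n. \<delta> / real (Suc n) \<le> \<delta>"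
    and lim0: "(\<lambda>n. \<delta> / real (Suc n)) \<longlonglongrightarrow> 0" by (rule mollifiers_exist, rule that)
  have xn: "a1 \<le> x - \<delta> / real (Suc n)" "x + \<delta> / real (Suc n) \<le> a2" for n
    using x le[of n] \<delta> by linarith+
  have tcd: "s \<in> {c<..<d}" if "s \<in> {c<..c + \<delta> / 2}" for s using that \<delta> by auto
  have "\<bar>M (k n 0) R x t - M (k n 0) R x t'\<bar> \<le> (A2 + G0) * \<bar>t - t'\<bar>" for n
  proof -
    note m = k[of n]
    have "norm (M (k n 0) R x t - M (k n 0) R x t') \<le> (A2 + G0) * norm (t - t')"
    proof (rule field_differentiable_bound[of "{c<..c + \<delta> / 2}"])
      fix s assume s: "s \<in> {c<..c + \<delta> / 2}"
      show "(M (k n 0) R x has_real_derivative - (M (k n (Suc (Suc 0))) \<psi> x s + M (k n 0) (\<lambda>p. \<gamma> (\<psi> p)) x s))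
              (at s within {c<..c + \<delta> / 2})"
        by (rule DERIV_subset[OF moll_R_deriv_t[OF m xn _ tcd[OF s]] subset_UNIV]) simp
      have "\<bar>M (k n (Suc (Suc 0))) \<psi> x (c + (s - c))\<bar> \<le> A2"
        by (rule moll_dxx_bound[OF m le x]) (use s in auto)
      moreover have "\<bar>M (k n 0) (\<lambda>p. \<gamma> (\<psi> p)) x s\<bar> \<le> G0"
        by (rule moll_abs_le[OF m xn \<gamma>\<psi>_cont_open tcd[OF s]]) (rule G0[OF _ tcd[OF s]])
      ultimately show "norm (- (M (k n (Suc (Suc 0))) \<psi> x s + M (k n 0) (\<lambda>p. \<gamma> (\<psi> p)) x s)) \<le> A2 + G0"
        by simp
    qed (use t in auto)
    then show ?thesis by simp
  qed
  moreover have "(\<lambda>n. M (k n 0) R x s) \<longlonglongrightarrow> R (x, s)" if "s \<in> {c<..c + \<delta> / 2}" for s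
  proof (rule moll_tendsto[OF k lim0 R_cont xn])
    show "(x, s) \<in> {a1..a2} \<times> {c<..<d}" using tcd[OF that] x \<delta> by auto
  qed (use tcd[OF that] in auto)
  ultimately show ?thesis
    using t by (intro LIMSEQ_le_const2[of "\<lambda>n. \<bar>M (k n 0) R x t - M (k n 0) R x t'\<bar>"]) (auto intro!: tendsto_intros)
qed

lemma P_vanishes_at_bed:
  assumes x: "\<bar>x - a\<bar> \<le> \<delta>" and s: "0 < s" "s \<le> \<delta>"
  shows "\<bar>P (x, c + s)\<bar> \<le> A1 * s"
proof -
  obtain k where k: "\<And>n. mollifier (\<delta> / real (Suc n)) (k n)" and le: "\<And>n. \<delta> / real (Suc n) \<le> \<delta>"
    and lim0: "(\<lambda>n. \<delta> / real (Suc n)) \<longlonglongrightarrow> 0" by (rule mollifiers_exist, rule that)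
  have xn: "a1 \<le> x - \<delta> / real (Suc n)" "x + \<delta> / real (Suc n) \<le> a2" for n
    using x le[of n] \<delta> by linarith+
  have t: "c + s \<in> {c<..<d}" using s \<delta> by auto
  have "\<bar>M (k n 0) P x (c + s)\<bar> \<le> A1 * s" for n
  proof -
    have "M (k n (Suc 0)) \<psi> x (c + s) = M (k n 0) P x (c + s)"
      by (rule moll_\<psi>_by_parts[OF k xn _ t]) simp
    moreover have "\<bar>M (k n (Suc 0)) \<psi> x (c + s)\<bar> \<le> A1 * s"
      by (rule moll_dx_linear_bound[OF k le]) (use x s \<delta> in auto)
    ultimately show ?thesis by simp
  qed
  moreover have "(\<lambda>n. M (k n 0) P x (c + s)) \<longlonglongrightarrow> P (x, c + s)"
  proof (rule moll_tendsto[OF k lim0 P_cont xn])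
    show "(x, c + s) \<in> {a1..a2} \<times> {c<..<d}" using t x \<delta> by auto
  qed (use t in auto)
  ultimately show ?thesis
    by (intro LIMSEQ_le_const2[of "\<lambda>n. \<bar>M (k n 0) P x (c + s)\<bar>"]) (auto intro!: tendsto_intros)
qed

lemma P_limit: "(P \<longlongrightarrow> 0) (at (a, c) within {a1..a2} \<times> {c<..<d})"
proof (rule tendstoI)
  fix e :: real assume e: "0 < e"
  have A1: "0 \<le> A1" using C_nonneg G1_nonneg \<delta> by (simp add: A1_def)
  define r where "r = min \<delta> (e / (A1 + 1))"
  have r: "0 < r" "r \<le> \<delta>" "r \<le> e / (A1 + 1)" using \<delta> e A1 by (auto simp: r_def)
  have "dist (P p) 0 < e" if "p \<in> {a1..a2} \<times> {c<..<d}" "dist p (a, c) < r" for p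
  proof -
    obtain x t where p: "p = (x, t)" by (cases p)
    have xt: "\<bar>x - a\<bar> < r" "\<bar>t - c\<bar> < r"
      using dist_fst_le[of p "(a, c)"] dist_snd_le[of p "(a, c)"] that p by (auto simp: dist_real_def)
    have t: "c < t" using that p by auto
    have "\<bar>P (x, c + (t - c))\<bar> \<le> A1 * (t - c)"
      by (rule P_vanishes_at_bed) (use xt r t in auto)
    also have "\<dots> \<le> A1 * (e / (A1 + 1))" using xt t r A1 by (intro mult_left_mono) auto
    also have "\<dots> < e" using e A1 by (simp add: field_simps)
    finally show ?thesis by (simp add: p)
  qed
  then show "\<forall>\<^sub>F p in at (a, c) within {a1..a2} \<times> {c<..<d}. dist (P p) 0 < e"
    unfolding eventually_at using r by blast
qed

text \<open>The vertical Lipschitz estimate gives the limit along the vertical line through \<open>(a, c)\<close>. A neighbouring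
vertical line is compared with it at a fixed small height \<open>t1\<close>, where \<open>R\<close> is continuous.\<close>

lemma R_limit: "\<exists>l. (R \<longlongrightarrow> l) (at (a, c) within {a1..a2} \<times> {c<..<d})"
proof -
  define A3 where "A3 = \<bar>A2 + G0\<bar> + 1"
  have A3: "0 < A3" by (simp add: A3_def)
  have lip: "\<bar>R (x, t) - R (x, t')\<bar> \<le> A3 * \<bar>t - t'\<bar>"
    if "\<bar>x - a\<bar> \<le> \<delta>" "t \<in> {c<..c + \<delta> / 2}" "t' \<in> {c<..c + \<delta> / 2}" for x t t'
  proof -
    have "A2 + G0 \<le> A3" unfolding A3_def by linarith
    then have "(A2 + G0) * \<bar>t - t'\<bar> \<le> A3 * \<bar>t - t'\<bar>" by (rule mult_right_mono) simp
    then show ?thesis using R_lipschitz[OF that] by linarith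
  qed
  have "A3-lipschitz_on {c<..c + \<delta> / 2} (\<lambda>t. R (a, t))"
    using lip[of a] A3 \<delta> by (intro lipschitz_onI) (auto simp: dist_real_def)
  then have "uniformly_continuous_on {c<..c + \<delta> / 2} (\<lambda>t. R (a, t))"
    by (rule lipschitz_on_uniformly_continuous)
  moreover have cl: "c \<in> closure {c<..c + \<delta> / 2}" using \<delta> by simp
  ultimately obtain l where l: "((\<lambda>t. R (a, t)) \<longlongrightarrow> l) (at c within {c<..c + \<delta> / 2})"
    using uniformly_continuous_on_extension_at_closure by blast
  have "(R \<longlongrightarrow> l) (at (a, c) within {a1..a2} \<times> {c<..<d})"
  proof (rule tendstoI)
    fix e :: real assume e: "0 < e"
    have "\<forall>\<^sub>F t in at c within {c<..c + \<delta> / 2}. dist (R (a, t)) l < e / 3"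
      using l e by (intro tendstoD) auto
    then obtain r1 where r1: "0 < r1"
      and close: "\<And>t. t \<in> {c<..c + \<delta> / 2} \<Longrightarrow> dist t c < r1 \<Longrightarrow> dist (R (a, t)) l < e / 3"
      unfolding eventually_at by auto
    define q where "q = min (\<delta> / 2) (min r1 (e / (3 * A3)))"
    have q: "0 < q" "q \<le> \<delta> / 2" "q \<le> r1" "q \<le> e / (3 * A3)"
      using \<delta> r1 e A3 by (simp_all add: q_def)
    define t1 where "t1 = c + q / 2"
    have t1: "c < t1" "t1 \<le> c + \<delta> / 2" "t1 - c < r1" "t1 - c \<le> e / (3 * A3)"
      using q unfolding t1_def by linarith+
    have t1d: "t1 \<in> {c<..<d}" using t1 \<delta> by auto
    have slice: "continuous_on {a1..a2} (\<lambda>s. R (s, t1))" by (rule continuous_on_slice[OF R_cont t1d])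
    have a: "a \<in> {a1..a2}" using \<delta> by auto
    from slice[unfolded continuous_on_iff, rule_format, OF a, of "e / 3"] obtain r2 where r2: "0 < r2"
      and near: "\<And>s. s \<in> {a1..a2} \<Longrightarrow> dist s a < r2 \<Longrightarrow> dist (R (s, t1)) (R (a, t1)) < e / 3"
      using e by auto
    define r where "r = min (t1 - c) (min \<delta> r2)"
    have r: "0 < r" "r \<le> t1 - c" "r \<le> \<delta>" "r \<le> r2" using t1 \<delta> r2 by (auto simp: r_def)
    have "dist (R p) l < e" if "p \<in> {a1..a2} \<times> {c<..<d}" "dist p (a, c) < r" for p
    proof -
      obtain x t where p: "p = (x, t)" by (cases p)
      have xt: "\<bar>x - a\<bar> < r" "\<bar>t - c\<bar> < r"
        using dist_fst_le[of p "(a, c)"] dist_snd_le[of p "(a, c)"] that p by (auto simp: dist_real_def)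
      have t: "c < t" "t < t1" using that p xt r by auto
      have "\<bar>R (x, t) - R (x, t1)\<bar> \<le> A3 * \<bar>t - t1\<bar>"
        by (rule lip) (use xt r t t1 in auto)
      also have "\<dots> < A3 * (e / (3 * A3))" using t t1 A3 by (intro mult_strict_left_mono) auto
      also have "\<dots> = e / 3" using A3 by simp
      finally have "\<bar>R (x, t) - R (x, t1)\<bar> < e / 3" .
      moreover have "\<bar>R (x, t1) - R (a, t1)\<bar> < e / 3"
        using near[of x] that p xt r by (auto simp: dist_real_def)
      moreover have "\<bar>R (a, t1) - l\<bar> < e / 3"
        using close[of t1] t1 by (auto simp: dist_real_def)
      ultimately have "\<bar>R (x, t) - l\<bar> < e" by linarith
      then show ?thesis by (simp add: p dist_real_def)
    qed
    then show "\<forall>\<^sub>F p in at (a, c) within {a1..a2} \<times> {c<..<d}. dist (R p) l < e"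
      unfolding eventually_at using r by blast
  qed
  then show ?thesis by blast
qed

end

section \<open>No maximum of the Bernoulli function off the surface\<close>

text \<open>The Cayley--Hamilton theorem for the Hessian \<open>H = (\<alpha>, \<beta>; \<beta>, - \<alpha> - f)\<close>: with \<open>v = (p, q)\<close> and
\<open>w = H v + f v\<close> one has \<open>H w = - det H v\<close>, hence \<open>- |v|\<^sup>2 det H = w \<bullet> (w - f v)\<close>, and the left-hand side
contains the squared norm \<open>f\<^sup>2 - 2 det H\<close> of \<open>H\<close>.\<close>

lemma quadratic_form_identity:
  fixes p q \<alpha> \<beta> f :: real
  defines "w1 \<equiv> p * \<alpha> + q * \<beta> + f * p" and "w2 \<equiv> p * \<beta> - q * \<alpha>"
  shows "(p\<^sup>2 + q\<^sup>2) * (2 * \<beta>\<^sup>2 + \<alpha>\<^sup>2 + (\<alpha> + f)\<^sup>2) =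
    (p\<^sup>2 + q\<^sup>2) * f\<^sup>2 + 2 * (w1 * (w1 - f * p) + w2 * (w2 - f * q))"
  unfolding w1_def w2_def by (simp add: power2_eq_square algebra_simps)

locale bernoulli_box = weak_stream_box +
  fixes g \<omega> :: real and \<Gamma> :: "real \<Rightarrow> real"
  assumes P_cont_closed: "continuous_on ({a1..a2} \<times> {c..d}) P"
    and R_cont_closed: "continuous_on ({a1..a2} \<times> {c..d}) R"
    and R_nonpos: "\<And>p. p \<in> {a1..a2} \<times> {c..d} \<Longrightarrow> R p \<le> 0"
    and g_pos: "0 < g" and \<omega>_nonneg: "0 \<le> \<omega>"
    and \<gamma>_le: "\<And>r. r \<in> {0..B} \<Longrightarrow> \<gamma> r \<le> 2 * \<omega>"
    and \<Gamma>_cont: "continuous_on {0..B} \<Gamma>"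
    and \<Gamma>_deriv: "\<And>r. r \<in> {0<..<B} \<Longrightarrow> (\<Gamma> has_real_derivative \<gamma> r) (at r)"
begin

text \<open>\<open>T\<close> up to an additive constant, for \<open>\<psi>\<close> itself. In \<open>TM\<close> the averages take the place of \<open>\<psi>\<close> and its
gradient; \<open>TM_x\<close>, \<open>TM_t\<close>, \<open>TM_xx\<close> and \<open>TM_tt\<close> are the derivatives of \<open>TM\<close>, in which second vertical derivatives
of the averages have been replaced by means of the Poisson equation.\<close>

definition "T p = 1 / 2 * ((P p)\<^sup>2 + (R p)\<^sup>2) + g * snd p + \<Gamma> (\<psi> p) - \<omega> * \<psi> p"

definition "TM k x t = 1 / 2 * ((M (k (Suc 0)) \<psi> x t)\<^sup>2 + (M (k 0) R x t)\<^sup>2) + g * t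
  + \<Gamma> (M (k 0) \<psi> x t) - \<omega> * M (k 0) \<psi> x t"

definition "TM_x k x t = M (k (Suc 0)) \<psi> x t * M (k (Suc (Suc 0))) \<psi> x t + M (k 0) R x t * M (k (Suc 0)) R x t
  + (\<gamma> (M (k 0) \<psi> x t) - \<omega>) * M (k (Suc 0)) \<psi> x t"

definition "TM_t k x t = M (k (Suc 0)) \<psi> x t * M (k (Suc 0)) R x t
  - M (k 0) R x t * (M (k (Suc (Suc 0))) \<psi> x t + M (k 0) (\<lambda>p. \<gamma> (\<psi> p)) x t)
  + g + (\<gamma> (M (k 0) \<psi> x t) - \<omega>) * M (k 0) R x t"

definition "TM_xx k x t = (M (k (Suc (Suc 0))) \<psi> x t)\<^sup>2 + M (k (Suc 0)) \<psi> x t * M (k (Suc (Suc (Suc 0)))) \<psi> x t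
  + (M (k (Suc 0)) R x t)\<^sup>2 + M (k 0) R x t * M (k (Suc (Suc 0))) R x t
  + \<gamma>' (M (k 0) \<psi> x t) * (M (k (Suc 0)) \<psi> x t)\<^sup>2 + (\<gamma> (M (k 0) \<psi> x t) - \<omega>) * M (k (Suc (Suc 0))) \<psi> x t"

definition "TM_tt k x t = (M (k (Suc 0)) R x t)\<^sup>2
  - M (k (Suc 0)) \<psi> x t * (M (k (Suc (Suc (Suc 0)))) \<psi> x t + M (k (Suc 0)) (\<lambda>p. \<gamma> (\<psi> p)) x t)
  + (M (k (Suc (Suc 0))) \<psi> x t + M (k 0) (\<lambda>p. \<gamma> (\<psi> p)) x t)\<^sup>2
  - M (k 0) R x t * (M (k (Suc (Suc 0))) R x t + M (k 0) (\<lambda>p. \<gamma>' (\<psi> p) * R p) x t)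
  + \<gamma>' (M (k 0) \<psi> x t) * (M (k 0) R x t)\<^sup>2
  - (\<gamma> (M (k 0) \<psi> x t) - \<omega>) * (M (k (Suc (Suc 0))) \<psi> x t + M (k 0) (\<lambda>p. \<gamma> (\<psi> p)) x t)"

lemma moll_\<psi>_range_closed:
  assumes m: "mollifier \<epsilon> k" and x: "a1 \<le> x - \<epsilon>" "x + \<epsilon> \<le> a2" and t: "t \<in> {c..d}"
  shows "M (k 0) \<psi> x t \<in> {0..B}"
proof -
  have r: "\<psi> (s, t) \<in> {0..B}" if "\<bar>s - x\<bar> \<le> \<epsilon>" for s
    by (rule \<psi>_range_closed) (use that x t in auto)
  have "M (k 0) \<psi> x t \<le> B" "0 \<le> M (k 0) \<psi> x t"
    by (rule moll_average_le[OF m x continuous_on_slice[OF \<psi>_cont t]] moll_average_ge[OF m x continuous_on_slice[OF \<psi>_cont t]];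
        use r in force)+
  then show ?thesis by simp
qed

text \<open>The strict inequalities are what makes \<open>\<gamma>\<close> and \<open>\<Gamma>\<close>, which live on \<open>[0, B]\<close>, two-sided differentiable at
the values of the averages.\<close>

lemma moll_\<psi>_range:
  assumes m: "mollifier \<epsilon> k" and x: "a1 \<le> x - \<epsilon>" "x + \<epsilon> \<le> a2" and t: "t \<in> {c<..<d}"
  shows "M (k 0) \<psi> x t \<in> {0<..<B}"
proof -
  have e: "0 < \<epsilon>" by (rule mollifier_pos[OF m])
  have t': "t \<in> {c..d}" using t by auto
  have cont: "continuous_on {a1..a2} (\<lambda>s. \<psi> (s, t))" by (rule continuous_on_slice[OF \<psi>_cont t'])
  have ne: "{a1..a2} \<noteq> {}" using x e by auto
  obtain s1 where s1: "s1 \<in> {a1..a2}" "\<And>s. s \<in> {a1..a2} \<Longrightarrow> \<psi> (s, t) \<le> \<psi> (s1, t)"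
    using continuous_attains_sup[OF compact_Icc ne cont] by blast
  obtain s2 where s2: "s2 \<in> {a1..a2}" "\<And>s. s \<in> {a1..a2} \<Longrightarrow> \<psi> (s2, t) \<le> \<psi> (s, t)"
    using continuous_attains_inf[OF compact_Icc ne cont] by blast
  have sub: "s \<in> {a1..a2}" if "\<bar>s - x\<bar> \<le> \<epsilon>" for s using that x by auto
  have "M (k 0) \<psi> x t \<le> \<psi> (s1, t)"
    by (rule moll_average_le[OF m x cont]) (rule s1(2)[OF sub])
  moreover have "\<psi> (s2, t) \<le> M (k 0) \<psi> x t"
    by (rule moll_average_ge[OF m x cont]) (rule s2(2)[OF sub])
  ultimately show ?thesis using \<psi>_range[OF s1(1) t] \<psi>_range[OF s2(1) t] by auto
qed

lemma moll_const:
  assumes m: "mollifier \<epsilon> k" and x: "a1 \<le> x - \<epsilon>" "x + \<epsilon> \<le> a2" and f: "\<And>s. s \<in> {a1..a2} \<Longrightarrow> f (s, t) = b"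
  shows "M (k 0) f x t = b"
proof -
  have eq: "M (k 0) f x t = M (k 0) (\<lambda>_. b) x t"
    unfolding moll_def by (rule integral_cong) (simp add: f)
  show ?thesis unfolding eq
    by (rule antisym; rule moll_average_le[OF m x] moll_average_ge[OF m x]) auto
qed

lemma \<gamma>_comp_deriv:
  assumes "r \<in> {0<..<B}" "(h has_real_derivative D) (at x)" "h x = r"
  shows "((\<lambda>x. \<gamma> (h x)) has_real_derivative \<gamma>' r * D) (at x)"
  using DERIV_chain2[of \<gamma> "\<gamma>' r" h x D] \<gamma>_deriv_interior[OF assms(1)] assms(2,3) by simp

lemma \<Gamma>_comp_deriv:
  assumes "r \<in> {0<..<B}" "(h has_real_derivative D) (at x)" "h x = r"
  shows "((\<lambda>x. \<Gamma> (h x)) has_real_derivative \<gamma> r * D) (at x)"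
  using DERIV_chain2[of \<Gamma> "\<gamma> r" h x D] \<Gamma>_deriv[OF assms(1)] assms(2,3) by simp

context
  fixes \<epsilon> k x t
  assumes m: "mollifier \<epsilon> k" and x: "a1 \<le> x - \<epsilon>" "x + \<epsilon> \<le> a2" and t: "t \<in> {c<..<d}"
begin

lemma range_U: "M (k 0) \<psi> x t \<in> {0<..<B}"
  by (rule moll_\<psi>_range[OF m x t])

lemma dx_\<psi>: "n < 3 \<Longrightarrow> ((\<lambda>x. M (k n) \<psi> x t) has_real_derivative M (k (Suc n)) \<psi> x t) (at x)"
  by (rule moll_deriv_x[OF m _ \<psi>_cont_open t])

lemma dx_R: "n < 3 \<Longrightarrow> ((\<lambda>x. M (k n) R x t) has_real_derivative M (k (Suc n)) R x t) (at x)"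
  by (rule moll_deriv_x[OF m _ R_cont t])

lemma dt_\<psi>: "n < 3 \<Longrightarrow> ((\<lambda>t. M (k n) \<psi> x t) has_real_derivative M (k n) R x t) (at t)"
  using moll_\<psi>_deriv_t[OF m _ t, of n x] by simp

lemma dt_R: "n < 2 \<Longrightarrow> ((\<lambda>t. M (k n) R x t) has_real_derivative
    - (M (k (Suc (Suc n))) \<psi> x t + M (k n) (\<lambda>p. \<gamma> (\<psi> p)) x t)) (at t)"
  using moll_R_deriv_t[OF m x _ t, of n] by simp

lemma dt_F: "((\<lambda>t. M (k 0) (\<lambda>p. \<gamma> (\<psi> p)) x t) has_real_derivative M (k 0) (\<lambda>p. \<gamma>' (\<psi> p) * R p) x t) (at t)"
  using moll_\<gamma>\<psi>_deriv_t[OF m _ t, of 0 x] by simp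

lemma TM_deriv_x: "((\<lambda>x. TM k x t) has_real_derivative TM_x k x t) (at x)"
  unfolding TM_def
  by (rule derivative_eq_intros dx_\<psi> dx_R \<Gamma>_comp_deriv[OF range_U dx_\<psi>] refl | simp (no_asm) only:)+
    (simp_all add: TM_x_def algebra_simps)

lemma TM_deriv_t: "((\<lambda>t. TM k x t) has_real_derivative TM_t k x t) (at t)"
  unfolding TM_def
  by (rule derivative_eq_intros dt_\<psi> dt_R \<Gamma>_comp_deriv[OF range_U dt_\<psi>] refl | simp (no_asm) only:)+
    (simp_all add: TM_t_def algebra_simps)

lemma TM_x_deriv_x: "((\<lambda>x. TM_x k x t) has_real_derivative TM_xx k x t) (at x)"
  unfolding TM_x_def
  by (rule derivative_eq_intros dx_\<psi> dx_R \<gamma>_comp_deriv[OF range_U dx_\<psi>] refl | simp (no_asm) only:)+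
    (simp_all add: TM_xx_def algebra_simps power2_eq_square)

lemma TM_t_deriv_t: "((\<lambda>t. TM_t k x t) has_real_derivative TM_tt k x t) (at t)"
  unfolding TM_t_def
  by (rule derivative_eq_intros dt_\<psi> dt_R dt_F \<gamma>_comp_deriv[OF range_U dt_\<psi>] refl | simp (no_asm) only:)+
    (simp_all add: TM_tt_def algebra_simps power2_eq_square)

text \<open>The formula for \<open>|\<nabla>\<psi>|\<^sup>2 \<Delta>T\<close>. The quantity \<open>E\<close> and the difference \<open>\<gamma>U - f\<close> measure that averaging does not
commute with \<open>\<gamma>\<close>; both vanish in the limit.\<close>

lemma TM_laplacian:
  defines "p \<equiv> M (k (Suc 0)) \<psi> x t" and "q \<equiv> M (k 0) R x t"
    and "f \<equiv> M (k 0) (\<lambda>p. \<gamma> (\<psi> p)) x t" and "\<gamma>U \<equiv> \<gamma> (M (k 0) \<psi> x t)"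
    and "E \<equiv> \<gamma>' (M (k 0) \<psi> x t) * ((M (k (Suc 0)) \<psi> x t)\<^sup>2 + (M (k 0) R x t)\<^sup>2)
      - M (k (Suc 0)) \<psi> x t * M (k 0) (\<lambda>p. \<gamma>' (\<psi> p) * P p) x t
      - M (k 0) R x t * M (k 0) (\<lambda>p. \<gamma>' (\<psi> p) * R p) x t"
  defines "w1 \<equiv> TM_x k x t + (\<omega> - \<gamma>U + f) * p" and "w2 \<equiv> TM_t k x t - g + (\<omega> - \<gamma>U + f) * q"
  shows "(p\<^sup>2 + q\<^sup>2) * (TM_xx k x t + TM_tt k x t) =
    (p\<^sup>2 + q\<^sup>2) * (f\<^sup>2 + E - (\<gamma>U - \<omega>) * f) + 2 * (w1 * (w1 - f * p) + w2 * (w2 - f * q))"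
proof -
  define \<alpha> where "\<alpha> = M (k (Suc (Suc 0))) \<psi> x t"
  define \<beta> where "\<beta> = M (k (Suc 0)) R x t"
  have F1: "M (k (Suc 0)) (\<lambda>p. \<gamma> (\<psi> p)) x t = M (k 0) (\<lambda>p. \<gamma>' (\<psi> p) * P p) x t"
    by (rule moll_\<gamma>\<psi>_by_parts[OF m x _ t]) simp
  have w1: "w1 = p * \<alpha> + q * \<beta> + f * p"
    unfolding w1_def TM_x_def \<alpha>_def \<beta>_def p_def q_def \<gamma>U_def by (simp add: algebra_simps)
  have w2: "w2 = p * \<beta> - q * \<alpha>"
    unfolding w2_def TM_t_def \<alpha>_def \<beta>_def p_def q_def \<gamma>U_def f_def by (simp add: algebra_simps)
  have S: "TM_xx k x t + TM_tt k x t = (2 * \<beta>\<^sup>2 + \<alpha>\<^sup>2 + (\<alpha> + f)\<^sup>2) + (E - (\<gamma>U - \<omega>) * f)"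
    unfolding TM_xx_def TM_tt_def E_def \<alpha>_def \<beta>_def f_def \<gamma>U_def F1
    by (simp add: algebra_simps)
  show ?thesis
    unfolding S distrib_left[of "p\<^sup>2 + q\<^sup>2" "2 * \<beta>\<^sup>2 + \<alpha>\<^sup>2 + (\<alpha> + f)\<^sup>2"] quadratic_form_identity w1[symmetric] w2[symmetric]
    by (simp add: algebra_simps)
qed

end

text \<open>On the bed all horizontal derivatives of the averages vanish, and \<open>TM_t\<close> equals \<open>g - \<omega> \<psi>\<^sub>Y\<close> with \<open>\<psi>\<^sub>Y\<close>
averaged. By continuity it stays positive on nearby horizontal segments. The term \<open>K (l - c)\<close> leaves room
for the perturbation of \<open>T\<close> below.\<close>

lemma TM_t_pos_near_bed:
  assumes m: "mollifier \<epsilon> k" and X: "a1 + \<epsilon> \<le> x1" "x1 \<le> x2" "x2 + \<epsilon> \<le> a2"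
    and bed: "\<And>s. s \<in> {a1..a2} \<Longrightarrow> \<psi> (s, c) = B" and \<eta>: "0 < \<eta>"
  shows "\<exists>l. c < l \<and> l < c + \<eta> \<and> (\<forall>x\<in>{x1..x2}. K * (l - c) < TM_t k x l)"
proof -
  define h where "h p = TM_t k (fst p) (snd p) - K * (snd p - c)" for p
  let ?Q = "{x1..x2} \<times> {c..d}"
  have range: "M (k 0) \<psi> (fst p) (snd p) \<in> {0..B}" if "p \<in> ?Q" for p
    by (rule moll_\<psi>_range_closed[OF m]) (use that X in auto)
  have mc: "continuous_on ?Q (\<lambda>p. M (k n) f (fst p) (snd p))"
    if "n \<le> 3" "continuous_on ({a1..a2} \<times> {c..d}) f" for n f
    by (rule moll_comp_continuous[OF m that]) (auto intro!: continuous_intros)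
  have "continuous_on ?Q (\<lambda>p. \<gamma> (M (k 0) \<psi> (fst p) (snd p)))"
    by (rule continuous_on_compose2[OF \<gamma>_cont mc[OF _ \<psi>_cont]]) (use range in auto)
  then have cont: "continuous_on ?Q h"
    unfolding h_def TM_t_def
    by (intro continuous_intros mc \<psi>_cont R_cont_closed \<gamma>\<psi>_cont) auto
  have c: "c \<in> {c..d}" using c_less_d by simp
  have pos: "0 < h (x, c)" if x: "x \<in> {x1..x2}" for x
  proof -
    have xx: "a1 \<le> x - \<epsilon>" "x + \<epsilon> \<le> a2" using x X by auto
    have "M (k (Suc 0)) \<psi> x c = 0" "M (k (Suc (Suc 0))) \<psi> x c = 0"
      by (rule moll_const_deriv[where f = \<psi> and b = B, OF m xx _ bed]; simp)+
    moreover have "M (k 0) \<psi> x c = B" by (rule moll_const[where f = \<psi>, OF m xx bed])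
    moreover have "M (k 0) (\<lambda>p. \<gamma> (\<psi> p)) x c = \<gamma> B" by (rule moll_const[where f = "\<lambda>p. \<gamma> (\<psi> p)", OF m xx]) (simp add: bed)
    ultimately have h: "h (x, c) = g - \<omega> * M (k 0) R x c"
      by (simp add: h_def TM_t_def algebra_simps)
    have "M (k 0) R x c \<le> 0"
      by (rule moll_average_le[OF m xx continuous_on_slice[OF R_cont_closed c]])
        (rule R_nonpos, use xx c in auto)
    then have "\<omega> * M (k 0) R x c \<le> 0" using \<omega>_nonneg by (simp add: mult_nonneg_nonpos)
    then show ?thesis using h g_pos by simp
  qed
  have "continuous_on {x1..x2} (\<lambda>x. h (x, c))" by (rule continuous_on_slice[OF cont c])
  from continuous_attains_inf[OF compact_Icc _ this] obtain x0
    where x0: "x0 \<in> {x1..x2}" "\<And>x. x \<in> {x1..x2} \<Longrightarrow> h (x0, c) \<le> h (x, c)" using X by auto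
  have "compact ?Q" by (intro compact_Times) auto
  then have "uniformly_continuous_on ?Q h" using cont by (rule compact_uniformly_continuous[rotated])
  then obtain e where e: "0 < e"
    and close: "\<And>p q. p \<in> ?Q \<Longrightarrow> q \<in> ?Q \<Longrightarrow> dist q p < e \<Longrightarrow> dist (h q) (h p) < h (x0, c)"
    using pos[OF x0(1)] unfolding uniformly_continuous_on_def by blast
  define r where "r = min e (min \<eta> (d - c)) / 2"
  have r: "0 < r" "r < e" "r < \<eta>" "r < d - c" using e \<eta> c_less_d by (auto simp: r_def)
  have "K * (c + r - c) < TM_t k x (c + r)" if x: "x \<in> {x1..x2}" for x
  proof -
    have "dist (h (x, c + r)) (h (x, c)) < h (x0, c)"
      by (rule close) (use x r in \<open>auto simp: dist_Pair_Pair dist_real_def\<close>)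
    then have "0 < h (x, c + r)" using x0(2)[OF x] by (auto simp: dist_real_def)
    then show ?thesis by (simp add: h_def)
  qed
  then show ?thesis using r by (intro exI[of _ "c + r"]) auto
qed


text \<open>At a maximum point \<open>(a, b)\<close> of \<open>T\<close>, subtract \<open>\<delta> |z - (a, b)|\<^sup>2\<close> to make the maximum strict. The
averaged functions then have maximum points that converge to \<open>(a, b)\<close>. Where these are interior, the
gradient of the averaged \<open>T\<close> tends to zero and its Laplacian is at most \<open>4 \<delta>\<close>, and in the limit
\<open>TM_laplacian\<close> gives \<open>2 g\<^sup>2 \<le> 4 \<delta> |\<nabla>\<psi>|\<^sup>2\<close> at \<open>(a, b)\<close>, which fails for small \<open>\<delta>\<close>.

The averages are smooth only above the bed, so the maximum is taken over rectangles whose lower edges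
\<open>l n\<close> decrease to \<open>c\<close>. If \<open>(a, b)\<close> is on the bed, the lower edges are chosen such that the averaged \<open>T\<close>
increases upwards from them.\<close>

lemma no_maximum:
  assumes a: "a1 < a" "a < a2" and b: "c \<le> b" "b < d"
    and bed: "b = c \<Longrightarrow> \<forall>s\<in>{a1..a2}. \<psi> (s, c) = B"
    and max: "\<And>p. p \<in> {a1..a2} \<times> {c..d} \<Longrightarrow> T p \<le> T (a, b)"
  shows False
proof -
  let ?Box = "{a1..a2} \<times> {c..d}"
  define P0 R0 \<gamma>0 where "P0 = P (a, b)" and "R0 = R (a, b)" and "\<gamma>0 = \<gamma> (\<psi> (a, b))"
  have ab: "(a, b) \<in> ?Box" using a b by auto
  define \<delta> where "\<delta> = g\<^sup>2 / (4 * (P0\<^sup>2 + R0\<^sup>2 + 1))"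
  have \<delta>: "0 < \<delta>" using g_pos by (auto simp: \<delta>_def intro!: divide_pos_pos add_nonneg_pos)
  have "0 < P0\<^sup>2 + R0\<^sup>2 + 1" by (intro add_nonneg_pos) auto
  then have "4 * (P0\<^sup>2 + R0\<^sup>2 + 1) * \<delta> = g\<^sup>2" by (simp add: \<delta>_def)
  then have small: "(P0\<^sup>2 + R0\<^sup>2) * (4 * \<delta>) < g\<^sup>2" using \<delta> by (simp add: algebra_simps)
  define r where "r = min (a - a1) (a2 - a) / 2"
  have r: "0 < r" "a1 \<le> a - 2 * r" "a + 2 * r \<le> a2" using a by (auto simp: r_def min_def field_simps)
  define d' where "d' = (b + d) / 2"
  have d': "b < d'" "d' < d" using b by (auto simp: d'_def)
  define \<epsilon> where "\<epsilon> n = r / real (Suc n)" for n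
  have \<epsilon>: "0 < \<epsilon> n" "\<epsilon> n \<le> r" for n using r by (auto simp: \<epsilon>_def field_simps)
  have \<epsilon>0: "\<epsilon> \<longlonglongrightarrow> 0" unfolding \<epsilon>_def by (rule LIMSEQ_Suc[OF lim_const_over_n])
  have "\<forall>n. \<exists>k. mollifier (\<epsilon> n) k" using \<epsilon> by (intro allI ex_mollifier)
  then obtain k where m: "\<And>n. mollifier (\<epsilon> n) (k n)" by metis
  have xr: "a1 \<le> x - \<epsilon> n" "x + \<epsilon> n \<le> a2" if "\<bar>x - a\<bar> \<le> r" for x n
    using that \<epsilon>(2)[of n] r by linarith+
  \<comment> \<open>Above the bed any lower edge close to \<open>c\<close> will do: the maximum points approach \<open>b > c\<close>.\<close>
  have "\<exists>l. c < l \<and> l < d' \<and> l < c + \<epsilon> n \<and> (b = c \<longrightarrow> (\<forall>x\<in>{a - r..a + r}. 2 * \<delta> * (l - c) < TM_t (k n) x l))" for n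
  proof (cases "b = c")
    case True
    have "\<exists>l. c < l \<and> l < c + min (\<epsilon> n) (d' - c) \<and> (\<forall>x\<in>{a - r..a + r}. 2 * \<delta> * (l - c) < TM_t (k n) x l)"
      by (rule TM_t_pos_near_bed[OF m])
        (use True bed d' r \<epsilon>[of n] in auto)
    then show ?thesis by auto
  next
    case False
    then show ?thesis using b d' \<epsilon>[of n]
      by (intro exI[of _ "c + min (\<epsilon> n) (d' - c) / 2"]) (auto simp: min_def field_simps)
  qed
  then obtain l where l: "\<And>n. c < l n" "\<And>n. l n < d'" "\<And>n. l n < c + \<epsilon> n"
    and lpos: "\<And>n x. b = c \<Longrightarrow> \<bar>x - a\<bar> \<le> r \<Longrightarrow> 2 * \<delta> * (l n - c) < TM_t (k n) x (l n)"
    by (metis abs_diff_le_iff atLeastAtMost_iff)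
  have l_lim: "l \<longlonglongrightarrow> c"
  proof (rule tendsto_sandwich[where f = "\<lambda>_. c" and h = "\<lambda>n. c + \<epsilon> n"])
    show "(\<lambda>n. c + \<epsilon> n) \<longlonglongrightarrow> c" using tendsto_add[OF tendsto_const \<epsilon>0, of c] by simp
  qed (use l in \<open>auto intro!: always_eventually less_imp_le\<close>)
  define \<Phi> where "\<Phi> n x t = TM (k n) x t - \<delta> * ((x - a)\<^sup>2 + (t - b)\<^sup>2)" for n x t
  have TMc: "continuous_on ({a - r..a + r} \<times> {l n..d'}) (\<lambda>p. \<Phi> n (fst p) (snd p))" for n
  proof -
    let ?Q = "{a - r..a + r} \<times> {l n..d'}"
    have mc: "continuous_on ?Q (\<lambda>p. M (k n i) f (fst p) (snd p))"
      if "i \<le> 3" "continuous_on ?Box f" for i f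
      by (rule moll_comp_continuous[OF m that])
        (use l(1)[of n] d' in \<open>auto intro!: continuous_intros\<close>)
    have "continuous_on ?Q (\<lambda>p. \<Gamma> (M (k n 0) \<psi> (fst p) (snd p)))"
    proof (rule continuous_on_compose2[OF \<Gamma>_cont mc[OF _ \<psi>_cont]])
      show "(\<lambda>p. M (k n 0) \<psi> (fst p) (snd p)) ` ?Q \<subseteq> {0..B}"
      proof (rule image_subsetI)
        fix p assume p: "p \<in> ?Q"
        show "M (k n 0) \<psi> (fst p) (snd p) \<in> {0..B}"
          by (rule moll_\<psi>_range_closed[OF m xr]) (use p l(1)[of n] d' in \<open>auto simp: abs_le_iff\<close>)
      qed
    qed simp
    then show ?thesis unfolding \<Phi>_def TM_def
      by (intro continuous_intros mc \<psi>_cont R_cont_closed) auto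
  qed
  have "\<exists>p\<in>{a - r..a + r} \<times> {l n..d'}. \<forall>q\<in>{a - r..a + r} \<times> {l n..d'}. \<Phi> n (fst q) (snd q) \<le> \<Phi> n (fst p) (snd p)" for n
    by (rule continuous_attains_sup[OF _ _ TMc]) (use r l(2)[of n] in \<open>auto intro!: compact_Times\<close>)
  then obtain q where q: "\<And>n. q n \<in> {a - r..a + r} \<times> {l n..d'}"
    and qmax: "\<And>n p. p \<in> {a - r..a + r} \<times> {l n..d'} \<Longrightarrow> \<Phi> n (fst p) (snd p) \<le> \<Phi> n (fst (q n)) (snd (q n))"
    by metis
  have "compact ({a - r..a + r} \<times> {c..d'})" by (intro compact_Times) auto
  moreover have "\<forall>n. q n \<in> {a - r..a + r} \<times> {c..d'}"
  proof
    fix n show "q n \<in> {a - r..a + r} \<times> {c..d'}" using q[of n] l(1)[of n] by auto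
  qed
  ultimately obtain z \<sigma> where z: "z \<in> {a - r..a + r} \<times> {c..d'}" and \<sigma>: "strict_mono (\<sigma> :: nat \<Rightarrow> nat)"
    and qz: "(q \<circ> \<sigma>) \<longlonglongrightarrow> z"
    unfolding compact_def by blast
  obtain x0 t0 where z0: "z = (x0, t0)" by (cases z)
  define x t K where "x n = fst (q (\<sigma> n))" and "t n = snd (q (\<sigma> n))" and "K n = k (\<sigma> n)" for n
  define e where "e n = \<epsilon> (\<sigma> n)" for n
  have mK: "mollifier (e n) (K n)" for n unfolding e_def K_def by (rule m)
  have e0: "e \<longlonglongrightarrow> 0" unfolding e_def using LIMSEQ_subseq_LIMSEQ[OF \<epsilon>0 \<sigma>] by (simp add: o_def)
  have ll: "(\<lambda>n. l (\<sigma> n)) \<longlonglongrightarrow> c" using LIMSEQ_subseq_LIMSEQ[OF l_lim \<sigma>] by (simp add: o_def)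
  have xl: "x \<longlonglongrightarrow> x0" and tl: "t \<longlonglongrightarrow> t0"
    unfolding x_def t_def using tendsto_fst[OF qz] tendsto_snd[OF qz] z0 by (simp_all add: o_def)
  have xb: "\<bar>x n - a\<bar> \<le> r" and tb: "l (\<sigma> n) \<le> t n" "t n \<le> d'" for n
    using q[of "\<sigma> n"] by (auto simp: x_def t_def abs_le_iff)
  have topen: "s \<in> {c<..<d}" if "l (\<sigma> n) \<le> s" "s \<le> d'" for s n
    using that l(1)[of "\<sigma> n"] d' by auto
  have lim: "(\<lambda>n. M (K n 0) f (X n) (Y n)) \<longlonglongrightarrow> f (X0, Y0)"
    if f: "continuous_on ?Box f" and X: "\<And>n. \<bar>X n - a\<bar> \<le> r" and Y: "\<And>n. Y n \<in> {c..d}"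
      and XY: "X \<longlonglongrightarrow> X0" "Y \<longlonglongrightarrow> Y0" for f X Y X0 Y0
  proof (rule moll_tendsto[OF mK e0 f _ _ Y XY])
    show "a1 \<le> X n - e n" "X n + e n \<le> a2" for n using xr[OF X[of n], of "\<sigma> n"] by (simp_all add: e_def)
    have "\<bar>X0 - a\<bar> \<le> r"
      by (rule LIMSEQ_le_const2[of "\<lambda>n. \<bar>X n - a\<bar>"]) (use X XY in \<open>auto intro!: tendsto_intros\<close>)
    moreover have "Y0 \<in> {c..d}"
      by (rule closed_sequentially[OF closed_atLeastAtMost _ XY(2)]) (use Y in auto)
    ultimately show "(X0, Y0) \<in> ?Box" using r by auto
  qed
  have U1: "M (K n (Suc 0)) \<psi> X Y = M (K n 0) P X Y" if "\<bar>X - a\<bar> \<le> r" "l (\<sigma> n) \<le> Y" "Y \<le> d'" for n X Y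
    by (rule moll_\<psi>_by_parts[OF mK _ _ _ topen[OF that(2,3)]])
      (use xr[OF that(1), of "\<sigma> n"] in \<open>simp_all add: e_def\<close>)
  have Tlim: "(\<lambda>n. \<Phi> (\<sigma> n) (X n) (Y n)) \<longlonglongrightarrow> T (X0, Y0) - \<delta> * ((X0 - a)\<^sup>2 + (Y0 - b)\<^sup>2)"
    if X: "\<And>n. \<bar>X n - a\<bar> \<le> r" and Y: "\<And>n. l (\<sigma> n) \<le> Y n" "\<And>n. Y n \<le> d'"
      and XY: "X \<longlonglongrightarrow> X0" "Y \<longlonglongrightarrow> Y0" for X Y X0 Y0
  proof -
    have Yc: "Y n \<in> {c..d}" for n using topen[OF Y(1)[of n] Y(2)[of n]] by auto
    note L = lim[OF _ X Yc XY]
    have "(X0, Y0) \<in> ?Box"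
    proof -
      have "\<bar>X0 - a\<bar> \<le> r"
        by (rule LIMSEQ_le_const2[of "\<lambda>n. \<bar>X n - a\<bar>"]) (use X XY in \<open>auto intro!: tendsto_intros\<close>)
      moreover have "Y0 \<in> {c..d}"
        by (rule closed_sequentially[OF closed_atLeastAtMost _ XY(2)]) (use Yc in auto)
      ultimately show ?thesis using r by auto
    qed
    then have \<psi>0: "\<psi> (X0, Y0) \<in> {0..B}" by (intro \<psi>_range_closed) auto
    have "M (K n 0) \<psi> (X n) (Y n) \<in> {0..B}" for n
      by (rule moll_\<psi>_range_closed[OF mK]) (use xr[OF X[of n], of "\<sigma> n"] Yc in \<open>simp_all add: e_def\<close>)
    then have "(\<lambda>n. \<Gamma> (M (K n 0) \<psi> (X n) (Y n))) \<longlonglongrightarrow> \<Gamma> (\<psi> (X0, Y0))"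
      by (intro continuous_on_tendsto_compose[OF \<Gamma>_cont L[OF \<psi>_cont] \<psi>0] always_eventually allI)
    then have "(\<lambda>n. 1 / 2 * ((M (K n 0) P (X n) (Y n))\<^sup>2 + (M (K n 0) R (X n) (Y n))\<^sup>2) + g * Y n
        + \<Gamma> (M (K n 0) \<psi> (X n) (Y n)) - \<omega> * M (K n 0) \<psi> (X n) (Y n)
        - \<delta> * ((X n - a)\<^sup>2 + (Y n - b)\<^sup>2)) \<longlonglongrightarrow> T (X0, Y0) - \<delta> * ((X0 - a)\<^sup>2 + (Y0 - b)\<^sup>2)"
      unfolding T_def snd_conv
      by (intro tendsto_intros L \<psi>_cont P_cont_closed R_cont_closed XY)
    then show ?thesis
      unfolding \<Phi>_def TM_def K_def[symmetric] U1[OF X Y(1) Y(2)] .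
  qed
  \<comment> \<open>The point \<open>(a, b)\<close> may lie below the rectangle; its nearest point in the rectangle replaces it.\<close>
  have cmp: "\<Phi> (\<sigma> n) a (max b (l (\<sigma> n))) \<le> \<Phi> (\<sigma> n) (x n) (t n)" for n
    using qmax[of "(a, max b (l (\<sigma> n)))" "\<sigma> n"] r d' l(2)[of "\<sigma> n"] by (auto simp: x_def t_def)
  have "(\<lambda>n. max b (l (\<sigma> n))) \<longlonglongrightarrow> max b c" by (intro tendsto_intros ll)
  then have bl: "(\<lambda>n. max b (l (\<sigma> n))) \<longlonglongrightarrow> b" using b by (simp add: max_def)
  have "T (a, b) - \<delta> * ((a - a)\<^sup>2 + (b - b)\<^sup>2) \<le> T (x0, t0) - \<delta> * ((x0 - a)\<^sup>2 + (t0 - b)\<^sup>2)"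
  proof (rule LIMSEQ_le)
    show "(\<lambda>n. \<Phi> (\<sigma> n) a (max b (l (\<sigma> n)))) \<longlonglongrightarrow> T (a, b) - \<delta> * ((a - a)\<^sup>2 + (b - b)\<^sup>2)"
      by (rule Tlim[OF _ _ _ tendsto_const bl]) (use r d' l(2) less_imp_le in auto)
    show "(\<lambda>n. \<Phi> (\<sigma> n) (x n) (t n)) \<longlonglongrightarrow> T (x0, t0) - \<delta> * ((x0 - a)\<^sup>2 + (t0 - b)\<^sup>2)"
      by (rule Tlim[OF xb tb xl tl])
  qed (use cmp in blast)
  moreover have "T (x0, t0) \<le> T (a, b)" by (rule max) (use z z0 r d' in auto)
  ultimately have "\<delta> * ((x0 - a)\<^sup>2 + (t0 - b)\<^sup>2) \<le> 0" by simp
  then have "(x0 - a)\<^sup>2 + (t0 - b)\<^sup>2 \<le> 0" using \<delta> by (simp add: mult_le_0_iff)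
  then have z_eq: "x0 = a" "t0 = b" by (simp_all add: sum_power2_le_zero_iff)
  \<comment> \<open>As the maximum points tend to \<open>(a, b)\<close>, they leave all edges except possibly a lower edge near the bed.\<close>
  have ev: "\<forall>\<^sub>F n in sequentially. \<bar>x n - a\<bar> < r \<and> t n < d' \<and> (c < b \<longrightarrow> l (\<sigma> n) < t n)"
  proof (intro eventually_conj)
    have "\<forall>\<^sub>F n in sequentially. dist (x n) a < r" using xl r unfolding z_eq by (intro tendstoD) auto
    then show "\<forall>\<^sub>F n in sequentially. \<bar>x n - a\<bar> < r" by (simp add: dist_real_def)
    show "\<forall>\<^sub>F n in sequentially. t n < d'" by (rule order_tendstoD(2)[OF tl]) (use z_eq d' in simp)
    show "\<forall>\<^sub>F n in sequentially. c < b \<longrightarrow> l (\<sigma> n) < t n"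
    proof (cases "c < b")
      case True
      then have "\<forall>\<^sub>F n in sequentially. l (\<sigma> n) < (b + c) / 2" "\<forall>\<^sub>F n in sequentially. (b + c) / 2 < t n"
        by (intro order_tendstoD(2)[OF ll] order_tendstoD(1)[OF tl]; use z_eq in simp)+
      then show ?thesis by eventually_elim simp
    qed simp
  qed
  define Z where "Z n = (let p = M (K n 0) P (x n) (t n); q = M (K n 0) R (x n) (t n);
      f = M (K n 0) (\<lambda>p. \<gamma> (\<psi> p)) (x n) (t n); u = M (K n 0) \<psi> (x n) (t n);
      E = \<gamma>' u * (p\<^sup>2 + q\<^sup>2) - p * M (K n 0) (\<lambda>p. \<gamma>' (\<psi> p) * P p) (x n) (t n)
        - q * M (K n 0) (\<lambda>p. \<gamma>' (\<psi> p) * R p) (x n) (t n);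
      w1 = 2 * \<delta> * (x n - a) + (\<omega> - \<gamma> u + f) * p; w2 = 2 * \<delta> * (t n - b) - g + (\<omega> - \<gamma> u + f) * q in
    (p\<^sup>2 + q\<^sup>2) * (f\<^sup>2 + E - (\<gamma> u - \<omega>) * f) + 2 * (w1 * (w1 - f * p) + w2 * (w2 - f * q)))" for n
  have evZ: "\<forall>\<^sub>F n in sequentially. Z n \<le> ((M (K n 0) P (x n) (t n))\<^sup>2 + (M (K n 0) R (x n) (t n))\<^sup>2) * (4 * \<delta>)"
    using ev
  proof eventually_elim
    case (elim n)
    have xx: "a1 \<le> y - e n" "y + e n \<le> a2" if "\<bar>y - a\<bar> \<le> r" for y
      using xr[OF that, of "\<sigma> n"] by (simp_all add: e_def)
    have \<Phi>n: "\<Phi> (\<sigma> n) = (\<lambda>x t. TM (K n) x t - \<delta> * ((x - a)\<^sup>2 + (t - b)\<^sup>2))"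
      by (simp add: \<Phi>_def K_def fun_eq_iff)
    have maxn: "\<Phi> (\<sigma> n) X Y \<le> \<Phi> (\<sigma> n) (x n) (t n)" if "\<bar>X - a\<bar> \<le> r" "l (\<sigma> n) \<le> Y" "Y \<le> d'" for X Y
      using qmax[of "(X, Y)" "\<sigma> n"] that by (auto simp: x_def t_def abs_le_iff)
    have to: "t n \<in> {c<..<d}" by (rule topen[OF tb])
    have dt: "((\<lambda>Y. \<Phi> (\<sigma> n) (x n) Y) has_real_derivative TM_t (K n) (x n) Y - 2 * \<delta> * (Y - b)) (at Y)"
      if "Y \<in> {c<..<d}" for Y
      unfolding \<Phi>n
      by (rule DERIV_diff[OF TM_deriv_t[OF mK xx[OF xb] that]]) (auto intro!: derivative_eq_intros)
    have dx: "((\<lambda>X. \<Phi> (\<sigma> n) X (t n)) has_real_derivative TM_x (K n) X (t n) - 2 * \<delta> * (X - a)) (at X)"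
      if "\<bar>X - a\<bar> \<le> r" for X
      unfolding \<Phi>n
      by (rule DERIV_diff[OF TM_deriv_x[OF mK xx[OF that] to]]) (auto intro!: derivative_eq_intros)
    have lt: "l (\<sigma> n) < t n"
    proof (rule ccontr)
      assume "\<not> l (\<sigma> n) < t n"
      then have eq: "t n = l (\<sigma> n)" using tb(1)[of n] by simp
      then have bc: "b = c" using elim b by auto
      have "0 < TM_t (K n) (x n) (t n) - 2 * \<delta> * (t n - b)"
        using lpos[OF bc xb[of n], of "\<sigma> n"] by (simp add: eq bc K_def)
      from DERIV_pos_inc_right[OF dt[OF to] this] obtain h where h: "0 < h"
        and inc: "\<And>s. 0 < s \<Longrightarrow> s < h \<Longrightarrow> \<Phi> (\<sigma> n) (x n) (t n) < \<Phi> (\<sigma> n) (x n) (t n + s)" by blast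
      define s where "s = min h (d' - t n) / 2"
      have s: "0 < s" "s < h" "t n + s \<le> d'" using h elim by (auto simp: s_def min_def field_simps)
      show False using inc[OF s(1,2)] maxn[OF xb, of "t n + s" n] s tb(1)[of n] by simp
    qed
    have X: "TM_x (K n) (x n) (t n) - 2 * \<delta> * (x n - a) = 0" "TM_xx (K n) (x n) (t n) - 2 * \<delta> \<le> 0"
    proof -
      have D: "((\<lambda>X. TM_x (K n) X (t n) - 2 * \<delta> * (X - a)) has_real_derivative TM_xx (K n) (x n) (t n) - 2 * \<delta>) (at (x n))"
        by (rule DERIV_diff[OF TM_x_deriv_x[OF mK xx[OF xb] to]]) (auto intro!: derivative_eq_intros)
      note I = interior_max_derivatives[where S = "{a - r<..<a + r}" and x = "x n"
          and f = "\<lambda>X. \<Phi> (\<sigma> n) X (t n)", OF _ _ dx D]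
      show "TM_x (K n) (x n) (t n) - 2 * \<delta> * (x n - a) = 0"
        by (rule I(1)) (use elim maxn tb in \<open>auto simp: abs_less_iff abs_le_iff\<close>)
      show "TM_xx (K n) (x n) (t n) - 2 * \<delta> \<le> 0"
        by (rule I(2)) (use elim maxn tb in \<open>auto simp: abs_less_iff abs_le_iff\<close>)
    qed
    have Y: "TM_t (K n) (x n) (t n) - 2 * \<delta> * (t n - b) = 0" "TM_tt (K n) (x n) (t n) - 2 * \<delta> \<le> 0"
    proof -
      have D: "((\<lambda>Y. TM_t (K n) (x n) Y - 2 * \<delta> * (Y - b)) has_real_derivative TM_tt (K n) (x n) (t n) - 2 * \<delta>) (at (t n))"
        by (rule DERIV_diff[OF TM_t_deriv_t[OF mK xx[OF xb] to]]) (auto intro!: derivative_eq_intros)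
      have S: "Y \<in> {c<..<d}" if "Y \<in> {l (\<sigma> n)<..<d'}" for Y
        by (rule topen[of n]) (use that in auto)
      note I = interior_max_derivatives[where S = "{l (\<sigma> n)<..<d'}" and x = "t n"
          and f = "\<lambda>Y. \<Phi> (\<sigma> n) (x n) Y", OF _ _ dt[OF S] D]
      show "TM_t (K n) (x n) (t n) - 2 * \<delta> * (t n - b) = 0"
        by (rule I(1)) (use elim lt maxn[OF xb] in auto)
      show "TM_tt (K n) (x n) (t n) - 2 * \<delta> \<le> 0"
        by (rule I(2)) (use elim lt maxn[OF xb] in auto)
    qed
    have ex: "TM_x (K n) (x n) (t n) = 2 * \<delta> * (x n - a)" and et: "TM_t (K n) (x n) (t n) = 2 * \<delta> * (t n - b)"
      using X(1) Y(1) by simp_all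
    note U1n = U1[OF xb[of n] tb]
    have "Z n = ((M (K n 0) P (x n) (t n))\<^sup>2 + (M (K n 0) R (x n) (t n))\<^sup>2) * (TM_xx (K n) (x n) (t n) + TM_tt (K n) (x n) (t n))"
      using TM_laplacian[OF mK xx[OF xb[of n]] to] unfolding Z_def Let_def ex et U1n by simp
    also have "\<dots> \<le> ((M (K n 0) P (x n) (t n))\<^sup>2 + (M (K n 0) R (x n) (t n))\<^sup>2) * (4 * \<delta>)"
      by (rule mult_left_mono) (use X(2) Y(2) in auto)
    finally show ?case .
  qed
  have tc: "t n \<in> {c..d}" for n using topen[OF tb(1)[of n] tb(2)[of n]] by auto
  note L = lim[OF _ xb tc xl tl, unfolded z_eq]
  have u: "M (K n 0) \<psi> (x n) (t n) \<in> {0..B}" for n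
    by (rule moll_\<psi>_range_closed[OF mK _ _ tc]) (use xr[OF xb[of n], of "\<sigma> n"] in \<open>simp_all add: e_def\<close>)
  have \<psi>0: "\<psi> (a, b) \<in> {0..B}" by (rule \<psi>_range_closed) (use ab in auto)
  have L\<gamma>: "(\<lambda>n. \<gamma> (M (K n 0) \<psi> (x n) (t n))) \<longlonglongrightarrow> \<gamma> (\<psi> (a, b))"
    by (intro continuous_on_tendsto_compose[OF \<gamma>_cont L[OF \<psi>_cont] \<psi>0] always_eventually allI u)
  have L\<gamma>': "(\<lambda>n. \<gamma>' (M (K n 0) \<psi> (x n) (t n))) \<longlonglongrightarrow> \<gamma>' (\<psi> (a, b))"
    by (intro continuous_on_tendsto_compose[OF \<gamma>'_cont L[OF \<psi>_cont] \<psi>0] always_eventually allI u)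
  define \<gamma>1 where "\<gamma>1 = \<gamma>' (\<psi> (a, b))"
  have ZL: "Z \<longlonglongrightarrow> (P0\<^sup>2 + R0\<^sup>2) * (\<gamma>0\<^sup>2 + (\<gamma>1 * (P0\<^sup>2 + R0\<^sup>2) - P0 * (\<gamma>1 * P0) - R0 * (\<gamma>1 * R0)) - (\<gamma>0 - \<omega>) * \<gamma>0)
     + 2 * ((2 * \<delta> * (a - a) + (\<omega> - \<gamma>0 + \<gamma>0) * P0) * ((2 * \<delta> * (a - a) + (\<omega> - \<gamma>0 + \<gamma>0) * P0) - \<gamma>0 * P0)
       + (2 * \<delta> * (b - b) - g + (\<omega> - \<gamma>0 + \<gamma>0) * R0) * ((2 * \<delta> * (b - b) - g + (\<omega> - \<gamma>0 + \<gamma>0) * R0) - \<gamma>0 * R0))"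
    unfolding Z_def Let_def P0_def R0_def \<gamma>0_def \<gamma>1_def
    by (intro tendsto_intros L L\<gamma> L\<gamma>' \<gamma>\<psi>_cont continuous_on_mult[OF \<gamma>'\<psi>_cont] P_cont_closed R_cont_closed
        xl[unfolded z_eq] tl[unfolded z_eq])
  have RL: "(\<lambda>n. ((M (K n 0) P (x n) (t n))\<^sup>2 + (M (K n 0) R (x n) (t n))\<^sup>2) * (4 * \<delta>)) \<longlonglongrightarrow> (P0\<^sup>2 + R0\<^sup>2) * (4 * \<delta>)"
    unfolding P0_def R0_def by (intro tendsto_intros L P_cont_closed R_cont_closed)
  have "(P0\<^sup>2 + R0\<^sup>2) * (\<gamma>0\<^sup>2 + (\<gamma>1 * (P0\<^sup>2 + R0\<^sup>2) - P0 * (\<gamma>1 * P0) - R0 * (\<gamma>1 * R0)) - (\<gamma>0 - \<omega>) * \<gamma>0)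
     + 2 * ((2 * \<delta> * (a - a) + (\<omega> - \<gamma>0 + \<gamma>0) * P0) * ((2 * \<delta> * (a - a) + (\<omega> - \<gamma>0 + \<gamma>0) * P0) - \<gamma>0 * P0)
       + (2 * \<delta> * (b - b) - g + (\<omega> - \<gamma>0 + \<gamma>0) * R0) * ((2 * \<delta> * (b - b) - g + (\<omega> - \<gamma>0 + \<gamma>0) * R0) - \<gamma>0 * R0))
     \<le> (P0\<^sup>2 + R0\<^sup>2) * (4 * \<delta>)"
    by (rule tendsto_le[OF sequentially_bot RL ZL evZ])
  then have "2 * g\<^sup>2 + (P0\<^sup>2 + R0\<^sup>2) * (\<omega> * (2 * \<omega> - \<gamma>0)) + 2 * g * (- R0) * (2 * \<omega> - \<gamma>0) \<le> (P0\<^sup>2 + R0\<^sup>2) * (4 * \<delta>)"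
    by (simp add: power2_eq_square algebra_simps)
  moreover have "0 \<le> 2 * \<omega> - \<gamma>0" using \<gamma>_le[OF \<psi>0] by (simp add: \<gamma>0_def)
  moreover have "0 \<le> - R0" using R_nonpos[OF ab] by (simp add: R0_def)
  ultimately have "2 * g\<^sup>2 \<le> (P0\<^sup>2 + R0\<^sup>2) * (4 * \<delta>)"
    using \<omega>_nonneg g_pos
    by (smt (verit) mult_nonneg_nonneg sum_power2_ge_zero)
  then show False using small g_pos zero_le_power2[of g] by linarith
qed

end

section \<open>From the wave problem to rectangles\<close>

lemma continuous_on_Lim_closure:
  fixes f :: "'a::metric_space \<Rightarrow> 'b::metric_space"
  assumes lim: "\<And>p. p \<in> closure S \<Longrightarrow> \<exists>l. (f \<longlongrightarrow> l) (at p within S)"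
    and nt: "\<And>p. p \<in> closure S \<Longrightarrow> at p within S \<noteq> bot"
  shows "continuous_on (closure S) (\<lambda>p. Lim (at p within S) f)"
proof -
  define F where "F p = Lim (at p within S) f" for p
  have F: "(f \<longlongrightarrow> F p) (at p within S)" if "p \<in> closure S" for p
    using lim[OF that] tendsto_Lim[OF nt[OF that]] by (auto simp: F_def)
  have "\<exists>d>0. \<forall>q\<in>closure S. dist q p < d \<longrightarrow> dist (F q) (F p) < e" if p: "p \<in> closure S" and e: "0 < e" for p e
  proof -
    have "\<forall>\<^sub>F q in at p within S. dist (f q) (F p) < e / 2" using F[OF p] e by (intro tendstoD) auto
    then obtain d where d: "0 < d"
      and close: "\<And>q. q \<in> S \<Longrightarrow> q \<noteq> p \<Longrightarrow> dist q p < d \<Longrightarrow> dist (f q) (F p) < e / 2"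
      unfolding eventually_at by blast
    have "dist (F q) (F p) < e" if q: "q \<in> closure S" "dist q p < d" for q
    proof (cases "q = p")
      case False
      have "\<forall>\<^sub>F z in at q within S. dist (F p) (f z) \<le> e / 2"
        unfolding eventually_at
      proof (intro exI conjI ballI impI)
        show "0 < min (dist q p) (d - dist q p)" using False q by simp
        fix z assume z: "z \<in> S" "z \<noteq> q \<and> dist z q < min (dist q p) (d - dist q p)"
        have "z \<noteq> p" using z by (auto simp: dist_commute)
        moreover have "dist z p < d" using z dist_triangle[of z p q] by auto
        ultimately show "dist (F p) (f z) \<le> e / 2" using close[of z] z by (simp add: dist_commute)
      qed
      from Lim_dist_ubound[OF nt[OF q(1)] F[OF q(1)] this] show ?thesis using e by (simp add: dist_commute)
    qed (use e in simp)
    then show ?thesis using d by blast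
  qed
  then show ?thesis unfolding continuous_on_iff F_def by blast
qed

lemma set_lebesgue_integral_eq_integral_cbox:
  fixes f :: "real \<times> real \<Rightarrow> real"
  assumes "cbox a b \<subseteq> \<Omega>" "continuous_on (cbox a b) f" "\<And>p. p \<in> \<Omega> - cbox a b \<Longrightarrow> f p = 0"
  shows "(LINT p:\<Omega>|lebesgue. f p) = integral (cbox a b) f"
proof -
  have "(LINT p:\<Omega>|lebesgue. f p) = (LINT p:cbox a b|lebesgue. f p)"
    unfolding set_lebesgue_integral_def
    by (rule Bochner_Integration.integral_cong) (use assms in \<open>auto simp: indicator_def\<close>)
  also have "\<dots> = integral (cbox a b) f"
    by (rule set_lebesgue_integral_eq_integral(2)[OF absolutely_integrable_continuous[OF assms(2)]])
  finally show ?thesis .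
qed

lemma grad_eqI:
  assumes "(f has_derivative D) (at p)"
  shows "grad f p = (D (1, 0), D (0, 1))"
  using frechet_derivative_at[OF assms] by (simp add: grad_def)

lemma DERIV_of_grad:
  assumes f: "f differentiable (at (x, y))"
  shows "((\<lambda>x. f (x, y)) has_real_derivative fst (grad f (x, y))) (at x)"
    and "((\<lambda>y. f (x, y)) has_real_derivative snd (grad f (x, y))) (at y)"
proof -
  define D where "D = frechet_derivative f (at (x, y))"
  have D: "(f has_derivative D) (at (x, y))" using f by (simp add: D_def frechet_derivative_works)
  interpret D: bounded_linear D by (rule has_derivative_bounded_linear[OF D])
  have "((\<lambda>x. f (x, y)) has_derivative (\<lambda>h. D (h, 0))) (at x)"
    by (rule has_derivative_compose[where f = "\<lambda>x. (x, y)" and g = f, OF _ D]) (auto intro!: derivative_eq_intros)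
  moreover have "D (h, 0) = fst (grad f (x, y)) * h" for h
    using D.scaleR[of h "(1, 0)"] by (simp add: grad_def D_def mult.commute)
  ultimately show "((\<lambda>x. f (x, y)) has_real_derivative fst (grad f (x, y))) (at x)"
    by (simp add: has_field_derivative_def)
  have "((\<lambda>y. f (x, y)) has_derivative (\<lambda>h. D (0, h))) (at y)"
    by (rule has_derivative_compose[where f = "\<lambda>y. (x, y)" and g = f, OF _ D]) (auto intro!: derivative_eq_intros)
  moreover have "D (0, h) = snd (grad f (x, y)) * h" for h
    using D.scaleR[of h "(0, 1)"] by (simp add: grad_def D_def mult.commute)
  ultimately show "((\<lambda>y. f (x, y)) has_real_derivative snd (grad f (x, y))) (at y)"
    by (simp add: has_field_derivative_def)
qed

lemma product_test_function:
  fixes A A' D D' :: "real \<Rightarrow> real"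
  assumes A: "\<And>s. (A has_real_derivative A' s) (at s)" "continuous_on UNIV A'" "\<And>s. s \<notin> {a1..a2} \<Longrightarrow> A s = 0"
    and D: "\<And>t. (D has_real_derivative D' t) (at t)" "continuous_on UNIV D'" "\<And>t. t \<notin> {c..d} \<Longrightarrow> D t = 0"
    and sub: "cbox (a1, c) (a2, d) \<subseteq> \<Omega>"
  shows "C1_test_fun \<Omega> (\<lambda>(s, t). A s * D t)"
    and "grad (\<lambda>(s, t). A s * D t) p = (A' (fst p) * D (snd p), A (fst p) * D' (snd p))"
proof -
  have A1: "((\<lambda>p. A (fst p)) has_derivative (\<lambda>h. A' (fst p) * fst h)) (at p)" for p :: "real \<times> real"
    by (rule has_derivative_compose[of fst fst _ _ A])
      (use A(1) in \<open>auto simp: has_field_derivative_def intro!: derivative_eq_intros\<close>)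
  have D1: "((\<lambda>p. D (snd p)) has_derivative (\<lambda>h. D' (snd p) * snd h)) (at p)" for p :: "real \<times> real"
    by (rule has_derivative_compose[of snd snd _ _ D])
      (use D(1) in \<open>auto simp: has_field_derivative_def intro!: derivative_eq_intros\<close>)
  have der: "((\<lambda>(s, t). A s * D t) has_derivative
      (\<lambda>h. A (fst p) * (D' (snd p) * snd h) + A' (fst p) * fst h * D (snd p))) (at p)" for p
    using has_derivative_mult[OF A1 D1, of p] by (simp add: case_prod_unfold)
  show g: "grad (\<lambda>(s, t). A s * D t) p = (A' (fst p) * D (snd p), A (fst p) * D' (snd p))" for p
    by (simp add: grad_eqI[OF der])
  have Ac: "continuous_on UNIV A" and Dc: "continuous_on UNIV D"
    using A(1) D(1) by (meson DERIV_isCont continuous_at_imp_continuous_on)+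
  have "closure {p. (\<lambda>(s, t). A s * D t) p \<noteq> 0} \<subseteq> cbox (a1, c) (a2, d)"
    by (rule closure_minimal) (use A(3) D(3) in \<open>fastforce simp: cbox_Pair_eq\<close>, rule closed_cbox)
  moreover from this have "compact (closure {p. (\<lambda>(s, t). A s * D t) p \<noteq> 0})"
    using bounded_subset[OF bounded_cbox] closed_closure compact_eq_bounded_closed by blast
  moreover have "continuous_on UNIV (grad (\<lambda>(s, t). A s * D t))"
  proof -
    have "continuous_on UNIV (\<lambda>p. (A' (fst p) * D (snd p), A (fst p) * D' (snd p)))"
      by (intro continuous_intros continuous_on_kernel[OF Ac] continuous_on_kernel[OF Dc]
          continuous_on_kernel[OF A(2)] continuous_on_kernel[OF D(2)])
    then show ?thesis by (simp add: g[abs_def])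
  qed
  ultimately show "C1_test_fun \<Omega> (\<lambda>(s, t). A s * D t)"
    unfolding C1_test_fun_def using der sub by (auto simp: differentiable_def)
qed

lemma DERIV_abs_le_lipschitz:
  fixes f :: "real \<Rightarrow> real"
  assumes f: "(f has_real_derivative D) (at x)" and S: "open S" "x \<in> S"
    and lip: "\<And>y. y \<in> S \<Longrightarrow> \<bar>f y - f x\<bar> \<le> K * \<bar>y - x\<bar>"
  shows "\<bar>D\<bar> \<le> K"
proof -
  have "((\<lambda>y. \<bar>(f y - f x) / (y - x)\<bar>) \<longlongrightarrow> \<bar>D\<bar>) (at x)"
    using f unfolding has_field_derivative_iff by (rule tendsto_rabs)
  moreover have "\<forall>\<^sub>F y in at x. \<bar>(f y - f x) / (y - x)\<bar> \<le> K"
    unfolding eventually_at_topological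
  proof (intro exI[of _ S] conjI S ballI impI)
    fix y assume "y \<in> S" "y \<noteq> x"
    then show "\<bar>(f y - f x) / (y - x)\<bar> \<le> K" using lip[of y] by (simp add: abs_divide divide_le_eq)
  qed
  ultimately show ?thesis by (rule tendsto_upperbound) simp
qed

lemma C1_holder_on_imp_C1:
  assumes "C1_holder_on \<alpha> S f" "0 < \<alpha>"
  obtains f' where "\<And>x. x \<in> S \<Longrightarrow> (f has_real_derivative f' x) (at x within S)" "continuous_on S f'"
proof -
  obtain f' C where f': "\<And>x. x \<in> S \<Longrightarrow> (f has_real_derivative f' x) (at x within S)"
    and C: "\<And>x y. x \<in> S \<Longrightarrow> y \<in> S \<Longrightarrow> \<bar>f' x - f' y\<bar> \<le> C * \<bar>x - y\<bar> powr \<alpha>"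
    using assms(1) unfolding C1_holder_on_def by blast
  have "continuous_on S f'"
    unfolding continuous_on_def
  proof
    fix x assume x: "x \<in> S"
    have "((\<lambda>y. \<bar>y - x\<bar>) \<longlongrightarrow> \<bar>x - x\<bar>) (at x within S)" by (intro tendsto_intros)
    then have "((\<lambda>y. \<bar>y - x\<bar> powr \<alpha>) \<longlongrightarrow> 0) (at x within S)"
      by (intro tendsto_zero_powrI[where b = \<alpha>]) (use assms(2) in auto)
    from tendsto_mult_left[OF this, of C] have "((\<lambda>y. C * \<bar>y - x\<bar> powr \<alpha>) \<longlongrightarrow> 0) (at x within S)"
      by simp
    moreover have "\<forall>\<^sub>F y in at x within S. norm (f' y - f' x) \<le> C * \<bar>y - x\<bar> powr \<alpha>"
      unfolding eventually_at by (rule exI[of _ 1]) (use C[OF _ x] in simp)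
    ultimately have "((\<lambda>y. f' y - f' x) \<longlongrightarrow> 0) (at x within S)"
      by (rule Lim_null_comparison[rotated])
    then show "(f' \<longlongrightarrow> f' x) (at x within S)" by (rule LIM_zero_cancel)
  qed
  with f' show ?thesis by (rule that)
qed

locale water_wave =
  fixes g B L F Q :: real and \<gamma> \<gamma>' :: "real \<Rightarrow> real" and S \<Omega> :: "(real \<times> real) set"
    and \<psi> :: "real \<times> real \<Rightarrow> real"
  assumes g: "0 < g" and B: "0 < B" and L: "0 < L"
    and \<gamma>': "\<And>r. r \<in> {0..B} \<Longrightarrow> (\<gamma> has_real_derivative \<gamma>' r) (at r within {0..B})"
    and \<gamma>'_cont: "continuous_on {0..B} \<gamma>'"
    and sol: "classical_solution g B L \<gamma> S F \<Omega> \<psi> Q"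
    and decreasing: "\<And>p. p \<in> \<Omega> \<Longrightarrow> snd (grad \<psi> p) < 0"
begin

lemma open_\<Omega>: "open \<Omega>" and connected_\<Omega>: "connected \<Omega>" and above_bed: "p \<in> \<Omega> \<Longrightarrow> F < snd p"
  and bdd_\<Omega>: "bdd_above (snd ` \<Omega>)" and frontier_\<Omega>: "frontier \<Omega> = S \<union> bed F"
  using sol by (auto simp: classical_solution_def fluid_domain_def)

lemma closure_\<Omega>: "closure \<Omega> = \<Omega> \<union> S \<union> bed F"
  using frontier_\<Omega> closure_Un_frontier[of \<Omega>] by auto

lemma \<psi>_bed: "p \<in> bed F \<Longrightarrow> \<psi> p = B" and \<psi>_surface: "p \<in> S \<Longrightarrow> \<psi> p = 0"
  and \<psi>_bounds: "p \<in> \<Omega> \<Longrightarrow> 0 \<le> \<psi> p \<and> \<psi> p \<le> B"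
  and \<psi>_periodic: "(X, Y) \<in> closure \<Omega> \<Longrightarrow> \<psi> (X + 2 * L, Y) = \<psi> (X, Y)"
  and \<psi>_weak: "C1_test_fun \<Omega> \<zeta> \<Longrightarrow>
        (LINT p:\<Omega>|lebesgue. grad \<psi> p \<bullet> grad \<zeta> p) = (LINT p:\<Omega>|lebesgue. \<gamma> (\<psi> p) * \<zeta> p)"
  using sol by (auto simp: classical_solution_def stream_function_def)

lemma \<psi>_lipschitz: obtains K where "K-lipschitz_on (closure \<Omega>) \<psi>"
  using sol by (auto simp: classical_solution_def stream_function_def)

lemma \<psi>_cont: "continuous_on (closure \<Omega>) \<psi>"
  using \<psi>_lipschitz lipschitz_on_continuous_on by metis

lemma \<psi>_differentiable: "p \<in> \<Omega> \<Longrightarrow> \<psi> differentiable (at p)"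
  using sol by (auto simp: classical_solution_def C1_upto_def)

lemma grad_extension: obtains G where "continuous_on (\<Omega> \<union> S) G" "\<And>p. p \<in> \<Omega> \<Longrightarrow> G p = grad \<psi> p"
  using sol by (auto simp: classical_solution_def C1_upto_def)

lemma grad_cont: "continuous_on \<Omega> (grad \<psi>)"
proof -
  obtain G where G: "continuous_on (\<Omega> \<union> S) G" "\<And>p. p \<in> \<Omega> \<Longrightarrow> G p = grad \<psi> p"
    by (rule grad_extension, rule that)
  have "continuous_on \<Omega> G" by (rule continuous_on_subset[OF G(1)]) auto
  then show ?thesis using G(2) by (simp cong: continuous_on_cong)
qed

lemma \<psi>_closed_range: "p \<in> closure \<Omega> \<Longrightarrow> \<psi> p \<in> {0..B}"
  using \<psi>_bounds[of p] \<psi>_bed[of p] \<psi>_surface[of p] B by (auto simp: closure_\<Omega>)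

text \<open>As \<open>\<psi>\<close> decreases strictly in the vertical direction, the value \<open>0\<close> would force negative values just above the
point, and the value \<open>B\<close> would force larger values just below it.\<close>

lemma \<psi>_open_range:
  assumes p: "(X, Y) \<in> \<Omega>"
  shows "0 < \<psi> (X, Y)" "\<psi> (X, Y) < B"
proof -
  have D: "((\<lambda>y. \<psi> (X, y)) has_real_derivative snd (grad \<psi> (X, Y))) (at Y)"
    by (rule DERIV_of_grad(2)[OF \<psi>_differentiable[OF p]])
  obtain e where e: "0 < e" "ball (X, Y) e \<subseteq> \<Omega>" using p open_\<Omega> by (meson openE)
  have inside: "(X, y) \<in> \<Omega>" if "\<bar>y - Y\<bar> < e" for y
    using that e(2) by (auto simp: subset_iff dist_Pair_Pair dist_real_def abs_minus_commute)
  obtain d1 where d1: "0 < d1" "\<And>h. 0 < h \<Longrightarrow> h < d1 \<Longrightarrow> \<psi> (X, Y + h) < \<psi> (X, Y)"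
    using DERIV_neg_dec_right[OF D decreasing[OF p]] by blast
  obtain d2 where d2: "0 < d2" "\<And>h. 0 < h \<Longrightarrow> h < d2 \<Longrightarrow> \<psi> (X, Y) < \<psi> (X, Y - h)"
    using DERIV_neg_dec_left[OF D decreasing[OF p]] by blast
  define h where "h = min e (min d1 d2) / 2"
  have h: "0 < h" "h < e" "h < d1" "h < d2" using e d1 d2 by (auto simp: h_def)
  show "0 < \<psi> (X, Y)" using d1(2)[of h] \<psi>_bounds[OF inside[of "Y + h"]] h by auto
  show "\<psi> (X, Y) < B" using d2(2)[of h] \<psi>_bounds[OF inside[of "Y - h"]] h by auto
qed

lemma grad_bound:
  assumes K: "K-lipschitz_on (closure \<Omega>) \<psi>" and p: "(X, Y) \<in> \<Omega>"
  shows "\<bar>fst (grad \<psi> (X, Y))\<bar> \<le> K"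
proof -
  obtain e where e: "0 < e" "ball (X, Y) e \<subseteq> \<Omega>" using p open_\<Omega> by (meson openE)
  show ?thesis
  proof (rule DERIV_abs_le_lipschitz[OF DERIV_of_grad(1)[OF \<psi>_differentiable[OF p]], of "ball X e"])
    fix y assume "y \<in> ball X e"
    then have "(y, Y) \<in> \<Omega>" using e(2) by (auto simp: subset_iff dist_Pair_Pair)
    then have "dist (\<psi> (y, Y)) (\<psi> (X, Y)) \<le> K * dist (y, Y) (X, Y)"
      using p closure_subset by (intro lipschitz_onD[OF K]) auto
    then show "\<bar>\<psi> (y, Y) - \<psi> (X, Y)\<bar> \<le> K * \<bar>y - X\<bar>" by (simp add: dist_Pair_Pair dist_real_def)
  qed (use e in auto)
qed

lemma nontrivial_at: "p \<in> closure \<Omega> \<Longrightarrow> at p within \<Omega> \<noteq> bot"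
proof (cases "p \<in> \<Omega>")
  case True
  then show ?thesis using at_within_open[OF True open_\<Omega>] by simp
next
  case False
  assume "p \<in> closure \<Omega>"
  with False have "p islimpt \<Omega>" by (simp add: closure_def)
  then show ?thesis by (simp add: trivial_limit_within)
qed

lemma grad_cl_eq: "p \<in> \<Omega> \<Longrightarrow> grad_cl \<Omega> \<psi> p = grad \<psi> p"
  unfolding grad_cl_def
  by (rule tendsto_Lim[OF nontrivial_at])
    (use grad_cont closure_subset in \<open>auto simp: continuous_on_def\<close>)

lemma box_in_\<Omega>_weak_stream:
  assumes cd: "c < d" and int: "{a1..a2} \<times> {c<..<d} \<subseteq> \<Omega>" and cl: "{a1..a2} \<times> {c..d} \<subseteq> closure \<Omega>"
    and P: "\<And>p. p \<in> \<Omega> \<Longrightarrow> P p = fst (grad \<psi> p)" and R: "\<And>p. p \<in> \<Omega> \<Longrightarrow> R p = snd (grad \<psi> p)"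
  shows "weak_stream_box a1 a2 c d B \<gamma> \<gamma>' \<psi> P R"
proof
  let ?I = "{a1..a2} \<times> {c<..<d}"
  show "c < d" by fact
  show "continuous_on {0..B} \<gamma>'" by (rule \<gamma>'_cont)
  show "continuous_on ({a1..a2} \<times> {c..d}) \<psi>" by (rule continuous_on_subset[OF \<psi>_cont cl])
  show "(\<gamma> has_real_derivative \<gamma>' r) (at r within {0..B})" if "r \<in> {0..B}" for r by (rule \<gamma>'[OF that])
  show "continuous_on ?I P"
  proof -
    have "continuous_on ?I (\<lambda>p. fst (grad \<psi> p))"
      by (intro continuous_on_fst continuous_on_subset[OF grad_cont int])
    then show ?thesis by (rule continuous_on_eq) (use P int in auto)
  qed
  show "continuous_on ?I R"
  proof -
    have "continuous_on ?I (\<lambda>p. snd (grad \<psi> p))"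
      by (intro continuous_on_snd continuous_on_subset[OF grad_cont int])
    then show ?thesis by (rule continuous_on_eq) (use R int in auto)
  qed
  fix s t assume "s \<in> {a1..a2}" "t \<in> {c<..<d}"
  then have st: "(s, t) \<in> \<Omega>" using int by auto
  show "0 < \<psi> (s, t) \<and> \<psi> (s, t) < B" using \<psi>_open_range[OF st] by simp
  show "((\<lambda>s. \<psi> (s, t)) has_real_derivative P (s, t)) (at s)"
    unfolding P[OF st] by (rule DERIV_of_grad(1)[OF \<psi>_differentiable[OF st]])
  show "((\<lambda>t. \<psi> (s, t)) has_real_derivative R (s, t)) (at t)"
    unfolding R[OF st] by (rule DERIV_of_grad(2)[OF \<psi>_differentiable[OF st]])
next
  fix A A' D D' :: "real \<Rightarrow> real" and c' d'
  assume c': "c < c'" "c' < d'" "d' < d"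
    and A: "\<And>s. (A has_real_derivative A' s) (at s)" "continuous_on UNIV A'" "\<And>s. s \<notin> {a1..a2} \<Longrightarrow> A s = 0"
    and D: "\<And>t. (D has_real_derivative D' t) (at t)" "continuous_on UNIV D'" "\<And>t. t \<notin> {c'..d'} \<Longrightarrow> D t = 0"
  let ?K = "cbox (a1, c') (a2, d')"
  let ?\<zeta> = "\<lambda>(s, t). A s * D t"
  have K: "?K \<subseteq> \<Omega>" using int c' by (force simp: cbox_Pair_eq)
  have test: "C1_test_fun \<Omega> ?\<zeta>" by (rule product_test_function(1)[OF A D K])
  have grad\<zeta>: "grad ?\<zeta> p = (A' (fst p) * D (snd p), A (fst p) * D' (snd p))" for p
    by (rule product_test_function(2)[OF A D K])
  have Ac: "continuous_on UNIV A" and Dc: "continuous_on UNIV D"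
    using A(1) D(1) by (meson DERIV_isCont continuous_at_imp_continuous_on)+
  have zero: "A' s * D t = 0 \<and> A s * D' t = 0 \<and> A s * D t = 0" if "(s, t) \<notin> ?K" for s t
  proof -
    have "open (- ?K)" by (simp add: open_Compl closed_cbox)
    then obtain e where e: "0 < e" "ball (s, t) e \<subseteq> - ?K" using \<open>(s, t) \<notin> ?K\<close> by (metis ComplI openE)
    have z: "?\<zeta> p = 0" if "p \<in> ball (s, t) e" for p
    proof -
      have "p \<notin> ?K" using e(2) that by blast
      then have "fst p \<notin> {a1..a2} \<or> snd p \<notin> {c'..d'}" by (cases p) (simp add: cbox_Pair_eq)
      then have "A (fst p) = 0 \<or> D (snd p) = 0" using A(3)[of "fst p"] D(3)[of "snd p"] by blast
      then show ?thesis by (auto simp: case_prod_beta)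
    qed
    have "(?\<zeta> has_derivative (\<lambda>_. 0)) (at (s, t))"
      by (rule has_derivative_transform_within_open[OF has_derivative_const[of 0] open_ball[of "(s, t)" e]])
        (use e(1) z in auto)
    from grad_eqI[OF this] show ?thesis using z[of "(s, t)"] e(1) by (simp add: grad\<zeta>)
  qed
  have "(LINT p:\<Omega>|lebesgue. grad \<psi> p \<bullet> grad ?\<zeta> p) = integral ?K (\<lambda>p. grad \<psi> p \<bullet> grad ?\<zeta> p)"
  proof (rule set_lebesgue_integral_eq_integral_cbox[OF K])
    show "continuous_on ?K (\<lambda>p. grad \<psi> p \<bullet> grad ?\<zeta> p)"
      unfolding grad\<zeta>
      by (intro continuous_intros continuous_on_subset[OF grad_cont K] continuous_on_kernel[OF Ac]
          continuous_on_kernel[OF Dc] continuous_on_kernel[OF A(2)] continuous_on_kernel[OF D(2)])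
    show "grad \<psi> p \<bullet> grad ?\<zeta> p = 0" if "p \<in> \<Omega> - ?K" for p
    proof -
      have "(fst p, snd p) \<notin> ?K" using that by simp
      from zero[OF this] have "grad ?\<zeta> p = 0" by (simp add: grad\<zeta> zero_prod_def)
      then show ?thesis by simp
    qed
  qed
  moreover have "(LINT p:\<Omega>|lebesgue. \<gamma> (\<psi> p) * ?\<zeta> p) = integral ?K (\<lambda>p. \<gamma> (\<psi> p) * ?\<zeta> p)"
  proof (rule set_lebesgue_integral_eq_integral_cbox[OF K])
    have "continuous_on ?K (\<lambda>p. \<gamma> (\<psi> p))"
    proof (rule continuous_on_compose2[OF DERIV_continuous_on[OF \<gamma>']])
      show "continuous_on ?K \<psi>" using K closure_subset by (intro continuous_on_subset[OF \<psi>_cont]) blast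
      show "\<psi> ` ?K \<subseteq> {0..B}" using K closure_subset \<psi>_closed_range by blast
    qed
    then show "continuous_on ?K (\<lambda>p. \<gamma> (\<psi> p) * ?\<zeta> p)"
      unfolding case_prod_beta by (intro continuous_intros continuous_on_kernel[OF Ac] continuous_on_kernel[OF Dc])
    show "\<gamma> (\<psi> p) * ?\<zeta> p = 0" if "p \<in> \<Omega> - ?K" for p
    proof -
      have "(fst p, snd p) \<notin> ?K" using that by simp
      from zero[OF this] show ?thesis by (simp add: case_prod_beta)
    qed
  qed
  moreover have "integral ?K (\<lambda>p. grad \<psi> p \<bullet> grad ?\<zeta> p) =
      integral ?K (\<lambda>(s, t). P (s, t) * (A' s * D t) + R (s, t) * (A s * D' t))"
  proof (rule integral_cong)
    fix p assume "p \<in> ?K"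
    then have "p \<in> \<Omega>" using K by blast
    then show "grad \<psi> p \<bullet> grad ?\<zeta> p = (\<lambda>(s, t). P (s, t) * (A' s * D t) + R (s, t) * (A s * D' t)) p"
      by (simp add: grad\<zeta> P R case_prod_beta inner_prod_def)
  qed
  moreover have "integral ?K (\<lambda>p. \<gamma> (\<psi> p) * ?\<zeta> p) = integral ?K (\<lambda>(s, t). \<gamma> (\<psi> (s, t)) * (A s * D t))"
    by (rule integral_cong) (simp add: case_prod_beta)
  ultimately show "integral ?K (\<lambda>(s, t). P (s, t) * (A' s * D t) + R (s, t) * (A s * D' t)) =
      integral ?K (\<lambda>(s, t). \<gamma> (\<psi> (s, t)) * (A s * D t))"
    using \<psi>_weak[OF test] by simp
qed

end

section \<open>The maximum of T\<close>

context water_wave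
begin

definition "shift = (2 * L, 0 :: real)"

lemma free_surface_S: "free_surface L F S"
  using sol by (simp add: classical_solution_def)

lemma surface_gap: obtains \<delta> where "0 < \<delta>" "\<And>X Y. (X, Y) \<in> S \<Longrightarrow> F + \<delta> \<le> Y"
proof -
  obtain u v :: "real \<Rightarrow> real" and \<omega> where S: "S = range (\<lambda>s. (u s, v s))" and v: "continuous_on UNIV v" "\<And>s. F < v s"
    and \<omega>: "0 < \<omega>" "\<And>s. v (s + \<omega>) = v s"
    using free_surface_S unfolding free_surface_def by blast
  interpret v: periodic_fun_simple v \<omega> by unfold_locales (rule \<omega>(2))
  have "continuous_on {0..\<omega>} v" by (rule continuous_on_subset[OF v(1)]) simp
  then have "\<exists>s0\<in>{0..\<omega>}. \<forall>s\<in>{0..\<omega>}. v s0 \<le> v s"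
    using \<omega>(1) by (intro continuous_attains_inf) auto
  then obtain s0 where s0: "\<And>s. s \<in> {0..\<omega>} \<Longrightarrow> v s0 \<le> v s" by blast
  have "v s0 \<le> v s" for s
  proof -
    define n where "n = \<lfloor>s / \<omega>\<rfloor>"
    have "of_int n \<le> s / \<omega>" "s / \<omega> \<le> of_int n + 1" unfolding n_def by linarith+
    then have "of_int n * \<omega> \<le> s" "s \<le> (of_int n + 1) * \<omega>"
      using \<omega>(1) by (simp_all add: pos_le_divide_eq pos_divide_le_eq)
    then have "s - of_int n * \<omega> \<in> {0..\<omega>}" by (simp add: algebra_simps)
    from s0[OF this] show ?thesis using v.minus_of_int[of s n] by simp
  qed
  then show ?thesis using that[of "v s0 - F"] v(2)[of s0] S by auto
qed

text \<open>A strip above the bed does not meet the boundary of \<open>\<Omega>\<close> and contains points of \<open>\<Omega>\<close>, since the bed lies in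
the closure of \<open>\<Omega>\<close>.\<close>

lemma bed_strip: obtains \<delta> where "0 < \<delta>" "UNIV \<times> {F<..<F + \<delta>} \<subseteq> \<Omega>"
proof -
  obtain \<delta> where \<delta>: "0 < \<delta>" "\<And>X Y. (X, Y) \<in> S \<Longrightarrow> F + \<delta> \<le> Y" by (rule surface_gap, rule that)
  let ?U = "(UNIV :: real set) \<times> {F<..<F + \<delta>}"
  have "(0, F) \<in> closure \<Omega>" by (simp add: closure_\<Omega> bed_def)
  then obtain p where p: "p \<in> \<Omega>" "dist p (0, F) < \<delta>" using \<delta>(1) by (meson closure_approachable)
  have "dist (snd p) F \<le> dist p (0, F)" using dist_snd_le[of p "(0, F)"] by simp
  then have "snd p < F + \<delta>" using p(2) by (simp add: dist_real_def)
  then have "p \<in> ?U" using above_bed[OF p(1)] by (simp add: mem_Times_iff)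
  then have "?U \<inter> \<Omega> \<noteq> {}" using p(1) by blast
  moreover have "?U \<inter> frontier \<Omega> = {}" using \<delta>(2) by (fastforce simp: frontier_\<Omega> bed_def)
  moreover have "connected ?U" by (intro connected_Times) auto
  ultimately have "?U - \<Omega> = {}" using connected_Int_frontier by blast
  then show ?thesis using that[of \<delta>] \<delta>(1) by blast
qed

lemma surface_shift: "(+) shift ` S = S"
proof -
  obtain u v :: "real \<Rightarrow> real" and \<omega> where S: "S = range (\<lambda>s. (u s, v s))"
    and \<omega>: "0 < \<omega>" "\<And>s. u (s + \<omega>) = u s + 2 * L \<and> v (s + \<omega>) = v s"
    using free_surface_S unfolding free_surface_def by blast
  have "shift + (u s, v s) = (u (s + \<omega>), v (s + \<omega>))" for s by (simp add: \<omega>(2) shift_def)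
  then have "(+) shift ` S = range (\<lambda>s. (u (s + \<omega>), v (s + \<omega>)))" by (simp add: S image_image)
  also have "\<dots> = (\<lambda>s. (u s, v s)) ` range (\<lambda>s. s + \<omega>)" by (simp only: image_image)
  also have "range (\<lambda>s. s + \<omega>) = UNIV" by (rule surjI[of _ "\<lambda>s. s - \<omega>"]) simp
  finally show ?thesis by (simp add: S)
qed

text \<open>Both \<open>\<Omega>\<close> and its translate are connected open sets with the same frontier, and both contain a
strip above the bed.\<close>

lemma \<Omega>_shift: "(+) shift ` \<Omega> = \<Omega>"
proof -
  let ?\<Omega>' = "(+) shift ` \<Omega>"
  have bed: "(+) shift ` bed F = bed F"
    by (auto simp: bed_def shift_def image_def intro!: exI[of _ "_ - 2 * L"])
  have fr: "frontier ?\<Omega>' = frontier \<Omega>"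
    by (simp add: frontier_translation frontier_\<Omega> image_Un surface_shift bed)
  have op: "open ?\<Omega>'" by (rule open_translation[OF open_\<Omega>])
  have co: "connected ?\<Omega>'" by (intro connected_continuous_image connected_\<Omega> continuous_intros)
  obtain \<delta> where \<delta>: "0 < \<delta>" "UNIV \<times> {F<..<F + \<delta>} \<subseteq> \<Omega>" by (rule bed_strip, rule that)
  have "(0, F + \<delta> / 2) \<in> \<Omega>" "(- 2 * L, F + \<delta> / 2) \<in> \<Omega>" using \<delta> by auto
  moreover from this(2) have "(0, F + \<delta> / 2) \<in> ?\<Omega>'"
    by (intro image_eqI[of _ _ "(- 2 * L, F + \<delta> / 2)"]) (auto simp: shift_def)
  ultimately have ne: "?\<Omega>' \<inter> \<Omega> \<noteq> {}" by blast
  have disj: "\<Omega> \<inter> frontier \<Omega> = {}" "?\<Omega>' \<inter> frontier ?\<Omega>' = {}"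
    using op open_\<Omega> by (auto simp: frontier_def interior_open)
  have "?\<Omega>' - \<Omega> = {}" using connected_Int_frontier[OF co ne] disj(2) fr by blast
  moreover have "\<Omega> - ?\<Omega>' = {}" using connected_Int_frontier[OF connected_\<Omega>, of ?\<Omega>'] ne disj(1) fr by blast
  ultimately show ?thesis by blast
qed

lemma shift_mem: "shift + p \<in> \<Omega> \<longleftrightarrow> p \<in> \<Omega>" "shift + p \<in> closure \<Omega> \<longleftrightarrow> p \<in> closure \<Omega>"
proof -
  show "shift + p \<in> \<Omega> \<longleftrightarrow> p \<in> \<Omega>" using \<Omega>_shift by (metis add_left_cancel imageE image_eqI)
  have "(+) shift ` closure \<Omega> = closure \<Omega>" using closure_translation[of shift \<Omega>] \<Omega>_shift by simp
  then show "shift + p \<in> closure \<Omega> \<longleftrightarrow> p \<in> closure \<Omega>" by (metis add_left_cancel imageE image_eqI)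
qed

lemma \<psi>_shift: "p \<in> closure \<Omega> \<Longrightarrow> \<psi> (shift + p) = \<psi> p"
  using \<psi>_periodic[of "fst p" "snd p"] by (cases p) (simp add: shift_def add.commute)

lemma grad_shift:
  assumes p: "p \<in> \<Omega>"
  shows "grad \<psi> (shift + p) = grad \<psi> p"
proof -
  define D where "D = frechet_derivative \<psi> (at (shift + p))"
  have D: "(\<psi> has_derivative D) (at (shift + p))"
    using \<psi>_differentiable[of "shift + p"] p by (simp add: D_def frechet_derivative_works shift_mem)
  have "((\<lambda>q. \<psi> (shift + q)) has_derivative (\<lambda>h. D h)) (at p)"
    by (rule has_derivative_compose[where f = "\<lambda>q. shift + q" and g = \<psi>, OF _ D]) (auto intro!: derivative_eq_intros)
  then have "(\<psi> has_derivative D) (at p)"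
    by (rule has_derivative_transform_within_open[OF _ open_\<Omega> p]) (use \<psi>_shift closure_subset in blast)
  then show ?thesis by (simp add: grad_eqI[OF D] grad_eqI)
qed

lemma grad_limit_bed:
  assumes "p \<in> bed F"
  shows "\<exists>l. (grad \<psi> \<longlongrightarrow> l) (at p within \<Omega>)"
proof -
  obtain a where p: "p = (a, F)" using assms by (auto simp: bed_def)
  obtain \<eta> where \<eta>: "0 < \<eta>" "UNIV \<times> {F<..<F + \<eta>} \<subseteq> \<Omega>" by (rule bed_strip, rule that)
  obtain K where K: "K-lipschitz_on (closure \<Omega>) \<psi>" by (rule \<psi>_lipschitz, rule that)
  have K0: "0 \<le> K" by (rule lipschitz_on_nonneg[OF K])
  define d where "d = F + \<eta> / 2"
  define P where "P p = fst (grad \<psi> p)" for p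
  define R where "R p = snd (grad \<psi> p)" for p
  have int: "{a - 1..a + 1} \<times> {F<..<d} \<subseteq> \<Omega>" using \<eta> by (auto simp: d_def)
  have cl: "{a - 1..a + 1} \<times> {F..d} \<subseteq> closure \<Omega>"
  proof
    fix q assume q: "q \<in> {a - 1..a + 1} \<times> {F..d}"
    show "q \<in> closure \<Omega>"
    proof (cases "snd q = F")
      case True
      then show ?thesis by (cases q) (simp add: closure_\<Omega> bed_def)
    next
      case False
      then have "q \<in> UNIV \<times> {F<..<F + \<eta>}" using q \<eta>(1) by (auto simp: d_def)
      then show ?thesis using \<eta>(2) closure_subset by blast
    qed
  qed
  have "compact (\<gamma> ` {0..B})" by (intro compact_continuous_image DERIV_continuous_on[OF \<gamma>']) auto
  then obtain G0 where G0: "\<And>r. r \<in> {0..B} \<Longrightarrow> \<bar>\<gamma> r\<bar> \<le> G0"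
    using compact_imp_bounded bounded_iff by (metis image_eqI real_norm_def)
  have "compact (\<gamma>' ` {0..B})" by (intro compact_continuous_image \<gamma>'_cont) auto
  then obtain G1 where G1: "\<And>r. r \<in> {0..B} \<Longrightarrow> \<bar>\<gamma>' r\<bar> \<le> G1"
    using compact_imp_bounded bounded_iff by (metis image_eqI real_norm_def)
  have G1_nonneg: "0 \<le> G1" using G1[of 0] B by (auto intro: order_trans[OF abs_ge_zero])
  define \<delta> where "\<delta> = min (1 / 5) (\<eta> / 4)"
  have \<delta>: "0 < \<delta>" "\<delta> \<le> 1 / 5" "\<delta> \<le> \<eta> / 4" using \<eta> by (auto simp: \<delta>_def)
  interpret box: weak_stream_box "a - 1" "a + 1" F d B \<gamma> \<gamma>' \<psi> P R
    by (rule box_in_\<Omega>_weak_stream[OF _ int cl]) (use \<eta> in \<open>auto simp: d_def P_def R_def\<close>)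
  have in\<Omega>: "(s, t) \<in> \<Omega>" if "s \<in> {a - 1..a + 1}" "t \<in> {F<..<d}" for s t using int that by auto
  interpret box: bed_box "a - 1" "a + 1" F d B \<gamma> \<gamma>' \<psi> P R K G0 "G1 * K" a \<delta>
  proof
    show "\<psi> (s, F) = B" for s by (rule \<psi>_bed) (simp add: bed_def)
    show "0 \<le> K" by fact
    show "0 \<le> G1 * K" using G1_nonneg K0 by simp
    show "0 < \<delta>" "a - 1 \<le> a - 5 * \<delta>" "a + 5 * \<delta> \<le> a + 1" "F + 2 * \<delta> \<le> d" using \<delta> by (auto simp: d_def)
    fix s t assume st: "s \<in> {a - 1..a + 1}" "t \<in> {F<..<d}"
    have r: "\<psi> (s, t) \<in> {0..B}" using \<psi>_closed_range[of "(s, t)"] in\<Omega>[OF st] closure_subset by blast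
    show Pb: "\<bar>P (s, t)\<bar> \<le> K" unfolding P_def by (rule grad_bound[OF K in\<Omega>[OF st]])
    show "\<bar>\<gamma> (\<psi> (s, t))\<bar> \<le> G0" by (rule G0[OF r])
    show "\<bar>\<gamma>' (\<psi> (s, t)) * P (s, t)\<bar> \<le> G1 * K"
      unfolding abs_mult by (rule mult_mono[OF G1[OF r] Pb G1_nonneg]) simp
  qed
  obtain l where l: "(R \<longlongrightarrow> l) (at (a, F) within {a - 1..a + 1} \<times> {F<..<d})"
    using box.R_limit by blast
  have "((\<lambda>p. (P p, R p)) \<longlongrightarrow> (0, l)) (at (a, F) within {a - 1..a + 1} \<times> {F<..<d})"
    by (rule tendsto_Pair[OF box.P_limit l])
  moreover have "(\<lambda>p. (P p, R p)) = grad \<psi>" by (simp add: P_def R_def fun_eq_iff)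
  moreover have "at (a, F) within {a - 1..a + 1} \<times> {F<..<d} = at (a, F) within \<Omega>"
  proof (rule at_within_nhd)
    let ?N = "{a - 1<..<a + 1} \<times> {..<d}"
    show "(a, F) \<in> ?N" using \<eta> by (simp add: d_def)
    show "open ?N" by (intro open_Times) auto
    have "\<Omega> \<inter> ?N \<subseteq> {a - 1..a + 1} \<times> {F<..<d}" using above_bed by fastforce
    then show "{a - 1..a + 1} \<times> {F<..<d} \<inter> ?N - {(a, F)} = \<Omega> \<inter> ?N - {(a, F)}" using int by blast
  qed
  ultimately show ?thesis unfolding p by auto
qed

lemma grad_limit:
  assumes p: "p \<in> closure \<Omega>"
  shows "\<exists>l. (grad \<psi> \<longlongrightarrow> l) (at p within \<Omega>)"
proof (cases "p \<in> bed F")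
  case True
  then show ?thesis by (rule grad_limit_bed)
next
  case False
  then have p': "p \<in> \<Omega> \<union> S" using p closure_\<Omega> by auto
  obtain G where G: "continuous_on (\<Omega> \<union> S) G" "\<And>p. p \<in> \<Omega> \<Longrightarrow> G p = grad \<psi> p"
    by (rule grad_extension, rule that)
  have "(G \<longlongrightarrow> G p) (at p within \<Omega>)"
    using G(1) p' by (meson continuous_on_def tendsto_within_subset sup_ge1)
  moreover have "\<forall>\<^sub>F q in at p within \<Omega>. G q = grad \<psi> q"
    using G(2) by (auto simp: eventually_at_filter)
  ultimately show ?thesis using tendsto_cong by blast
qed

lemma grad_cl_cont: "continuous_on (closure \<Omega>) (grad_cl \<Omega> \<psi>)"
  using continuous_on_Lim_closure[OF grad_limit nontrivial_at]
  by (simp add: grad_cl_def[abs_def])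

lemma grad_cl_shift:
  assumes p: "p \<in> closure \<Omega>"
  shows "grad_cl \<Omega> \<psi> (shift + p) = grad_cl \<Omega> \<psi> p"
proof -
  have "continuous_on (closure \<Omega>) (\<lambda>p. grad_cl \<Omega> \<psi> (shift + p) - grad_cl \<Omega> \<psi> p)"
    by (intro continuous_intros continuous_on_compose2[OF grad_cl_cont, of _ "\<lambda>p. shift + p"])
      (auto simp: shift_mem intro!: grad_cl_cont)
  from continuous_constant_on_closure[OF this _ p, of 0]
  have "grad_cl \<Omega> \<psi> (shift + p) - grad_cl \<Omega> \<psi> p = 0"
    by (simp add: grad_cl_eq shift_mem grad_shift)
  then show ?thesis by simp
qed

lemma snd_grad_cl_nonpos:
  assumes "p \<in> closure \<Omega>"
  shows "snd (grad_cl \<Omega> \<psi> p) \<le> 0"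
  by (rule continuous_le_on_closure[OF continuous_on_snd[OF grad_cl_cont] assms])
    (use decreasing grad_cl_eq in \<open>auto intro: less_imp_le\<close>)

lemma \<gamma>_cont: "continuous_on {0..B} \<gamma>"
  by (rule DERIV_continuous_on[OF \<gamma>'])

lemma varpi_nonneg: "0 \<le> varpi B \<gamma>"
  by (simp add: varpi_def)

lemma \<gamma>_le_varpi:
  assumes "r \<in> {0..B}"
  shows "\<gamma> r \<le> 2 * varpi B \<gamma>"
proof -
  have "bdd_above (\<gamma> ` {0..B})"
    by (intro bounded_imp_bdd_above compact_imp_bounded compact_continuous_image \<gamma>_cont) auto
  from cSUP_upper[OF assms this] show ?thesis by (simp add: varpi_def)
qed

lemma Gamma_hat_deriv:
  assumes "r \<in> {0..B}"
  shows "(Gamma_hat \<gamma> has_real_derivative \<gamma> r) (at r within {0..B})"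
  unfolding Gamma_hat_def[abs_def] by (rule integral_has_real_derivative[OF \<gamma>_cont assms])

lemma Gamma_hat_cont: "continuous_on {0..B} (Gamma_hat \<gamma>)"
  by (rule DERIV_continuous_on[OF Gamma_hat_deriv])

abbreviation "T\<^sub>\<psi> \<equiv> T_fun g B \<gamma> \<Omega> Q \<psi>"

lemma T_cont: "continuous_on (closure \<Omega>) T\<^sub>\<psi>"
proof -
  have "continuous_on (closure \<Omega>) (\<lambda>p. Gamma_hat \<gamma> (\<psi> p))"
    by (rule continuous_on_compose2[OF Gamma_hat_cont \<psi>_cont]) (use \<psi>_closed_range in blast)
  then show ?thesis unfolding T_fun_def[abs_def]
    by (intro continuous_intros grad_cl_cont \<psi>_cont)
qed

lemma T_shift: "p \<in> closure \<Omega> \<Longrightarrow> T\<^sub>\<psi> (shift + p) = T\<^sub>\<psi> p"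
  by (simp add: T_fun_def grad_cl_shift \<psi>_shift) (simp add: shift_def)

lemma T_surface: "p \<in> S \<Longrightarrow> T\<^sub>\<psi> p = 0"
proof -
  assume p: "p \<in> S"
  then have "(norm (grad_cl \<Omega> \<psi> p))\<^sup>2 + 2 * g * snd p = Q"
    using sol by (auto simp: classical_solution_def)
  then show ?thesis using \<psi>_surface[OF p] by (simp add: T_fun_def Gamma_hat_def)
qed

text \<open>By periodicity it suffices to consider the compact part of the closure over one period.\<close>

lemma T_attains_max: obtains p where "p \<in> closure \<Omega>" "\<And>q. q \<in> closure \<Omega> \<Longrightarrow> T\<^sub>\<psi> q \<le> T\<^sub>\<psi> p"
proof -
  obtain H where H: "\<And>p. p \<in> \<Omega> \<Longrightarrow> snd p \<le> H" using bdd_\<Omega> by (auto simp: bdd_above_def)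
  define Z where "Z = closure \<Omega> \<inter> cbox (0, F) (2 * L, H)"
  have cl: "F \<le> snd p \<and> snd p \<le> H" if "p \<in> closure \<Omega>" for p
  proof -
    have "closure \<Omega> \<subseteq> {p. F \<le> snd p \<and> snd p \<le> H}"
      by (rule closure_minimal)
        (use above_bed H in \<open>auto simp: less_imp_le intro!: closed_Collect_conj closed_Collect_le continuous_intros\<close>)
    then show ?thesis using that by blast
  qed
  have red: "\<exists>q\<in>Z. T\<^sub>\<psi> q = T\<^sub>\<psi> p" if p: "p \<in> closure \<Omega>" for p
  proof -
    obtain X Y where XY: "p = (X, Y)" by (cases p)
    \<comment> \<open>Coding membership in the closure into the value makes a periodic function on all of \<open>\<real>\<close>.\<close>
    define f where "f x = (if (x, Y) \<in> closure \<Omega> then Some (T\<^sub>\<psi> (x, Y)) else None)" for x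
    have sh: "(x + 2 * L, Y) = shift + (x, Y)" for x by (simp add: shift_def)
    interpret f: periodic_fun_simple f "2 * L"
      by unfold_locales (simp add: f_def sh shift_mem T_shift)
    define n where "n = \<lfloor>X / (2 * L)\<rfloor>"
    have "of_int n \<le> X / (2 * L)" "X / (2 * L) \<le> of_int n + 1" unfolding n_def by linarith+
    then have n: "of_int n * (2 * L) \<le> X" "X \<le> (of_int n + 1) * (2 * L)"
      using L by (simp_all add: pos_le_divide_eq pos_divide_le_eq)
    have "f (X - of_int n * (2 * L)) = f X" by (rule f.minus_of_int)
    then have "(X - of_int n * (2 * L), Y) \<in> closure \<Omega> \<and> T\<^sub>\<psi> (X - of_int n * (2 * L), Y) = T\<^sub>\<psi> p"
      using p by (auto simp: f_def XY split: if_splits)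
    then show ?thesis
      using n cl[OF p] by (intro bexI[of _ "(X - of_int n * (2 * L), Y)"]) (auto simp: Z_def XY cbox_Pair_eq algebra_simps)
  qed
  have "compact Z" unfolding Z_def by (intro closed_Int_compact) auto
  moreover have "Z \<noteq> {}"
  proof -
    have "(0, F) \<in> closure \<Omega>" by (simp add: closure_\<Omega> bed_def)
    from red[OF this] show ?thesis by blast
  qed
  moreover have "continuous_on Z T\<^sub>\<psi>" by (rule continuous_on_subset[OF T_cont]) (simp add: Z_def)
  ultimately have "\<exists>p\<in>Z. \<forall>q\<in>Z. T\<^sub>\<psi> q \<le> T\<^sub>\<psi> p" by (intro continuous_attains_sup)
  then obtain p where p: "p \<in> Z" "\<And>q. q \<in> Z \<Longrightarrow> T\<^sub>\<psi> q \<le> T\<^sub>\<psi> p" by blast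
  have "T\<^sub>\<psi> q \<le> T\<^sub>\<psi> p" if q: "q \<in> closure \<Omega>" for q
    using red[OF q] p(2) by metis
  then show ?thesis using that[of p] p(1) by (simp add: Z_def)
qed

text \<open>Around a point of \<open>\<Omega>\<close> the rectangle is taken inside \<open>\<Omega>\<close>; around a point of the bed its lower side lies
on the bed.\<close>

lemma no_max_off_surface:
  assumes p: "p \<in> closure \<Omega>" "p \<notin> S" and max: "\<And>q. q \<in> closure \<Omega> \<Longrightarrow> T\<^sub>\<psi> q \<le> T\<^sub>\<psi> p"
  shows False
proof -
  obtain a b where ab: "p = (a, b)" by (cases p)
  have "\<exists>r>0. \<exists>c d. c \<le> b \<and> b < d \<and> (b = c \<longrightarrow> c = F) \<and> {a - r..a + r} \<times> {c<..<d} \<subseteq> \<Omega> \<and> {a - r..a + r} \<times> {c..d} \<subseteq> closure \<Omega>"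
  proof (cases "p \<in> \<Omega>")
    case True
    obtain e where e: "0 < e" "ball p e \<subseteq> \<Omega>" using True open_\<Omega> by (meson openE)
    have "{a - e / 3..a + e / 3} \<times> {b - e / 3..b + e / 3} \<subseteq> \<Omega>"
    proof
      fix q assume q: "q \<in> {a - e / 3..a + e / 3} \<times> {b - e / 3..b + e / 3}"
      have "dist p q \<le> dist a (fst q) + dist b (snd q)"
        unfolding ab by (cases q) (simp add: dist_Pair_Pair sqrt_sum_squares_le_sum)
      also have "\<dots> < e" using q e(1) by (auto simp: dist_real_def abs_le_iff)
      finally show "q \<in> \<Omega>" using e(2) by auto
    qed
    then have "{a - e / 3..a + e / 3} \<times> {b - e / 3<..<b + e / 3} \<subseteq> \<Omega>"
      "{a - e / 3..a + e / 3} \<times> {b - e / 3..b + e / 3} \<subseteq> closure \<Omega>"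
      using closure_subset by fastforce+
    then show ?thesis using e(1)
      by (intro exI[of _ "e / 3"] conjI exI[of _ "b - e / 3"] exI[of _ "b + e / 3"]) auto
  next
    case False
    then have b: "b = F" using p closure_\<Omega> ab by (auto simp: bed_def)
    obtain \<eta> where \<eta>: "0 < \<eta>" "UNIV \<times> {F<..<F + \<eta>} \<subseteq> \<Omega>" by (rule bed_strip, rule that)
    have "{a - 1..a + 1} \<times> {F..F + \<eta> / 2} \<subseteq> closure \<Omega>"
    proof
      fix q assume q: "q \<in> {a - 1..a + 1} \<times> {F..F + \<eta> / 2}"
      show "q \<in> closure \<Omega>"
      proof (cases "snd q = F")
        case True
        then show ?thesis by (cases q) (simp add: closure_\<Omega> bed_def)
      next
        case False
        then have "q \<in> UNIV \<times> {F<..<F + \<eta>}" using q \<eta>(1) by auto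
        then show ?thesis using \<eta>(2) closure_subset by blast
      qed
    qed
    moreover have "{a - 1..a + 1} \<times> {F<..<F + \<eta> / 2} \<subseteq> \<Omega>" using \<eta> by auto
    ultimately show ?thesis using \<eta>(1) b
      by (intro exI[of _ 1] conjI exI[of _ F] exI[of _ "F + \<eta> / 2"]) auto
  qed
  then obtain r c d where r: "0 < r" and cd: "c \<le> b" "b < d" "b = c \<Longrightarrow> c = F"
    and int: "{a - r..a + r} \<times> {c<..<d} \<subseteq> \<Omega>" and cl: "{a - r..a + r} \<times> {c..d} \<subseteq> closure \<Omega>"
    by blast
  define P where "P p = fst (grad_cl \<Omega> \<psi> p)" for p
  define R where "R p = snd (grad_cl \<Omega> \<psi> p)" for p
  interpret box: weak_stream_box "a - r" "a + r" c d B \<gamma> \<gamma>' \<psi> P R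
    by (rule box_in_\<Omega>_weak_stream[OF _ int cl]) (use cd in \<open>auto simp: P_def R_def grad_cl_eq\<close>)
  interpret box: bernoulli_box "a - r" "a + r" c d B \<gamma> \<gamma>' \<psi> P R g "varpi B \<gamma>" "Gamma_hat \<gamma>"
  proof
    have gc: "continuous_on ({a - r..a + r} \<times> {c..d}) (grad_cl \<Omega> \<psi>)"
      by (rule continuous_on_subset[OF grad_cl_cont cl])
    show "continuous_on ({a - r..a + r} \<times> {c..d}) P" unfolding P_def by (rule continuous_on_fst[OF gc])
    show "continuous_on ({a - r..a + r} \<times> {c..d}) R" unfolding R_def by (rule continuous_on_snd[OF gc])
    show "R q \<le> 0" if "q \<in> {a - r..a + r} \<times> {c..d}" for q
      unfolding R_def using that cl by (intro snd_grad_cl_nonpos) blast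
    show "(Gamma_hat \<gamma> has_real_derivative \<gamma> s) (at s)" if "s \<in> {0<..<B}" for s
    proof -
      have "s \<in> interior {0..B}" using that by simp
      then have "at s within {0..B} = at s" by (rule at_within_interior)
      moreover have "s \<in> {0..B}" using that by auto
      ultimately show ?thesis using Gamma_hat_deriv by metis
    qed
  qed (rule g varpi_nonneg \<gamma>_le_varpi Gamma_hat_cont; assumption?)+
  have T: "T\<^sub>\<psi> q = box.T q - Q / 2" for q
  proof -
    have "(norm (grad_cl \<Omega> \<psi> q))\<^sup>2 = (P q)\<^sup>2 + (R q)\<^sup>2"
      unfolding P_def R_def by (cases "grad_cl \<Omega> \<psi> q") (simp add: norm_Pair)
    then show ?thesis by (simp add: T_fun_def box.T_def)
  qed
  show False
  proof (rule box.no_maximum[of a b])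
    show "a - r < a" "a < a + r" "c \<le> b" "b < d" using r cd by auto
    show "b = c \<Longrightarrow> \<forall>s\<in>{a - r..a + r}. \<psi> (s, c) = B" using cd(3) \<psi>_bed by (simp add: bed_def)
    show "box.T q \<le> box.T (a, b)" if "q \<in> {a - r..a + r} \<times> {c..d}" for q
      using max[of q] that cl by (auto simp: T ab)
  qed
qed

theorem T_nonpos: "p \<in> closure \<Omega> \<Longrightarrow> T\<^sub>\<psi> p \<le> 0"
proof -
  assume p: "p \<in> closure \<Omega>"
  obtain q where q: "q \<in> closure \<Omega>" "\<And>p. p \<in> closure \<Omega> \<Longrightarrow> T\<^sub>\<psi> p \<le> T\<^sub>\<psi> q" by (rule T_attains_max, rule that)
  have "q \<in> S" using no_max_off_surface[OF q(1) _ q(2)] by blast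
  then show "T\<^sub>\<psi> p \<le> 0" using q(2)[OF p] T_surface by simp
qed

end

theorem theorem3p1:
  fixes g B L \<alpha> F Q :: real
    and \<gamma> :: "real \<Rightarrow> real"
    and S \<Omega> :: "(real \<times> real) set"
    and \<psi> :: "real \<times> real \<Rightarrow> real"
  assumes "g > 0" "B > 0" "L > 0"
    and "0 < \<alpha>" "\<alpha> < 1"
    and "C1_holder_on \<alpha> {0..B} \<gamma>"
    and "classical_solution g B L \<gamma> S F \<Omega> \<psi> Q"
    and "\<forall>p\<in>\<Omega>. snd (grad \<psi> p) < 0"
  shows "\<forall>p\<in>closure \<Omega>. T_fun g B \<gamma> \<Omega> Q \<psi> p \<le> 0"
proof -
  obtain \<gamma>' where "\<And>r. r \<in> {0..B} \<Longrightarrow> (\<gamma> has_real_derivative \<gamma>' r) (at r within {0..B})"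
    and "continuous_on {0..B} \<gamma>'"
    by (rule C1_holder_on_imp_C1[OF assms(6,4)], rule that)
  then interpret water_wave g B L F Q \<gamma> \<gamma>' S \<Omega> \<psi>
    using assms by unfold_locales auto
  show ?thesis using T_nonpos by blast
qed

end
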